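(* Let $B \subset \mathbb{C}$ be a horizontal strip of height at least $\pi$, let $p$ be a holomorphic function on $B$, and consider the Hill's operator \[ \mathcal{H} = \left(\frac{d}{dz}\right)^2 - \left(\frac{1}{4} + \frac{p}{2}\right) \] on $B$. Let $\ell$ be the function on $B$ that gives the (Euclidean) distance to the edge of $B$. Suppose that at every point of $B$ \[ \left|\frac{p}{2}\right| < \begin{cases} \left(\frac{1}{2 \sin \ell}\right)^2 & \ell \le \frac{\pi}{2} \\ \frac{1}{4} & \ell \ge \frac{\pi}{2}. \end{cases} \] Then there is a conformal map $y : B \to \mathbb{C}$ with the following properties. (1) $y$ extends to a topological embedding $\hat{B} \to \hat{\mathbb{C}}$ which fixes $-\infty$ and $+\infty$. (2) $y$ is a Liouville transformation that relates $\mathcal{H}$ to the operator $\left(\frac{d}{dz}\right)^2 - \frac{1}{4}$. In other words, \[ \mathcal{H} = y_z^{3/2} \circ \left[ \left(\frac{d}{dy}\right)^2 - \frac{1}{4} \right] \circ y_z^{1/2}. \]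
   Context: The doubly extended plane $\hat{\mathbb{C}}$ is the set $\mathbb{C} \cup \{-\infty, +\infty\}$, topologized so that $\mathbb{C}$ is an open subset with its usual topology, the sets $\{-\infty\} \cup \{z \in \mathbb{C} : \Re z < c\}$, $c \in \mathbb{R}$, form a neighborhood basis of $-\infty$, and the sets $\{+\infty\} \cup \{z \in \mathbb{C} : \Re z > c\}$, $c \in \mathbb{R}$, form a neighborhood basis of $+\infty$. For a horizontal strip $B \subset \mathbb{C}$ (an open set), $\hat{B}$ denotes the closure of $B$ in $\hat{\mathbb{C}}$; it comprises the strip $B$, the edges of the strip, and the points $-\infty$ and $+\infty$. A conformal map is a holomorphic map with nowhere vanishing derivative. Here $z$ is the standard coordinate on $\mathbb{C}$, $y_z = dy/dz$, and $\frac{d}{dy} = \frac{1}{y_z}\frac{d}{dz}$. The symbol $y_z^{1/2}$ denotes a holomorphic square root of $y_z$ on $B$, and $y_z^{3/2} = (y_z^{1/2})^3$; functions appearing in compositions of operators act by multiplication. The equality in (2) is an equality of differential operators acting on holomorphic functions on (open subsets of) $B$. *)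

theory Defs
  imports "HOL-Complex_Analysis.Complex_Analysis"
begin

datatype ext_plane = Fin complex | Minus_Inf | Plus_Inf

instantiation ext_plane :: topological_space
begin

definition open_ext_plane :: "ext_plane set \<Rightarrow> bool" where
  "open_ext_plane U \<longleftrightarrow>
     open (Fin -` U) \<and>
     (Minus_Inf \<in> U \<longrightarrow> (\<exists>c. Fin ` {z. Re z < c} \<subseteq> U)) \<and>
     (Plus_Inf \<in> U \<longrightarrow> (\<exists>c. Fin ` {z. Re z > c} \<subseteq> U))"

instance
proof
  show "open (UNIV :: ext_plane set)"
    by (simp add: open_ext_plane_def)
next
  fix S T :: "ext_plane set"
  assume S: "open S" and T: "open T"
  have "open (Fin -` S \<inter> Fin -` T)"
    using S T by (intro open_Int) (simp_all add: open_ext_plane_def)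
  then have "open (Fin -` (S \<inter> T))"
    by (simp only: vimage_Int)
  moreover have "\<exists>c. Fin ` {z. Re z < c} \<subseteq> S \<inter> T" if mem: "Minus_Inf \<in> S \<inter> T"
  proof -
    from S mem obtain c where c: "Fin ` {z. Re z < c} \<subseteq> S"
      by (auto simp only: open_ext_plane_def Int_iff)
    from T mem obtain d where d: "Fin ` {z. Re z < d} \<subseteq> T"
      by (auto simp only: open_ext_plane_def Int_iff)
    have "Fin ` {z. Re z < min c d} \<subseteq> S \<inter> T"
      using c d by (simp add: image_subset_iff)
    then show ?thesis ..
  qed
  moreover have "\<exists>c. Fin ` {z. Re z > c} \<subseteq> S \<inter> T" if mem: "Plus_Inf \<in> S \<inter> T"
  proof -
    from S mem obtain c where c: "Fin ` {z. Re z > c} \<subseteq> S"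
      by (auto simp only: open_ext_plane_def Int_iff)
    from T mem obtain d where d: "Fin ` {z. Re z > d} \<subseteq> T"
      by (auto simp only: open_ext_plane_def Int_iff)
    have "Fin ` {z. Re z > max c d} \<subseteq> S \<inter> T"
      using c d by (simp add: image_subset_iff)
    then show ?thesis ..
  qed
  ultimately show "open (S \<inter> T)"
    unfolding open_ext_plane_def by (intro conjI impI)
next
  fix K :: "ext_plane set set"
  assume K: "\<forall>S\<in>K. open S"
  have "open (\<Union>S\<in>K. Fin -` S)"
    using K by (intro open_UN) (simp add: open_ext_plane_def)
  then have "open (Fin -` \<Union>K)"
    by (simp only: vimage_Union)
  moreover have "\<exists>c. Fin ` {z. Re z < c} \<subseteq> \<Union>K" if mem: "Minus_Inf \<in> \<Union>K"
  proof -
    from mem obtain S where S: "S \<in> K" "Minus_Inf \<in> S" ..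
    then have "open S" using K by simp
    with S obtain c where "Fin ` {z. Re z < c} \<subseteq> S"
      by (auto simp only: open_ext_plane_def)
    also have "S \<subseteq> \<Union>K" using S(1) by (rule Union_upper)
    finally show ?thesis ..
  qed
  moreover have "\<exists>c. Fin ` {z. Re z > c} \<subseteq> \<Union>K" if mem: "Plus_Inf \<in> \<Union>K"
  proof -
    from mem obtain S where S: "S \<in> K" "Plus_Inf \<in> S" ..
    then have "open S" using K by simp
    with S obtain c where "Fin ` {z. Re z > c} \<subseteq> S"
      by (auto simp only: open_ext_plane_def)
    also have "S \<subseteq> \<Union>K" using S(1) by (rule Union_upper)
    finally show ?thesis ..
  qed
  ultimately show "open (\<Union>K)"
    unfolding open_ext_plane_def by (intro conjI impI)
qed

end

definition horizontal_strip :: "real \<Rightarrow> real \<Rightarrow> complex set" where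
  "horizontal_strip a b = {z. a < Im z \<and> Im z < b}"

definition hat :: "complex set \<Rightarrow> ext_plane set" where
  "hat B = closure (Fin ` B)"

lemma hat_horizontal_strip:
  assumes "a < b"
  shows "hat (horizontal_strip a b) =
           Fin ` {z. a \<le> Im z \<and> Im z \<le> b} \<union> {Minus_Inf, Plus_Inf}"
proof -
  let ?B = "horizontal_strip a b"
  let ?C = "{z. a \<le> Im z \<and> Im z \<le> b}"
  define m where "m = (a + b) / 2"
  have m: "a < m" "m < b" using assms by (auto simp: m_def)
  have closed: "closed (Fin ` ?C \<union> {Minus_Inf, Plus_Inf})"
  proof -
    have "Fin -` (- (Fin ` ?C \<union> {Minus_Inf, Plus_Inf})) = - ?C" by auto
    moreover have "closed ?C"
      by (intro closed_Collect_conj closed_Collect_le continuous_intros)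
    ultimately show ?thesis
      unfolding closed_def open_ext_plane_def by (auto simp: open_Compl)
  qed
  have fin: "Fin z \<in> closure (Fin ` ?B)" if z: "z \<in> ?C" for z
  proof (rule ccontr)
    assume "Fin z \<notin> closure (Fin ` ?B)"
    then have z': "z \<in> Fin -` (- closure (Fin ` ?B))" by simp
    have "open (Fin -` (- closure (Fin ` ?B)))"
      using open_Compl[OF closed_closure[of "Fin ` ?B"]] by (simp add: open_ext_plane_def)
    then obtain e where e: "e > 0" "ball z e \<subseteq> Fin -` (- closure (Fin ` ?B))"
      using z' by (rule openE)
    define t where "t = min (1/2) (e / (2 * (b - a)))"
    define w where "w = Complex (Re z) (Im z + t * (m - Im z))"
    have t: "0 < t" "t < 1" using e assms by (auto simp: t_def)
    have "w \<in> ?B"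
    proof -
      have "Im w = (1 - t) * Im z + t * m" by (simp add: w_def algebra_simps)
      moreover have "(1 - t) * a + t * a < (1 - t) * Im z + t * m"
        using z m t by (intro add_le_less_mono) auto
      moreover have "(1 - t) * Im z + t * m < (1 - t) * b + t * b"
        using z m t by (intro add_le_less_mono) auto
      ultimately show ?thesis by (simp add: horizontal_strip_def algebra_simps)
    qed
    moreover have "w \<in> ball z e"
    proof -
      have "z - w = Complex 0 (- (t * (m - Im z)))"
        by (simp add: w_def complex_eq_iff)
      then have "dist z w = t * \<bar>m - Im z\<bar>"
        using t by (simp add: dist_norm complex_norm abs_mult)
      also have "\<dots> \<le> t * (b - a)"
        using z m t by (intro mult_left_mono) auto
      also have "\<dots> \<le> e / (2 * (b - a)) * (b - a)"
        using assms by (intro mult_right_mono) (auto simp: t_def)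
      also have "\<dots> < e" using assms e by (simp add: field_simps)
      finally show ?thesis by simp
    qed
    ultimately show False using e closure_subset[of "Fin ` ?B"] by blast
  qed
  have minus: "Minus_Inf \<in> closure (Fin ` ?B)"
  proof (rule ccontr)
    assume "Minus_Inf \<notin> closure (Fin ` ?B)"
    then obtain c where c: "Fin ` {z. Re z < c} \<subseteq> - closure (Fin ` ?B)"
      using open_Compl[OF closed_closure[of "Fin ` ?B"]] by (auto simp: open_ext_plane_def)
    have "Complex (c - 1) m \<in> ?B" using m by (simp add: horizontal_strip_def)
    moreover have "Fin (Complex (c - 1) m) \<in> - closure (Fin ` ?B)" by (rule subsetD[OF c]) simp
    ultimately show False using closure_subset[of "Fin ` ?B"] by blast
  qed
  have plus: "Plus_Inf \<in> closure (Fin ` ?B)"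
  proof (rule ccontr)
    assume "Plus_Inf \<notin> closure (Fin ` ?B)"
    then obtain c where c: "Fin ` {z. Re z > c} \<subseteq> - closure (Fin ` ?B)"
      using open_Compl[OF closed_closure[of "Fin ` ?B"]] by (auto simp: open_ext_plane_def)
    have "Complex (c + 1) m \<in> ?B" using m by (simp add: horizontal_strip_def)
    moreover have "Fin (Complex (c + 1) m) \<in> - closure (Fin ` ?B)" by (rule subsetD[OF c]) simp
    ultimately show False using closure_subset[of "Fin ` ?B"] by blast
  qed
  have "closure (Fin ` ?B) \<subseteq> Fin ` ?C \<union> {Minus_Inf, Plus_Inf}"
    by (rule closure_minimal[OF _ closed]) (auto simp: horizontal_strip_def)
  then show ?thesis
    unfolding hat_def using fin minus plus by (intro equalityI subsetI) auto
qed

definition edge_dist :: "complex set \<Rightarrow> complex \<Rightarrow> real" where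
  "edge_dist B z = infdist z (frontier B)"

text \<open>Injectivity is not required: a conformal map is a holomorphic map
  with nowhere vanishing derivative.\<close>

definition conformal_on :: "complex set \<Rightarrow> (complex \<Rightarrow> complex) \<Rightarrow> bool" where
  "conformal_on B y \<longleftrightarrow> y holomorphic_on B \<and> (\<forall>z\<in>B. deriv y z \<noteq> 0)"

definition mult_op :: "(complex \<Rightarrow> complex) \<Rightarrow> (complex \<Rightarrow> complex) \<Rightarrow> complex \<Rightarrow> complex" where
  "mult_op g f = (\<lambda>z. g z * f z)"

text \<open>The derivation \<open>d/dy = (1 / y_z) d/dz\<close>.\<close>

definition deriv_wrt :: "(complex \<Rightarrow> complex) \<Rightarrow> (complex \<Rightarrow> complex) \<Rightarrow> complex \<Rightarrow> complex" where
  "deriv_wrt y f = (\<lambda>z. 1 / deriv y z * deriv f z)"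

definition hill_op :: "(complex \<Rightarrow> complex) \<Rightarrow> (complex \<Rightarrow> complex) \<Rightarrow> complex \<Rightarrow> complex" where
  "hill_op p f = (\<lambda>z. (deriv ^^ 2) f z - (1/4 + p z / 2) * f z)"

text \<open>The operator \<open>(d/dy)\<^sup>2 - 1/4\<close>.\<close>

definition const_hill_op_wrt :: "(complex \<Rightarrow> complex) \<Rightarrow> (complex \<Rightarrow> complex) \<Rightarrow> complex \<Rightarrow> complex" where
  "const_hill_op_wrt y f = (\<lambda>z. (deriv_wrt y ^^ 2) f z - 1/4 * f z)"

text \<open>Equality of differential operators on \<open>B\<close>, tested on holomorphic functions on
  arbitrary open subsets of \<open>B\<close>. The functions are total, so values outside the open
  subset are ignored.\<close>

definition ops_eq_on ::
  "complex set \<Rightarrow> ((complex \<Rightarrow> complex) \<Rightarrow> complex \<Rightarrow> complex)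
     \<Rightarrow> ((complex \<Rightarrow> complex) \<Rightarrow> complex \<Rightarrow> complex) \<Rightarrow> bool" where
  "ops_eq_on B P Q \<longleftrightarrow>
     (\<forall>U f. open U \<longrightarrow> U \<subseteq> B \<longrightarrow> f holomorphic_on U \<longrightarrow> (\<forall>z\<in>U. P f z = Q f z))"

text \<open>\<open>y\<close> is a Liouville transformation relating \<open>hill_op p\<close> to \<open>(d/dz)\<^sup>2 - 1/4\<close>;
  \<open>s\<close> is a holomorphic square root of \<open>y_z\<close>. The right-hand side does not depend on
  the choice of its sign.\<close>

definition liouville_transformation_on ::
  "complex set \<Rightarrow> (complex \<Rightarrow> complex) \<Rightarrow> (complex \<Rightarrow> complex) \<Rightarrow> bool" where
  "liouville_transformation_on B p y \<longleftrightarrow>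
     (\<exists>s. s holomorphic_on B \<and> (\<forall>z\<in>B. (s z)^2 = deriv y z) \<and>
          ops_eq_on B (hill_op p)
            (mult_op (\<lambda>z. (s z)^3) \<circ> const_hill_op_wrt y \<circ> mult_op s))"

end

theory Submission
  imports Defs "HOL-Library.Going_To_Filter"
begin

text \<open>
  Put \<open>q = 1/4 + p/2\<close>. Along the midline of a substrip of height \<open>\<pi>\<close>, or along any other hyperbolic
  geodesic of it after a Liouville change of variable, the bound on \<open>p\<close> gives \<open>Re q > 0\<close>. Then
  \<open>\<bar>f\<bar>\<close> is strictly convex for every solution \<open>f\<close> of \<open>f'' = q f\<close>, so no ratio of solutions can take
  the same value at both ends of a geodesic, and a ratio normalized at the centre of the conformally
  equivalent disc has an integrable derivative along all radii. This is the univalence criterion of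
  Nehari in the form of Gehring and Pommerenke: the ratio extends to an injective continuous map of the closed
  substrip, ends included. Choosing \<open>f\<^sub>1\<close> and \<open>f\<^sub>2\<close> principal at \<open>-\<infinity>\<close> and \<open>+\<infinity>\<close>, the ratio
  \<open>f\<^sub>1 / f\<^sub>2\<close> has no zeros or poles on the closed strip, and \<open>y = ln (f\<^sub>1 / f\<^sub>2)\<close>.

  Since \<open>exp \<circ> y\<close> is injective only on substrips of height \<open>\<pi>\<close>, injectivity of \<open>y\<close> on a higher strip needs
  another argument: at distance at least \<open>\<pi>/2\<close> from the edges \<open>y' = f\<^sub>1'/f\<^sub>1 - f\<^sub>2'/f\<^sub>2\<close> has
  positive real part, again by convexity.
\<close>

section \<open>The equation \<open>f'' = q f\<close>\<close>

text \<open>The comparison equation \<open>g'' = g / 4\<close> has the solutions exp (y/2) and exp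
  (-y/2). Pulled back by \<open>y\<close> and divided by the square root of \<open>y_z\<close>, they
  become two solutions of \<open>f'' = q f\<close> with ratio exp y; hence \<open>y\<close> is
  sought as the logarithm of a ratio. Fixing both ends selects the pair: exp y must tend to 0 at
  -\<infinity> and to \<infinity> at +\<infinity>. The constants come from a strip of height pi with
  midline Im z = c. Under x = tanh ((z - i c) / 2) it becomes the unit disc, the coefficient 1/4
  becomes 0, and |q - 1/4| < 1 / (2 cos (Im z - c))^2 becomes Nehari's bound. The hypothesis on
  \<open>p\<close> implies this for every such strip inside \<open>B\<close>, because its bound does
  not increase with the distance to the edge. Strictness removes the exceptional case of the
  Gehring-Pommerenke theorem, where two boundary points share a value. A higher strip contains a
  whole family of such substrips, and one pair of solutions must serve all of them. Overlapping
  substrips share a line, and the behaviour along one line already determines the pair up to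
  constant factors.\<close>

definition hill_solution :: "complex set \<Rightarrow> (complex \<Rightarrow> complex) \<Rightarrow> (complex \<Rightarrow> complex) \<Rightarrow> (complex \<Rightarrow> complex) \<Rightarrow> bool" where
  "hill_solution S q f f' \<longleftrightarrow> (\<forall>z\<in>S. (f has_field_derivative f' z) (at z) \<and>
                            (f' has_field_derivative q z * f z) (at z))"

lemma hill_solutionD:
  assumes "hill_solution S q f f'" "z \<in> S"
  shows "(f has_field_derivative f' z) (at z)" "(f' has_field_derivative q z * f z) (at z)"
  using assms by (auto simp: hill_solution_def)

lemma hill_solution_subset: "hill_solution S q f f' \<Longrightarrow> T \<subseteq> S \<Longrightarrow> hill_solution T q f f'"
  by (auto simp: hill_solution_def)

lemma hill_solution_lincomb:
  assumes "hill_solution S q f f'" "hill_solution S q g g'"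
  shows "hill_solution S q (\<lambda>z. a * f z + b * g z) (\<lambda>z. a * f' z + b * g' z)"
  unfolding hill_solution_def
proof (intro ballI conjI)
  fix z assume z: "z \<in> S"
  note [derivative_intros] = hill_solutionD[OF assms(1) z] hill_solutionD[OF assms(2) z]
  show "((\<lambda>z. a * f z + b * g z) has_field_derivative a * f' z + b * g' z) (at z)"
    by (auto intro!: derivative_eq_intros)
  show "((\<lambda>z. a * f' z + b * g' z) has_field_derivative q z * (a * f z + b * g z)) (at z)"
    by (auto intro!: derivative_eq_intros simp: algebra_simps)
qed

lemma hill_solution_holomorphic:
  assumes "hill_solution S q f f'"
  shows "f holomorphic_on S" "f' holomorphic_on S"
  using assms unfolding hill_solution_def holomorphic_on_def field_differentiable_def
  by (meson has_field_derivative_at_within)+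

lemma wronskian_const:
  assumes "convex S" "hill_solution S q f f'" "hill_solution S q g g'"
  shows "\<exists>k. \<forall>z\<in>S. g' z * f z - g z * f' z = k"
proof (rule has_field_derivative_zero_constant[OF assms(1)])
  fix z assume z: "z \<in> S"
  note [derivative_intros] = hill_solutionD[OF assms(2) z] hill_solutionD[OF assms(3) z]
  show "((\<lambda>z. g' z * f z - g z * f' z) has_field_derivative 0) (at z within S)"
    by (rule has_field_derivative_at_within) (auto intro!: derivative_eq_intros simp: algebra_simps)
qed

text \<open>Cramer's rule: the coefficients are the Wronskians of \<open>h\<close> with
  \<open>f\<close> and with \<open>g\<close>, which do not depend on the point.\<close>

lemma hill_solution_combination:
  assumes "convex S" "hill_solution S q f f'" "hill_solution S q g g'" "hill_solution S q h h'"
    and W: "\<And>z. z \<in> S \<Longrightarrow> g' z * f z - g z * f' z = 1"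
  shows "\<exists>a b. \<forall>z\<in>S. h z = a * f z + b * g z \<and> h' z = a * f' z + b * g' z"
proof -
  obtain k where k: "\<And>z. z \<in> S \<Longrightarrow> h' z * f z - h z * f' z = k"
    using wronskian_const[OF assms(1,2,4)] by blast
  obtain l where l: "\<And>z. z \<in> S \<Longrightarrow> g' z * h z - g z * h' z = l"
    using wronskian_const[OF assms(1,4,3)] by blast
  have "h z = l * f z + k * g z \<and> h' z = l * f' z + k * g' z" if "z \<in> S" for z
  proof -
    have "l * f z + k * g z = h z * (g' z * f z - g z * f' z)"
      unfolding k[OF that, symmetric] l[OF that, symmetric] by (simp add: algebra_simps)
    moreover have "l * f' z + k * g' z = h' z * (g' z * f z - g z * f' z)"
      unfolding k[OF that, symmetric] l[OF that, symmetric] by (simp add: algebra_simps)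
    ultimately show ?thesis using W[OF that] by simp
  qed
  then show ?thesis by blast
qed

section \<open>Power series solutions in the unit disc\<close>

fun ode_coeff :: "(nat \<Rightarrow> complex) \<Rightarrow> complex \<Rightarrow> complex \<Rightarrow> nat \<Rightarrow> complex" where
  "ode_coeff q a b 0 = a"
| "ode_coeff q a b (Suc 0) = b"
| "ode_coeff q a b (Suc (Suc n)) =
     (\<Sum>k\<le>n. q k * ode_coeff q a b (n - k)) / (of_nat (n + 1) * of_nat (n + 2))"

text \<open>The product has m + 1 terms, each at most M * K after scaling by \<open>R ^ m\<close>,
  and the recursion divides by (m + 1) (m + 2). A factor M / (m + 2) remains, at most 1 once m \<ge>
  M, so the first coefficients already determine the bound.\<close>

lemma ode_coeff_bounded:
  assumes R: "0 < R" "R \<le> 1" and M: "\<And>k. norm (q k) * R ^ k \<le> M"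
  shows "\<exists>K. \<forall>n. norm (ode_coeff q a b n) * R ^ n \<le> K"
proof -
  let ?c = "\<lambda>n. norm (ode_coeff q a b n) * R ^ n"
  define N where "N = nat \<lceil>M\<rceil>"
  define K where "K = Max (?c ` {..Suc N})"
  have M0: "M \<ge> 0" using M[of 0] by (auto intro: order_trans[OF norm_ge_zero])
  have K: "?c n \<le> K" if "n \<le> Suc N" for n
    unfolding K_def using that by (intro Max_ge) auto
  have K0: "K \<ge> 0" using K[of 0] by (auto intro: order_trans[OF norm_ge_zero])
  have "?c n \<le> K" for n
  proof (induction n rule: less_induct)
    case (less n)
    show ?case
    proof (cases "n \<le> Suc N")
      case False
      then obtain m where m: "n = Suc (Suc m)" "m \<ge> N"
        by (cases n; cases "n - 1") auto
      have "norm (\<Sum>k\<le>m. q k * ode_coeff q a b (m - k)) * R ^ m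
          \<le> (\<Sum>k\<le>m. norm (q k * ode_coeff q a b (m - k))) * R ^ m"
        using R by (intro mult_right_mono norm_sum) auto
      also have "\<dots> = (\<Sum>k\<le>m. (norm (q k) * R ^ k) * ?c (m - k))"
        unfolding sum_distrib_right
        by (intro sum.cong) (auto simp: norm_mult algebra_simps simp flip: power_add)
      also have "\<dots> \<le> (\<Sum>k\<le>m. M * K)"
        using less[of "m - k" for k] M R K0 M0 m by (intro sum_mono mult_mono) auto
      also have "\<dots> = real (m + 1) * (M * K)" by simp
      finally have 1: "norm (\<Sum>k\<le>m. q k * ode_coeff q a b (m - k)) * R ^ m \<le> real (m+1) * (M * K)" .
      have "?c n = (norm (\<Sum>k\<le>m. q k * ode_coeff q a b (m - k)) * R ^ m) * R^2 / (real (m+1) * real (m+2))"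
        unfolding m(1) by (simp add: norm_divide norm_mult power2_eq_square del: of_nat_Suc of_nat_add)
      also have "\<dots> \<le> (real (m+1) * (M * K)) * 1 / (real (m+1) * real (m+2))"
        using R M0 K0 by (intro divide_right_mono mult_mono[OF 1]) (auto simp: power_le_one)
      also have "\<dots> = (M / real (m+2)) * K"
        by (subst mult.assoc, subst mult_divide_mult_cancel_left) simp_all
      also have "\<dots> \<le> 1 * K"
      proof (rule mult_right_mono[OF _ K0])
        have "M \<le> real N" unfolding N_def by linarith
        also have "\<dots> \<le> real (m + 2)" using m by simp
        finally show "M / real (m+2) \<le> 1" by simp
      qed
      finally show ?thesis by simp
    qed (use K in auto)
  qed
  then show ?thesis by blast
qed

lemma fps_conv_radius_ode_coeff:
  assumes "fps_conv_radius q \<ge> 1"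
  shows "fps_conv_radius (Abs_fps (ode_coeff (fps_nth q) a b)) \<ge> 1"
  unfolding fps_conv_radius_def fps_nth_Abs_fps
proof (rule conv_radius_geI_ex')
  fix r :: real assume r: "0 < r" "ereal r < 1"
  then have "r < 1" by (simp add: one_ereal_def)
  \<comment> \<open>An intermediate radius: boundedness at \<open>R\<close> gives convergence at
    \<open>r\<close> by comparison with the geometric series of ratio r / R.\<close>
  define R where "R = (1 + r) / 2"
  have R: "0 < R" "R \<le> 1" "r < R" "R < 1" using r \<open>r < 1\<close> by (auto simp: R_def)
  have "ereal (norm R) < fps_conv_radius q"
    using R assms by (auto intro: less_le_trans[of _ 1] simp: one_ereal_def)
  then have "summable (\<lambda>k. fps_nth q k * of_real R ^ k)"
    using R summable_in_conv_radius[of "of_real R :: complex" "fps_nth q"]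
    by (simp add: fps_conv_radius_def)
  then obtain M where M: "\<And>k. norm (fps_nth q k * of_real R ^ k) \<le> M"
    using summable_imp_bounded unfolding bounded_iff by blast
  obtain K where K: "\<And>n. norm (ode_coeff (fps_nth q) a b n) * R ^ n \<le> K"
    using ode_coeff_bounded[OF R(1,2), of "fps_nth q" M a b] M R
    by (auto simp: norm_mult norm_power)
  have "summable (\<lambda>n. K * (r / R) ^ n)"
    using r R by (intro summable_mult summable_geometric) auto
  then show "summable (\<lambda>n. ode_coeff (fps_nth q) a b n * of_real r ^ n)"
  proof (rule summable_comparison_test'[where N = 0])
    fix n
    have "norm (ode_coeff (fps_nth q) a b n * of_real r ^ n)
        = (norm (ode_coeff (fps_nth q) a b n) * R ^ n) * (r / R) ^ n"
      using R r by (simp add: norm_mult norm_power power_divide)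
    also have "\<dots> \<le> K * (r / R) ^ n"
      using K R r by (intro mult_right_mono) auto
    finally show "norm (ode_coeff (fps_nth q) a b n * of_real r ^ n) \<le> K * (r / R) ^ n" .
  qed
qed

lemma hill_solution_exists_disc:
  assumes "Q holomorphic_on ball 0 1"
  obtains f f' where "hill_solution (ball 0 1) Q f f'" "f 0 = a" "f' 0 = b"
proof -
  define q where "q = fps_expansion Q 0"
  have hol: "Q holomorphic_on eball 0 1"
    using assms by (simp add: one_ereal_def)
  have q1: "fps_conv_radius q \<ge> 1"
    unfolding q_def using conv_radius_fps_expansion[OF hol] .
  have qQ: "eval_fps q z = Q z" if "z \<in> ball 0 1" for z
    unfolding q_def using eval_fps_expansion[OF hol, of z] that by (simp add: one_ereal_def)
  define F where "F = Abs_fps (ode_coeff (fps_nth q) a b)"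
  have F1: "fps_conv_radius F \<ge> 1" unfolding F_def by (rule fps_conv_radius_ode_coeff[OF q1])
  have F2: "fps_conv_radius (fps_deriv F) \<ge> 1"
    using F1 fps_conv_radius_deriv[of F] by (rule order_trans)
  have eq: "fps_deriv (fps_deriv F) = q * F"
  proof (rule fps_ext)
    fix n
    have "fps_nth (fps_deriv (fps_deriv F)) n
        = of_nat (n + 1) * (of_nat (n + 2) * ode_coeff (fps_nth q) a b (Suc (Suc n)))"
      by (simp add: F_def algebra_simps del: ode_coeff.simps)
    also have "\<dots> = (\<Sum>k\<le>n. fps_nth q k * ode_coeff (fps_nth q) a b (n - k))"
      by (simp del: of_nat_Suc of_nat_add)
    also have "\<dots> = fps_nth (q * F) n"
      by (simp add: fps_mult_nth F_def atLeast0AtMost)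
    finally show "fps_nth (fps_deriv (fps_deriv F)) n = fps_nth (q * F) n" .
  qed
  show ?thesis
  proof (rule that)
    show "hill_solution (ball 0 1) Q (eval_fps F) (eval_fps (fps_deriv F))"
      unfolding hill_solution_def
    proof (intro ballI conjI)
      fix z :: complex assume z: "z \<in> ball 0 1"
      then have n: "ereal (norm z) < 1" by (simp add: one_ereal_def)
      show "(eval_fps F has_field_derivative eval_fps (fps_deriv F) z) (at z)"
        using n F1 by (intro has_field_derivative_eval_fps) (rule less_le_trans)
      have "(eval_fps (fps_deriv F) has_field_derivative eval_fps (fps_deriv (fps_deriv F)) z) (at z)"
        using n F2 by (intro has_field_derivative_eval_fps) (rule less_le_trans)
      also have "eval_fps (fps_deriv (fps_deriv F)) z = Q z * eval_fps F z"
        unfolding eq using less_le_trans[OF n F1] less_le_trans[OF n q1] qQ[OF z] by (simp add: eval_fps_mult)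
      finally show "(eval_fps (fps_deriv F) has_field_derivative Q z * eval_fps F z) (at z)" .
    qed
    show "eval_fps F 0 = a" "eval_fps (fps_deriv F) 0 = b"
      by (simp_all add: eval_fps_at_0 F_def)
  qed
qed

section \<open>Convexity on the real line\<close>

definition line_solution :: "(real \<Rightarrow> complex) \<Rightarrow> (real \<Rightarrow> complex) \<Rightarrow> (real \<Rightarrow> complex) \<Rightarrow> bool" where
  "line_solution q W W' \<longleftrightarrow> (\<forall>s. (W has_vector_derivative W' s) (at s) \<and>
                       (W' has_vector_derivative q s * W s) (at s))"

lemma line_solutionD:
  assumes "line_solution q W W'"
  shows "(W has_vector_derivative W' s) (at s)" "(W' has_vector_derivative q s * W s) (at s)"
  using assms by (auto simp: line_solution_def)

lemma line_solution_reflect: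
  assumes "line_solution q W W'"
  shows "line_solution (\<lambda>s. q (-s)) (\<lambda>s. W (-s)) (\<lambda>s. - W' (-s))"
  unfolding line_solution_def
proof (intro allI conjI)
  fix s :: real
  have neg: "((\<lambda>s. - s) has_vector_derivative (-1)) (at s)"
    by (auto intro!: derivative_eq_intros)
  show "((\<lambda>s. W (-s)) has_vector_derivative - W' (-s)) (at s)"
    using vector_diff_chain_at[OF neg line_solutionD(1)[OF assms, of "-s"]] by (simp add: o_def)
  have "((\<lambda>s. W' (-s)) has_vector_derivative - (q (-s) * W (-s))) (at s)"
    using vector_diff_chain_at[OF neg line_solutionD(2)[OF assms, of "-s"]] by (simp add: o_def)
  from has_vector_derivative_minus[OF this]
  show "((\<lambda>s. - W' (-s)) has_vector_derivative q (-s) * W (-s)) (at s)" by simp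
qed

text \<open>The imaginary part of \<open>c\<close> contributes a multiple of
  \<open>\<i> * w\<close>, which is orthogonal to \<open>w\<close>. Hence convexity of the modulus
  needs only Re q > 0.\<close>

lemma inner_mult_self: "(w::complex) \<bullet> (c * w) = Re c * (w \<bullet> w)"
  by (simp add: inner_complex_def algebra_simps)

lemma line_solution_derivs:
  assumes "line_solution q W W'"
  shows "((\<lambda>s. W s \<bullet> W s) has_real_derivative 2 * (W s \<bullet> W' s)) (at s)"
    and "((\<lambda>s. W s \<bullet> W' s) has_real_derivative (W' s \<bullet> W' s + Re (q s) * (W s \<bullet> W s))) (at s)"
proof -
  note D = line_solutionD[OF assms, of s]
  show "((\<lambda>s. W s \<bullet> W s) has_real_derivative 2 * (W s \<bullet> W' s)) (at s)"
    using has_derivative_inner[OF D(1)[unfolded has_vector_derivative_def] D(1)[unfolded has_vector_derivative_def]]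
    by (simp add: has_field_derivative_def algebra_simps inner_commute mult_commute_abs)
  show "((\<lambda>s. W s \<bullet> W' s) has_real_derivative (W' s \<bullet> W' s + Re (q s) * (W s \<bullet> W s))) (at s)"
    using has_derivative_inner[OF D(1)[unfolded has_vector_derivative_def] D(2)[unfolded has_vector_derivative_def]]
    by (simp add: has_field_derivative_def inner_mult_self mult_commute_abs add.commute flip: distrib_left)
qed

text \<open>The inner product is half the derivative of the squared modulus; its own derivative
  |W'|^2 + Re q |W|^2 is nonnegative.\<close>

lemma line_solution_inner_mono:
  assumes "line_solution q W W'" "\<And>s. Re (q s) > 0" "s \<le> t"
  shows "W s \<bullet> W' s \<le> W t \<bullet> W' t"
  using assms(3)
proof (rule DERIV_nonneg_imp_nondecreasing)
  fix x
  have "W' x \<bullet> W' x + Re (q x) * (W x \<bullet> W x) \<ge> 0"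
    using less_imp_le[OF assms(2)[of x]] by simp
  then show "\<exists>y. ((\<lambda>s. W s \<bullet> W' s) has_real_derivative y) (at x) \<and> 0 \<le> y"
    using line_solution_derivs(2)[OF assms(1), of x] by blast
qed

text \<open>The nonzero Wronskian excludes a common zero of \<open>W\<close> and \<open>W'\<close>,
  the only way in which the derivative of the inner product could vanish.\<close>

lemma line_solution_inner_strict:
  assumes "line_solution q W W'" "\<And>s. Re (q s) > 0"
    and W: "\<And>s. U' s * W s - U s * W' s = k" "k \<noteq> 0" and "s < t"
  shows "W s \<bullet> W' s < W t \<bullet> W' t"
  using assms(5)
proof (rule DERIV_pos_imp_increasing)
  fix x
  have "W x \<noteq> 0 \<or> W' x \<noteq> 0" using W(1)[of x] W(2) by auto
  then have "W' x \<bullet> W' x + Re (q x) * (W x \<bullet> W x) > 0"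
    using assms(2)[of x] by (auto intro: add_pos_nonneg add_nonneg_pos)
  then show "\<exists>y. ((\<lambda>s. W s \<bullet> W' s) has_real_derivative y) (at x) \<and> 0 < y"
    using line_solution_derivs(2)[OF assms(1), of x] by blast
qed

lemma line_solution_cauchy_schwarz:
  assumes "Re (q s) > 0"
  shows "(W s \<bullet> W' s)^2 \<le> (W s \<bullet> W s) * (W' s \<bullet> W' s + Re (q s) * (W s \<bullet> W s))"
proof -
  have "(W s \<bullet> W' s)^2 \<le> (W s \<bullet> W s) * (W' s \<bullet> W' s)"
    by (rule Cauchy_Schwarz_ineq)
  also have "\<dots> \<le> (W s \<bullet> W s) * (W' s \<bullet> W' s + Re (q s) * (W s \<bullet> W s))"
    using assms by (intro mult_left_mono) auto
  finally show ?thesis .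
qed

text \<open>
  With \<open>\<psi> = W \<bullet> W'\<close>, Cauchy-Schwarz gives \<open>\<psi>\<^sup>2 \<le> \<bar>W\<bar>\<^sup>2 \<psi>'\<close>, so the derivative
  \<open>k / W\<^sup>2\<close> of \<open>U / W\<close> is dominated by the derivative of \<open>- \<bar>k\<bar> / \<psi>\<close>.
\<close>

lemma line_solution_quotient_bound:
  assumes W: "line_solution q W W'" and U: "line_solution q U U'" and q: "\<And>s. Re (q s) > 0"
    and k: "\<And>s. U' s * W s - U s * W' s = k"
    and pos: "W s \<bullet> W' s > 0" and "s \<le> t"
  shows "norm (U t / W t - U s / W s) \<le> norm k / (W s \<bullet> W' s)"
proof (cases "s = t")
  case False
  with \<open>s \<le> t\<close> have "s < t" by simp
  have psi: "W x \<bullet> W' x > 0" if "x \<ge> s" for x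
    using line_solution_inner_mono[OF W q that] pos by linarith
  then have nz: "W x \<noteq> 0" if "x \<ge> s" for x using that by fastforce
  have dQ: "((\<lambda>x. U x / W x) has_vector_derivative k / (W x)^2) (at x)" if "x \<ge> s" for x
  proof -
    have 1: "((\<lambda>x. inverse (W x)) has_vector_derivative - (inverse (W x) * W' x * inverse (W x))) (at x)"
      using Deriv.has_derivative_inverse[OF nz[OF that] line_solutionD(1)[OF W, of x, unfolded has_vector_derivative_def]]
      by (simp add: has_vector_derivative_def algebra_simps)
    have "((\<lambda>x. U x * inverse (W x)) has_vector_derivative 
            U x * (- (inverse (W x) * W' x * inverse (W x))) + U' x * inverse (W x)) (at x)"
      by (rule has_vector_derivative_mult[OF line_solutionD(1)[OF U] 1])
    also have "U x * (- (inverse (W x) * W' x * inverse (W x))) + U' x * inverse (W x) = k / (W x)^2"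
      unfolding k[of x, symmetric] using nz[OF that] by (simp add: field_simps power2_eq_square)
    finally show ?thesis by (simp add: divide_inverse)
  qed
  define d where "d x = W' x \<bullet> W' x + Re (q x) * (W x \<bullet> W x)" for x
  have dP: "((\<lambda>x. - (norm k / (W x \<bullet> W' x))) has_vector_derivative norm k * d x / (W x \<bullet> W' x)^2) (at x)" 
    if "x \<ge> s" for x
    unfolding has_real_derivative_iff_has_vector_derivative[symmetric] d_def
    using psi[OF that] by (auto intro!: derivative_eq_intros line_solution_derivs[OF W] simp: power2_eq_square)
  have "norm (U t / W t - U s / W s) \<le> - (norm k / (W t \<bullet> W' t)) - - (norm k / (W s \<bullet> W' s))"
  proof (rule differentiable_bound_general[OF \<open>s < t\<close>, where f' = "\<lambda>x. k / (W x)^2" and \<phi>' = "\<lambda>x. norm k * d x / (W x \<bullet> W' x)^2"])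
    show "continuous_on {s..t} (\<lambda>x. U x / W x)"
      using dQ by (intro continuous_at_imp_continuous_on ballI) (auto dest: has_vector_derivative_continuous)
    show "continuous_on {s..t} (\<lambda>x. - (norm k / (W x \<bullet> W' x)))"
      using dP by (intro continuous_at_imp_continuous_on ballI) (auto dest: has_vector_derivative_continuous)
    fix x assume "s < x" "x < t"
    then have x: "x \<ge> s" by simp
    show "((\<lambda>x. U x / W x) has_vector_derivative k / (W x)^2) (at x)" by (rule dQ[OF x])
    show "((\<lambda>x. - (norm k / (W x \<bullet> W' x))) has_vector_derivative norm k * d x / (W x \<bullet> W' x)^2) (at x)"
      by (rule dP[OF x])
    have "(W x \<bullet> W' x)^2 \<le> (W x \<bullet> W x) * d x"
      unfolding d_def using line_solution_cauchy_schwarz[of q x W W'] q by simp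
    then have "1 / (W x \<bullet> W x) \<le> d x / (W x \<bullet> W' x)^2"
      using psi[OF x] nz[OF x] by (simp add: field_simps)
    then have "norm k * (1 / (W x \<bullet> W x)) \<le> norm k * (d x / (W x \<bullet> W' x)^2)"
      by (intro mult_left_mono) auto
    then show "norm (k / (W x)^2) \<le> norm k * d x / (W x \<bullet> W' x)^2"
      by (simp add: norm_divide norm_power dot_square_norm)
  qed
  also have "\<dots> \<le> norm k / (W s \<bullet> W' s)" using psi[of t] \<open>s < t\<close> by simp
  finally show ?thesis .
qed (use pos in auto)

text \<open>The same inequality says that \<open>\<psi>\<^sup>2 / \<bar>W\<bar>\<^sup>2\<close>, the squared slope of \<open>\<bar>W\<bar>\<close>, is nondecreasing.\<close>

lemma line_solution_growth:
  assumes W: "line_solution q W W'" and q: "\<And>s. Re (q s) > 0"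
    and pos: "W s \<bullet> W' s > 0" and "s \<le> t"
  shows "(W t \<bullet> W' t)^2 \<ge> (W s \<bullet> W' s)^2 / (W s \<bullet> W s) * (W s \<bullet> W s + 2 * (W s \<bullet> W' s) * (t - s))"
proof -
  have psi: "W x \<bullet> W' x \<ge> W s \<bullet> W' s" if "x \<ge> s" for x
    using line_solution_inner_mono[OF W q that] .
  have phi: "W x \<bullet> W x > 0" if "x \<ge> s" for x
    using psi[OF that] pos by auto
  \<comment> \<open>A tangent line inequality: the slope of |W|^2 is twice the inner product, which
    never drops below its value at \<open>s\<close>.\<close>
  have "W s \<bullet> W s - 2 * (W s \<bullet> W' s) * s \<le> W t \<bullet> W t - 2 * (W s \<bullet> W' s) * t"
    using \<open>s \<le> t\<close>
  proof (rule DERIV_nonneg_imp_nondecreasing)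
    fix x assume "s \<le> x"
    then show "\<exists>y. ((\<lambda>x. W x \<bullet> W x - 2 * (W s \<bullet> W' s) * x) has_real_derivative y) (at x) \<and> 0 \<le> y"
      using psi[of x] by (intro exI[of _ "2 * (W x \<bullet> W' x) - 2 * (W s \<bullet> W' s)"])
         (auto intro!: derivative_eq_intros line_solution_derivs[OF W])
  qed
  then have 1: "W s \<bullet> W s + 2 * (W s \<bullet> W' s) * (t - s) \<le> W t \<bullet> W t" by (simp add: algebra_simps)
  have 2: "(W s \<bullet> W' s)^2 / (W s \<bullet> W s) \<le> (W t \<bullet> W' t)^2 / (W t \<bullet> W t)"
    using \<open>s \<le> t\<close>
  proof (rule DERIV_nonneg_imp_nondecreasing)
    fix x assume "s \<le> x"
    define d where "d = W' x \<bullet> W' x + Re (q x) * (W x \<bullet> W x)"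
    have "((\<lambda>x. (W x \<bullet> W' x)^2 / (W x \<bullet> W x)) has_real_derivative 
            2 * (W x \<bullet> W' x) * ((W x \<bullet> W x) * d - (W x \<bullet> W' x)^2) / (W x \<bullet> W x)^2) (at x)"
      unfolding d_def using phi[OF \<open>s \<le> x\<close>]
      by (auto intro!: derivative_eq_intros line_solution_derivs[OF W] simp: power2_eq_square algebra_simps)
    moreover have "(W x \<bullet> W x) * d - (W x \<bullet> W' x)^2 \<ge> 0"
      unfolding d_def using line_solution_cauchy_schwarz[of q x W W', OF q] by simp
    ultimately show "\<exists>y. ((\<lambda>x. (W x \<bullet> W' x)^2 / (W x \<bullet> W x)) has_real_derivative y) (at x) \<and> 0 \<le> y"
      using psi[OF \<open>s \<le> x\<close>] pos by (intro exI conjI) (auto intro!: divide_nonneg_nonneg mult_nonneg_nonneg)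
  qed
  have "(W s \<bullet> W' s)^2 / (W s \<bullet> W s) * (W s \<bullet> W s + 2 * (W s \<bullet> W' s) * (t - s)) 
      \<le> (W t \<bullet> W' t)^2 / (W t \<bullet> W t) * (W t \<bullet> W t)"
    using phi[OF \<open>s \<le> t\<close>] pos \<open>s \<le> t\<close> by (intro mult_mono 1 2) auto
  also have "\<dots> = (W t \<bullet> W' t)^2" using phi[OF \<open>s \<le> t\<close>] by simp
  finally show ?thesis .
qed

text \<open>Otherwise |W| would increase from \<open>s + 1\<close> on, and
  \<open>line_solution_quotient_bound\<close> would keep U / W bounded although W / U tends to 0.
  The unit step turns the weak inequality at \<open>s\<close> into a strict one.\<close>

lemma line_solution_vanishing_at_top:
  assumes W: "line_solution q W W'" and U: "line_solution q U U'" and q: "\<And>s. Re (q s) > 0"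
    and k: "\<And>s. U' s * W s - U s * W' s = k" "k \<noteq> 0"
    and lim: "((\<lambda>s. W s / U s) \<longlongrightarrow> 0) at_top" and nz: "\<And>s. U s \<noteq> 0"
  shows "W s \<bullet> W' s < 0"
proof (rule ccontr)
  assume "\<not> W s \<bullet> W' s < 0"
  then have pos: "W (s+1) \<bullet> W' (s+1) > 0"
    using line_solution_inner_strict[OF W q k, of s "s+1"] by simp
  \<comment> \<open>Bound for |U / W| on the half-line from \<open>s + 1\<close>; the summand 1
    makes it strict and positive.\<close>
  define C where "C = norm (U (s+1) / W (s+1)) + norm k / (W (s+1) \<bullet> W' (s+1)) + 1"
  have C: "C > 0" unfolding C_def using pos by (intro add_nonneg_pos add_nonneg_nonneg) auto
  have "eventually (\<lambda>x. norm (W x / U x) < 1 / C) at_top"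
    using lim C by (auto simp: tendsto_iff dist_norm)
  then obtain N where "\<And>x. x \<ge> N \<Longrightarrow> norm (W x / U x) < 1 / C"
    by (auto simp: eventually_at_top_linorder)
  then obtain x where x: "norm (W x / U x) < 1 / C" "x \<ge> s+1"
    by (meson max.cobounded1 max.cobounded2)
  have "W x \<bullet> W' x > 0" using line_solution_inner_mono[OF W q x(2)] pos by linarith
  then have W0: "W x \<noteq> 0" by auto
  have "norm (U x / W x) \<le> norm (U (s+1) / W (s+1)) + norm (U x / W x - U (s+1) / W (s+1))"
    by (metis norm_triangle_sub)
  also have "\<dots> < C"
    unfolding C_def using line_solution_quotient_bound[OF W U q k(1) pos x(2)] by simp
  finally have "norm (U x) < C * norm (W x)" using W0 by (simp add: norm_divide field_simps)
  with x(1) show False using C nz[of x] by (simp add: norm_divide field_simps)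
qed

lemma line_solution_vanishing_at_bot:
  assumes W: "line_solution q W W'" and U: "line_solution q U U'" and q: "\<And>s. Re (q s) > 0"
    and k: "\<And>s. U' s * W s - U s * W' s = k" "k \<noteq> 0"
    and lim: "((\<lambda>s. W s / U s) \<longlongrightarrow> 0) at_bot" and nz: "\<And>s. U s \<noteq> 0"
  shows "W s \<bullet> W' s > 0"
proof -
  have "W (- (-s)) \<bullet> (- W' (- (-s))) < 0"
  proof (rule line_solution_vanishing_at_top[OF line_solution_reflect[OF W] line_solution_reflect[OF U], of "-k"])
    show "- U' (- s) * W (- s) - U (- s) * - W' (- s) = - k" for s
      using k(1)[of "-s"] by (simp add: algebra_simps)
    show "((\<lambda>s. W (- s) / U (- s)) \<longlongrightarrow> 0) at_top"
      using lim unfolding filterlim_at_bot_mirror .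
  qed (use q nz k in auto)
  then show ?thesis by simp
qed

section \<open>Geodesics of the disc\<close>

text \<open>
  Geodesics are parametrized as \<open>(A e\<^sup>s + B) / (C e\<^sup>s + E)\<close>, with numerator and denominator multiplied
  by \<open>e\<^bsup>-s/2\<^esup>\<close>. The norm identity in \<open>geodesic\<close> says that \<open>s\<close> is a multiple of the hyperbolic arc length.
\<close>

definition mob_num :: "complex \<Rightarrow> complex \<Rightarrow> real \<Rightarrow> complex" where
  "mob_num A B s = A * of_real (exp (s/2)) + B * of_real (exp (-s/2))"

definition geodesic :: "complex \<Rightarrow> complex \<Rightarrow> complex \<Rightarrow> complex \<Rightarrow> bool" where
  "geodesic A B C E \<longleftrightarrow> A * E - B * C \<noteq> 0 \<and>
     (\<forall>s. (norm (mob_num C E s))^2 - (norm (mob_num A B s))^2 = 2 * norm (A * E - B * C))"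

definition mob_pt :: "complex \<Rightarrow> complex \<Rightarrow> complex \<Rightarrow> complex \<Rightarrow> real \<Rightarrow> complex" where
  "mob_pt A B C E s = mob_num A B s / mob_num C E s"

lemma mob_num_deriv:
  "(mob_num A B has_vector_derivative mob_num (A/2) (-B/2) s) (at s)"
proof -
  have 1: "((\<lambda>s. of_real (exp (s/2)) :: complex) has_vector_derivative of_real (exp (s/2) / 2)) (at s)"
    by (intro has_vector_derivative_of_real) (auto intro!: derivative_eq_intros)
  have 2: "((\<lambda>s. of_real (exp (-s/2)) :: complex) has_vector_derivative of_real (- exp (-s/2) / 2)) (at s)"
    by (intro has_vector_derivative_of_real) (auto intro!: derivative_eq_intros)
  have "(mob_num A B has_vector_derivative A * of_real (exp (s/2) / 2) + B * of_real (- exp (-s/2) / 2)) (at s)"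
    unfolding mob_num_def[abs_def]
    by (intro has_vector_derivative_add has_vector_derivative_mult_right 1 2)
  then show ?thesis by (simp add: mob_num_def)
qed

lemma mob_num_wronskian:
  "mob_num (A/2) (-B/2) s * mob_num C E s - mob_num A B s * mob_num (C/2) (-E/2) s = A * E - B * C"
proof -
  have "of_real (exp (s/2)) * of_real (exp (-s/2)) = (1::complex)"
    unfolding of_real_mult[symmetric] by (simp flip: exp_add)
  moreover have "(A/2 * x + -B/2 * y) * (C * x + E * y) - (A * x + B * y) * (C/2 * x + -E/2 * y)
      = (A * E - B * C) * (x * y)" for x y
    by (simp add: field_simps)
  ultimately show ?thesis unfolding mob_num_def by simp
qed

lemma geodesic_nz:
  assumes "geodesic A B C E"
  shows "mob_num C E s \<noteq> 0"
proof
  assume "mob_num C E s = 0"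
  then have "- ((norm (mob_num A B s))^2) = 2 * norm (A * E - B * C)"
    using assms unfolding geodesic_def by (metis diff_0 norm_zero zero_power2)
  moreover have "norm (A * E - B * C) > 0" using assms by (simp add: geodesic_def)
  ultimately show False using zero_le_power2[of "norm (mob_num A B s)"] by linarith
qed

lemma geodesic_one_minus:
  assumes "geodesic A B C E"
  shows "1 - (norm (mob_pt A B C E s))^2 = 2 * norm (A * E - B * C) / (norm (mob_num C E s))^2"
proof -
  have "(norm (mob_num C E s))^2 - (norm (mob_num A B s))^2 = 2 * norm (A * E - B * C)"
    using assms by (simp add: geodesic_def)
  moreover have "1 - x / y = (y - x) / y" if "y \<noteq> 0" for x y :: real
    using that by (simp add: field_simps)
  ultimately show ?thesis using geodesic_nz[OF assms, of s]
    by (simp add: mob_pt_def norm_divide power_divide)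
qed

lemma geodesic_in_ball:
  assumes "geodesic A B C E"
  shows "mob_pt A B C E s \<in> ball 0 1"
proof -
  have "norm (A * E - B * C) > 0" using assms by (simp add: geodesic_def)
  then have "1 - (norm (mob_pt A B C E s))^2 > 0"
    unfolding geodesic_one_minus[OF assms] using geodesic_nz[OF assms] by simp
  then have "(norm (mob_pt A B C E s))^2 < 1^2" by simp
  then show ?thesis using power_less_imp_less_base by fastforce
qed

lemma has_vector_derivative_inverse_complex:
  assumes "(h has_vector_derivative h') (at s)" "h s \<noteq> (0::complex)"
  shows "((\<lambda>s. inverse (h s)) has_vector_derivative - h' / (h s)^2) (at s)"
  using Deriv.has_derivative_inverse[OF assms(2) assms(1)[unfolded has_vector_derivative_def]] assms(2)
  by (simp add: has_vector_derivative_def scaleR_conv_of_real field_simps power2_eq_square)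

lemma mob_pt_deriv:
  assumes "geodesic A B C E"
  shows "(mob_pt A B C E has_vector_derivative (A * E - B * C) / (mob_num C E s)^2) (at s)"
proof -
  have "((\<lambda>s. mob_num A B s * inverse (mob_num C E s)) has_vector_derivative
      mob_num A B s * (- mob_num (C/2) (-E/2) s / (mob_num C E s)^2) + mob_num (A/2) (-B/2) s * inverse (mob_num C E s)) (at s)"
    by (intro has_vector_derivative_mult mob_num_deriv has_vector_derivative_inverse_complex geodesic_nz[OF assms])
  also have "mob_num A B s * (- mob_num (C/2) (-E/2) s / (mob_num C E s)^2) + mob_num (A/2) (-B/2) s * inverse (mob_num C E s)
     = (A * E - B * C) / (mob_num C E s)^2"
    unfolding mob_num_wronskian[of A B s C E, symmetric]
    using geodesic_nz[OF assms, of s] by (simp add: field_simps power2_eq_square)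
  finally show ?thesis by (simp add: mob_pt_def[abs_def] divide_inverse)
qed

text \<open>
  With \<open>T\<close> the arc and \<open>h\<close> its denominator, \<open>T' = (A E - B C) / h\<^sup>2\<close> and \<open>h'' = h / 4\<close>, so \<open>h \<cdot> (v \<circ> T)\<close>
  solves an equation on the line whose coefficient is \<open>1/4\<close> plus a term that Nehari's bound keeps below \<open>1/4\<close>.
\<close>

definition geo_coeff where
  "geo_coeff Q A B C E s = 1/4 + Q (mob_pt A B C E s) * (A * E - B * C)^2 / (mob_num C E s)^4"
definition geo_lift where
  "geo_lift A B C E v s = mob_num C E s * v (mob_pt A B C E s)"
definition geo_lift' where
  "geo_lift' A B C E v v' s = mob_num (C/2) (-E/2) s * v (mob_pt A B C E s) +
      (A * E - B * C) / mob_num C E s * v' (mob_pt A B C E s)"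

lemma geodesic_line_solution:
  assumes g: "geodesic A B C E" and v: "hill_solution (ball 0 1) Q v v'"
  shows "line_solution (geo_coeff Q A B C E) (geo_lift A B C E v) (geo_lift' A B C E v v')"
  unfolding line_solution_def
proof (intro allI conjI)
  fix s
  let ?T = "mob_pt A B C E" and ?D = "A * E - B * C" and ?h = "mob_num C E" and ?h1 = "mob_num (C/2) (-E/2)"
  note nz = geodesic_nz[OF g, of s]
  note V = hill_solutionD[OF v geodesic_in_ball[OF g, of s]]
  have dv: "((\<lambda>s. v (?T s)) has_vector_derivative (?D / (?h s)^2) * v' (?T s)) (at s)"
    using field_vector_diff_chain_at[OF mob_pt_deriv[OF g] V(1)] by (simp add: o_def)
  have dv': "((\<lambda>s. v' (?T s)) has_vector_derivative (?D / (?h s)^2) * (Q (?T s) * v (?T s))) (at s)"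
    using field_vector_diff_chain_at[OF mob_pt_deriv[OF g] V(2)] by (simp add: o_def)
  have dh1: "(?h1 has_vector_derivative ?h s / 4) (at s)"
  proof -
    have eq: "mob_num (C/2/2) (-(-E/2)/2) s = mob_num C E s / 4" by (simp add: mob_num_def field_simps)
    show ?thesis using mob_num_deriv[of "C/2" "-E/2" s] unfolding eq .
  qed
  have "((\<lambda>s. ?h s * v (?T s)) has_vector_derivative ?h s * ((?D / (?h s)^2) * v' (?T s)) + ?h1 s * v (?T s)) (at s)"
    by (rule has_vector_derivative_mult[OF mob_num_deriv dv])
  also have "?h s * ((?D / (?h s)^2) * v' (?T s)) + ?h1 s * v (?T s) = geo_lift' A B C E v v' s"
    using nz by (simp add: geo_lift'_def field_simps power2_eq_square)
  finally show "(geo_lift A B C E v has_vector_derivative geo_lift' A B C E v v' s) (at s)"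
    by (simp add: geo_lift_def[abs_def])
  have alg: "(h1 * ((D / h^2) * v1) + h / 4 * v) +
     (D * inverse h * ((D / h^2) * (q * v)) + D * (- h1 / h^2) * v1)
     = (1/4 + q * D^2 / h^4) * (h * v)" if "h \<noteq> 0" for h h1 D v v1 q :: complex
  proof -
    \<comment> \<open>The two terms in v' cancel because h^2 T' is the constant D.\<close>
    have 1: "D * (- h1 / h^2) * v1 = - (h1 * ((D / h^2) * v1))" by simp
    have 2: "D * inverse h * ((D / h^2) * (q * v)) = (q * D^2 / h^4) * (h * v)"
      using that by (simp add: divide_inverse power2_eq_square power4_eq_xxxx)
    show ?thesis unfolding 1 2 by (simp add: distrib_right)
  qed
  have "((\<lambda>s. ?D * inverse (?h s)) has_vector_derivative ?D * (- ?h1 s / (?h s)^2)) (at s)"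
    by (intro has_vector_derivative_mult_right has_vector_derivative_inverse_complex mob_num_deriv nz)
  then have "((\<lambda>s. ?h1 s * v (?T s) + ?D * inverse (?h s) * v' (?T s)) has_vector_derivative
     (?h1 s * ((?D / (?h s)^2) * v' (?T s)) + ?h s / 4 * v (?T s)) +
     (?D * inverse (?h s) * ((?D / (?h s)^2) * (Q (?T s) * v (?T s))) + ?D * (- ?h1 s / (?h s)^2) * v' (?T s))) (at s)"
    by (intro has_vector_derivative_add has_vector_derivative_mult dh1 dv dv')
  also have "(?h1 s * ((?D / (?h s)^2) * v' (?T s)) + ?h s / 4 * v (?T s)) +
     (?D * inverse (?h s) * ((?D / (?h s)^2) * (Q (?T s) * v (?T s))) + ?D * (- ?h1 s / (?h s)^2) * v' (?T s))
     = geo_coeff Q A B C E s * geo_lift A B C E v s"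
    unfolding geo_lift_def geo_coeff_def by (rule alg[OF nz])
  finally show "(geo_lift' A B C E v v' has_vector_derivative geo_coeff Q A B C E s * geo_lift A B C E v s) (at s)"
    unfolding geo_lift'_def[abs_def] divide_inverse[of ?D] .
qed

lemma geo_lift_wronskian:
  assumes g: "geodesic A B C E" and k: "\<And>z. z \<in> ball 0 1 \<Longrightarrow> u' z * v z - u z * v' z = k"
  shows "geo_lift' A B C E u u' s * geo_lift A B C E v s - geo_lift A B C E u s * geo_lift' A B C E v v' s
      = (A * E - B * C) * k"
  unfolding k[OF geodesic_in_ball[OF g, of s], symmetric]
  using geodesic_nz[OF g, of s] by (simp add: geo_lift_def geo_lift'_def field_simps)

text \<open>By \<open>geodesic_one_minus\<close> the bound at the point of parameter
  \<open>s\<close> reads |Q| |AE - BC|^2 / |h|^4 < 1/4 on every geodesic; the 4 is the square of the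
  factor 2 in the norm identity.\<close>

lemma geo_coeff_pos:
  assumes g: "geodesic A B C E" and Q: "\<And>z. z \<in> ball 0 1 \<Longrightarrow> norm (Q z) < 1 / (1 - (norm z)^2)^2"
  shows "Re (geo_coeff Q A B C E s) > 0"
proof -
  let ?T = "mob_pt A B C E s" and ?D = "A * E - B * C" and ?h = "mob_num C E s"
  have D: "norm ?D > 0" using g by (simp add: geodesic_def)
  have h: "norm ?h > 0" using geodesic_nz[OF g] by simp
  have "norm (Q ?T) < 1 / (2 * norm ?D / (norm ?h)^2)^2"
    using Q[OF geodesic_in_ball[OF g, of s]] unfolding geodesic_one_minus[OF g] .
  then have "norm (Q ?T) * norm ?D ^ 2 < 1/4 * norm ?h ^ 4"
    using D h by (simp add: field_simps)
  moreover have "norm (Q ?T * ?D^2 / ?h^4) = norm (Q ?T) * norm ?D ^ 2 / norm ?h ^ 4"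
    by (simp add: norm_mult norm_divide norm_power)
  ultimately have "norm (Q ?T * ?D^2 / ?h^4) < 1/4"
    using zero_less_power[OF h, of 4] by (simp add: pos_divide_less_eq)
  then have "\<bar>Re (Q ?T * ?D^2 / ?h^4)\<bar> < 1/4"
    using abs_Re_le_cmod[of "Q ?T * ?D^2 / ?h^4"] by linarith
  then show ?thesis by (simp add: geo_coeff_def)
qed

lemma mob_pt_at_top:
  assumes "C \<noteq> 0"
  shows "(mob_pt A B C E \<longlongrightarrow> A / C) at_top"
proof -
  have lim: "((\<lambda>s::real. of_real (exp (-s)) :: complex) \<longlongrightarrow> of_real 0) at_top"
    by (intro tendsto_of_real) real_asymp
  have eq: "mob_pt A B C E s = (A + B * of_real (exp (-s))) / (C + E * of_real (exp (-s)))" for s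
  proof -
    have "mob_num X Y s = of_real (exp (s/2)) * (X + Y * of_real (exp (-s)))" for X Y
    proof -
      have "exp (-s/2) = exp (s/2) * exp (-s)" by (simp flip: exp_add)
      then show ?thesis by (simp add: mob_num_def algebra_simps)
    qed
    then show ?thesis by (simp add: mob_pt_def)
  qed
  have "((\<lambda>s. (A + B * of_real (exp (-s))) / (C + E * of_real (exp (-s)))) \<longlongrightarrow> (A + B * of_real 0) / (C + E * of_real 0)) at_top"
    using assms by (intro tendsto_intros lim) auto
  then show ?thesis by (simp add: eq[abs_def])
qed

lemma mob_pt_reflect: "mob_pt A B C E (-s) = mob_pt B A E C s"
  by (simp add: mob_pt_def mob_num_def add.commute)

lemma mob_pt_at_bot:
  assumes "E \<noteq> 0"
  shows "(mob_pt A B C E \<longlongrightarrow> B / E) at_bot"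
  unfolding filterlim_at_bot_mirror mob_pt_reflect by (rule mob_pt_at_top[OF assms])

section \<open>Geodesics with prescribed end points\<close>

lemma norm_mob_num_sq:
  "(norm (mob_num A B s))^2 = (norm A)^2 * exp s + (norm B)^2 * exp (-s) + 2 * Re (A * cnj B)"
proof -
  define r where "r = exp (s/2)"
  have r: "r > 0" "exp (-s/2) = 1/r" "exp s = r^2" "exp (-s) = 1/r^2"
    by (auto simp: r_def exp_minus field_simps simp flip: exp_of_nat_mult exp_add)
  have "(norm (mob_num A B s))^2 = (Re A * r + Re B / r)^2 + (Im A * r + Im B / r)^2"
    unfolding mob_num_def r(2) r_def[symmetric] cmod_power2 by simp
  also have "\<dots> = ((Re A)^2 + (Im A)^2) * r^2 + ((Re B)^2+(Im B)^2) / r^2 + 2 * (Re A * Re B + Im A * Im B)"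
    using r(1) by (simp add: power2_eq_square field_simps)
  finally show ?thesis unfolding r cmod_power2 by simp
qed

text \<open>For any nonzero weight \<open>k\<close> the expression (z2 e^s + k z1) / (e^s + k) has
  the limits z1 and z2. The choice k = 1 - z2 cnj z1 makes it a geodesic: the exponential terms of
  the norm identity cancel because |z1| = |z2| = 1, and both sides reduce to 2 |k|^2.\<close>

lemma geodesic_boundary:
  assumes z: "norm z1 = 1" "norm z2 = 1" "z1 \<noteq> z2"
  obtains A B C E where "geodesic A B C E"
    "(mob_pt A B C E \<longlongrightarrow> z1) at_bot" "(mob_pt A B C E \<longlongrightarrow> z2) at_top"
proof -
  define k where "k = 1 - z2 * cnj z1"
  have n1: "z1 * cnj z1 = 1" "z2 * cnj z2 = 1"
    using z by (simp_all add: complex_norm_square[symmetric])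
  have k: "k * z1 = z1 - z2" unfolding k_def using n1(1) by (simp add: algebra_simps)
  have nk: "norm k = norm (z2 - z1)"
    using arg_cong[OF k, of norm] z by (simp add: norm_mult norm_minus_commute)
  have k0: "k \<noteq> 0" using k z by auto
  have nk2: "(norm k)^2 = 2 * Re k"
  proof -
    have "(norm (z2 * cnj z1))^2 = 1" using z by (simp add: norm_mult)
    then show ?thesis unfolding k_def cmod_power2 by (simp add: power2_eq_square algebra_simps)
  qed
  have D: "z2 * k - k * z1 * 1 = k * (z2 - z1)" by (simp add: algebra_simps)
  have g: "geodesic z2 (k * z1) 1 k"
    unfolding geodesic_def D
  proof (intro conjI allI)
    show "k * (z2 - z1) \<noteq> 0" using k0 z by auto
    fix s
    have "Re (z2 * cnj (k * z1)) = Re ((1 - k) * cnj k)" by (simp add: k_def algebra_simps)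
    also have "\<dots> = Re k - (norm k)^2" unfolding cmod_power2 by (simp add: power2_eq_square algebra_simps)
    finally show "(norm (mob_num 1 k s))^2 - (norm (mob_num z2 (k * z1) s))^2 = 2 * norm (k * (z2 - z1))"
      unfolding norm_mob_num_sq using z nk by (simp add: norm_mult power2_eq_square)
  qed
  show ?thesis
    by (rule that[OF g]) (use mob_pt_at_top[of 1 z2 "k * z1" k] mob_pt_at_bot[of k z2 "k * z1" 1] k0 in auto)
qed

lemma norm_add_sq: "(norm (x + y))^2 = (norm x)^2 + (norm y)^2 + 2 * Re (x * cnj y)"
  unfolding cmod_power2 by (simp add: power2_eq_square algebra_simps)

lemma norm_diff_sq: "(norm (x - y))^2 = (norm x)^2 + (norm y)^2 - 2 * Re (x * cnj y)"
  unfolding cmod_power2 by (simp add: power2_eq_square algebra_simps)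

lemma Re_add_mult_cnj_diff: "Re ((x + y) * cnj (x - y)) = (norm x)^2 - (norm y)^2"
  unfolding cmod_power2 by (simp add: power2_eq_square algebra_simps)

text \<open>The automorphism x |-> (x - z1) / (1 - cnj z1 x) of the disc moves z1 to 0 and z2 to
  \<open>w\<close>. The geodesic is the diameter e tanh (s/2) in the direction \<open>e\<close> of
  \<open>w\<close>, moved back by the inverse automorphism; this yields the four
  coefficients.\<close>

lemma geodesic_interior:
  assumes z: "norm z1 < 1" "norm z2 \<le> 1" "z1 \<noteq> z2"
  obtains A B C E where "geodesic A B C E" "mob_pt A B C E 0 = z1"
    "(norm z2 < 1 \<and> (\<exists>s>0. mob_pt A B C E s = z2)) \<or> (norm z2 = 1 \<and> (mob_pt A B C E \<longlongrightarrow> z2) at_top)"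
proof -
  define d where "d = 1 - cnj z1 * z2"
  have "norm (cnj z1 * z2) < 1" using z
    by (simp add: norm_mult) (metis mult_left_le norm_ge_zero order_le_less_trans mult.commute)
  then have d0: "d \<noteq> 0" unfolding d_def by auto
  define w where "w = (z2 - z1) / d"
  have w0: "w \<noteq> 0" using z d0 by (simp add: w_def)
  define e where "e = w / of_real (norm w)"
  have e: "norm e = 1" using w0 by (simp add: e_def norm_divide)
  have we: "w = e * of_real (norm w)" using w0 by (simp add: e_def)
  have n1: "1 - (norm z1)^2 > 0" using z by (simp add: power_less_one_iff abs_square_less_1)
  \<comment> \<open>The classical identity behind the invariance of the disc under this
    automorphism; as |z1| < 1, it gives |w| = 1 exactly when |z2| = 1.\<close>
  have key: "(norm d)^2 - (norm (z2 - z1))^2 = (1 - (norm z1)^2) * (1 - (norm z2)^2)"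
    unfolding d_def cmod_power2 by (simp add: power2_eq_square algebra_simps)
  have wn: "1 - (norm w)^2 = (1 - (norm z1)^2) * (1 - (norm z2)^2) / (norm d)^2"
    unfolding key[symmetric] w_def using d0 by (simp add: norm_divide power_divide field_simps)
  have w1: "1 + cnj z1 * w \<noteq> 0"
  proof -
    have "d + cnj z1 * (z2 - z1) = of_real (1 - (norm z1)^2)"
      unfolding d_def of_real_diff complex_norm_square by (simp add: algebra_simps)
    also have "\<dots> \<noteq> 0" using n1 by (metis less_irrefl of_real_eq_0_iff)
    also have "d + cnj z1 * (z2 - z1) = d * (1 + cnj z1 * w)"
      unfolding w_def using d0 by (simp add: distrib_left)
    finally have "d * (1 + cnj z1 * w) \<noteq> 0" .
    then show ?thesis by auto
  qed
  have z2: "(z1 + w) / (1 + cnj z1 * w) = z2"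
  proof -
    have "z1 + w = z2 * (1 + cnj z1 * w)"
      unfolding w_def using d0 by (simp add: field_simps) (simp add: d_def algebra_simps)
    then show ?thesis using w1 by (simp add: field_simps)
  qed
  let ?A = "z1 + e" and ?B = "z1 - e" and ?C = "1 + cnj z1 * e" and ?E = "1 - cnj z1 * e"
  have D: "?A * ?E - ?B * ?C = 2 * e * of_real (1 - (norm z1)^2)"
    unfolding of_real_diff complex_norm_square by (simp add: algebra_simps)
  have nD: "norm (2 * e * of_real (1 - (norm z1)^2)) = 2 * (1 - (norm z1)^2)"
    using n1 e by (simp add: norm_mult del: of_real_diff)
  have g: "geodesic ?A ?B ?C ?E"
    unfolding geodesic_def D
  proof (intro conjI allI)
    show "2 * e * of_real (1 - (norm z1)^2) \<noteq> 0"
      using nD n1 by (metis less_irrefl mult_pos_pos norm_zero zero_less_numeral)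
    fix s
    have cw: "norm (cnj z1 * e) = norm z1" using e by (simp add: norm_mult)
    have 1: "(norm ?A)^2 = (norm ?C)^2"
      using e cw unfolding norm_add_sq by simp
    have 2: "(norm ?B)^2 = (norm ?E)^2"
      using e cw unfolding norm_diff_sq by simp
    have 3: "Re (?C * cnj ?E) - Re (?A * cnj ?B) = 2 * (1 - (norm z1)^2)"
      using e cw unfolding Re_add_mult_cnj_diff by simp
    show "(norm (mob_num ?C ?E s))^2 - (norm (mob_num ?A ?B s))^2 = 2 * norm (2 * e * of_real (1 - (norm z1)^2))"
      unfolding norm_mob_num_sq nD 1 2 using 3 by simp
  qed
  have "mob_pt ?A ?B ?C ?E 0 = z1" by (simp add: mob_pt_def mob_num_def)
  moreover have "(norm z2 < 1 \<and> (\<exists>s>0. mob_pt ?A ?B ?C ?E s = z2)) \<or> (norm z2 = 1 \<and> (mob_pt ?A ?B ?C ?E \<longlongrightarrow> z2) at_top)"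
  proof (cases "norm z2 = 1")
    case True
    then have "(norm w)^2 = 1" using wn by simp
    then have "norm w = 1" using norm_ge_zero[of w] by (simp add: power2_eq_1_iff) 
    then have "w = e" using we by simp
    then show ?thesis using True z2 w1 mob_pt_at_top[of ?C ?A ?B ?E] by simp
  next
    case False
    then have lt: "norm z2 < 1" using z by simp
    then have "1 - (norm z2)^2 > 0" by (simp add: power_less_one_iff abs_square_less_1)
    then have "1 - (norm w)^2 > 0" unfolding wn using n1 d0 by simp
    then have w_lt: "norm w < 1" by (simp add: abs_square_less_1)
    \<comment> \<open>Twice the inverse hyperbolic tangent of |w|, so that tanh (s/2) = |w|.\<close>
    define s where "s = ln ((1 + norm w) / (1 - norm w))"
    have s: "s > 0" unfolding s_def using w_lt w0 by (intro ln_gt_zero) (simp add: field_simps)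
    have es: "exp s = (1 + norm w) / (1 - norm w)"
    proof -
      have "0 < (1 + norm w) / (1 - norm w)" using w_lt by (intro divide_pos_pos) (auto intro: add_pos_nonneg)
      then show ?thesis by (simp add: s_def)
    qed
    define r where "r = exp (s/2)"
    have r: "r > 0" "exp (-s/2) = 1/r" "r^2 = (1 + norm w) / (1 - norm w)"
      unfolding es[symmetric] by (auto simp: r_def exp_minus field_simps simp flip: exp_of_nat_mult)
    have "(r^2 + 1) * norm w = r^2 - 1" unfolding r(3) using w_lt by (simp add: field_simps)
    then have rw: "(of_real r^2 + 1) * of_real (norm w) = (of_real r^2 - 1 :: complex)"
      by (metis of_real_1 of_real_add of_real_diff of_real_mult of_real_power)
    have "mob_num (a + b * e) (a - b * e) s = (of_real r^2 + 1) / of_real r * (a + b * w)" for a b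
    proof -
      have "mob_num (a + b * e) (a - b * e) s = (a * (of_real r^2 + 1) + b * e * (of_real r^2 - 1)) / of_real r"
        unfolding mob_num_def r(2) r_def[symmetric] using r(1) by (simp add: field_simps power2_eq_square)
      also have "\<dots> = (of_real r^2 + 1) / of_real r * (a + b * w)"
        unfolding rw[symmetric] by (subst (2) we) (simp add: field_simps)
      finally show ?thesis .
    qed
    from this[of z1 1] this[of 1 "cnj z1"]
    have "mob_pt ?A ?B ?C ?E s = ((of_real r^2 + 1) / of_real r * (z1 + w)) / ((of_real r^2 + 1) / of_real r * (1 + cnj z1 * w))"
      by (simp add: mob_pt_def)
    also have "\<dots> = (z1 + w) / (1 + cnj z1 * w)"
    proof -
      have "r^2 + 1 > 0" by (intro add_nonneg_pos) auto
      then have "complex_of_real (r^2+1) \<noteq> 0" by (metis less_irrefl of_real_eq_0_iff)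
      then have "(of_real r^2 + 1) / of_real r \<noteq> (0::complex)" using r(1) by simp
      then show ?thesis by simp
    qed
    finally show ?thesis using z2 s lt by auto
  qed
  ultimately show ?thesis using that[OF g] by blast
qed

section \<open>Injective extension to the closed disc\<close>

lemma mob_pt_radial: "mob_pt e (-e) 1 1 s = e * of_real (tanh (s/2))"
proof -
  have "mob_num e (-e) s = e * of_real (exp (s/2) - exp (-s/2))"
    by (simp add: mob_num_def algebra_simps)
  moreover have "mob_num 1 1 s = of_real (exp (s/2) + exp (-s/2))"
    by (simp add: mob_num_def)
  ultimately show ?thesis
    by (simp add: mob_pt_def tanh_altdef)
qed

lemma geodesic_radial:
  assumes "norm e = 1"
  shows "geodesic e (-e) 1 1"
  unfolding geodesic_def norm_mob_num_sq using assms
  by (auto simp: norm_mult complex_norm_square[symmetric] power2_eq_square simp flip: cmod_power2)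

lemma radial_point:
  assumes "z \<in> ball 0 (1::real)" "z \<noteq> (0::complex)"
  obtains e s where "norm e = 1" "s > 0" "mob_pt e (-e) 1 1 s = z"
proof -
  have n: "norm z < 1" "norm z > 0" using assms by auto
  define s where "s = ln ((1 + norm z) / (1 - norm z))"
  have pos: "0 < (1 + norm z) / (1 - norm z)" using n by (intro divide_pos_pos) linarith+
  have "exp (-s) = (1 - norm z) / (1 + norm z)"
    using pos by (simp add: s_def exp_minus)
  moreover have "1 + norm z \<noteq> 0" using n by linarith
  moreover have "1 + exp (-s) \<noteq> 0" using exp_gt_zero[of "-s"] by linarith
  ultimately have "tanh (s/2) = norm z"
    by (simp add: tanh_real_altdef field_simps)
  then have "mob_pt (z / of_real (norm z)) (- (z / of_real (norm z))) 1 1 s = z"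
    unfolding mob_pt_radial using n by simp
  moreover have "s > 0" unfolding s_def using n by (intro ln_gt_zero) (simp add: field_simps)
  moreover have "norm (z / of_real (norm z)) = 1"
    using n by (simp add: norm_divide)
  ultimately show ?thesis using that by force
qed

text \<open>
  The normalization \<open>u' 0 = 0\<close> makes the centre a critical point of the lift of \<open>u\<close> along every
  diameter, so that the lift grows linearly in all directions at once.
\<close>

locale disc_eq =
  fixes Q u u' v v' :: "complex \<Rightarrow> complex"
  assumes bound: "\<And>z. z \<in> ball 0 1 \<Longrightarrow> norm (Q z) < 1 / (1 - (norm z)^2)^2"
    and u: "hill_solution (ball 0 1) Q u u'" "u 0 = 1" "u' 0 = 0"
    and v: "hill_solution (ball 0 1) Q v v'"
    and wronskian: "\<And>z. z \<in> ball 0 1 \<Longrightarrow> v' z * u z - v z * u' z = 1"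
begin

definition psi :: "complex \<Rightarrow> real \<Rightarrow> real" where
  "psi e s = geo_lift e (-e) 1 1 u s \<bullet> geo_lift' e (-e) 1 1 u u' s"

definition phi :: "complex \<Rightarrow> real \<Rightarrow> real" where
  "phi e s = geo_lift e (-e) 1 1 u s \<bullet> geo_lift e (-e) 1 1 u s"

lemma psi_pos:
  assumes "norm e = 1" "s > 0"
  shows "psi e s > 0"
proof -
  note g = geodesic_radial[OF assms(1)]
  have "psi e 0 = 0"
    by (simp add: psi_def geo_lift_def geo_lift'_def mob_pt_radial u mob_num_def)
  moreover have "psi e 0 < psi e s"
    unfolding psi_def
  proof (rule line_solution_inner_strict[OF geodesic_line_solution[OF g u(1)] geo_coeff_pos[OF g bound]])
    show "geo_lift' e (-e) 1 1 v v' s * geo_lift e (-e) 1 1 u s - geo_lift e (-e) 1 1 v s * geo_lift' e (-e) 1 1 u u' s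
       = (e * 1 - - e * 1) * 1" for s
      using geo_lift_wronskian[OF g wronskian] .
    show "(e * 1 - - e * 1) * 1 \<noteq> 0" using assms(1) by auto
  qed (use assms(2) in auto)
  ultimately show ?thesis by simp
qed

lemma u_nonzero:
  assumes "z \<in> ball 0 1"
  shows "u z \<noteq> 0"
proof (cases "z = 0")
  case False
  then obtain e s where es: "norm e = 1" "s > 0" "mob_pt e (-e) 1 1 s = z"
    using radial_point[OF assms] by blast
  from psi_pos[OF es(1,2)] show ?thesis by (auto simp: psi_def geo_lift_def es(3))
qed (use u in auto)

text \<open>Uniformity in the direction comes from compactness: over all unit \<open>e\<close>,
  \<open>psi e 1\<close> has a positive minimum \<open>m\<close> and \<open>phi e 1\<close> a
  maximum \<open>M\<close>. Then \<open>line_solution_growth\<close> from s = 1 makes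
  \<open>psi e s\<close> at least sqrt (2 m^3 (s - 1) / M), and the quotient bound for a Wronskian
  of modulus 2 gives \<open>K\<close>.\<close>

lemma radial_bound:
  obtains K :: real where "K > 0"
    "\<And>e s t. norm e = 1 \<Longrightarrow> 1 < s \<Longrightarrow> s \<le> t \<Longrightarrow>
       norm (v (mob_pt e (-e) 1 1 t) / u (mob_pt e (-e) 1 1 t) - v (mob_pt e (-e) 1 1 s) / u (mob_pt e (-e) 1 1 s))
         \<le> K / sqrt (s - 1)"
proof -
  have cont: "continuous_on (sphere 0 1) (\<lambda>e. f (mob_pt e (-e) 1 1 1))" if "f holomorphic_on ball 0 1" for f
  proof (rule continuous_on_compose2[OF holomorphic_on_imp_continuous_on[OF that]])
    show "continuous_on (sphere 0 1) (\<lambda>e. mob_pt e (-e) 1 1 1)"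
      unfolding mob_pt_radial by (intro continuous_intros)
    show "(\<lambda>e. mob_pt e (-e) 1 1 1) ` sphere 0 1 \<subseteq> ball 0 1"
      using geodesic_in_ball[OF geodesic_radial] by auto
  qed
  note cont = cont[OF hill_solution_holomorphic(1)[OF u(1)]] cont[OF hill_solution_holomorphic(2)[OF u(1)]]
  have cpsi: "continuous_on (sphere 0 1) (\<lambda>e. psi e 1)"
    unfolding psi_def geo_lift_def geo_lift'_def
    by (intro continuous_intros cont) (use geodesic_nz[OF geodesic_radial[of 1]] in auto)
  have cphi: "continuous_on (sphere 0 1) (\<lambda>e. phi e 1)"
    unfolding phi_def geo_lift_def by (intro continuous_intros cont)
  have ne: "sphere 0 1 \<noteq> ({}::complex set)" by simp
  obtain e1 where e1: "norm e1 = 1" "\<And>e. norm e = 1 \<Longrightarrow> psi e1 1 \<le> psi e 1"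
    using continuous_attains_inf[OF compact_sphere ne cpsi] by auto
  obtain e2 where e2: "norm e2 = 1" "\<And>e. norm e = 1 \<Longrightarrow> phi e 1 \<le> phi e2 1"
    using continuous_attains_sup[OF compact_sphere ne cphi] by auto
  define m where "m = psi e1 1"
  define M where "M = phi e2 1"
  have m: "m > 0" unfolding m_def using psi_pos[OF e1(1)] by simp
  have "phi e2 1 > 0" using psi_pos[OF e2(1), of 1] by (auto simp: phi_def psi_def)
  then have M: "M > 0" by (simp add: M_def)
  define K where "K = 2 / sqrt (2 * m^3 / M)"
  show ?thesis
  proof (rule that[of K])
    show "K > 0" using m M by (simp add: K_def)
    fix e :: complex and s t :: real assume e: "norm e = 1" and st: "1 < s" "s \<le> t"
    note g = geodesic_radial[OF e]
    note U = geodesic_line_solution[OF g u(1)] and V = geodesic_line_solution[OF g v]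
    note q = geo_coeff_pos[OF g bound]
    have p1: "psi e 1 > 0" "psi e s > 0" using psi_pos[OF e] st by auto
    have ph: "phi e 1 > 0" using p1(1) by (auto simp: phi_def psi_def)
    have "2 * m^3 / M * (s - 1) = m^2 / M * (2 * m * (s - 1))"
      by (simp add: power2_eq_square power3_eq_cube)
    also have "\<dots> \<le> (psi e 1)^2 / phi e 1 * (phi e 1 + 2 * psi e 1 * (s - 1))"
    proof (rule mult_mono)
      show "m^2 / M \<le> (psi e 1)^2 / phi e 1"
        using e1(2)[OF e] e2(2)[OF e] m M ph unfolding m_def[symmetric] M_def[symmetric]
        by (intro frac_le power_mono) auto
      have "2 * m * (s - 1) \<le> 2 * psi e 1 * (s - 1)"
        using e1(2)[OF e] st unfolding m_def[symmetric] by (intro mult_right_mono) auto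
      then show "2 * m * (s - 1) \<le> phi e 1 + 2 * psi e 1 * (s - 1)" using ph by linarith
    qed (use m st p1 ph in auto)
    also have "\<dots> \<le> (psi e s)^2"
      unfolding psi_def phi_def
      using line_solution_growth[OF U q p1(1)[unfolded psi_def], of s] st by simp
    finally have "sqrt (2 * m^3 / M * (s - 1)) \<le> psi e s"
      using p1(2) by (intro real_le_lsqrt) auto
    then have pb: "sqrt (2 * m^3 / M) * sqrt (s - 1) \<le> psi e s"
      by (simp only: real_sqrt_mult)
    have eq: "geo_lift e (-e) 1 1 v x / geo_lift e (-e) 1 1 u x = v (mob_pt e (-e) 1 1 x) / u (mob_pt e (-e) 1 1 x)" for x
      using geodesic_nz[OF g] by (simp add: geo_lift_def)
    have "norm (geo_lift e (-e) 1 1 v t / geo_lift e (-e) 1 1 u t - geo_lift e (-e) 1 1 v s / geo_lift e (-e) 1 1 u s)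
        \<le> norm ((e * 1 - - e * 1) * 1) / (geo_lift e (-e) 1 1 u s \<bullet> geo_lift' e (-e) 1 1 u u' s)"
      by (rule line_solution_quotient_bound[OF U V q geo_lift_wronskian[OF g wronskian] p1(2)[unfolded psi_def] st(2)]) auto
    also have "\<dots> = 2 / psi e s" using e by (simp add: psi_def)
    also have "\<dots> \<le> 2 / (sqrt (2 * m^3 / M) * sqrt (s - 1))"
      using pb m M st by (intro divide_left_mono) (auto intro!: mult_pos_pos p1)
    also have "\<dots> = K / sqrt (s - 1)" by (simp add: K_def)
    finally show "norm (v (mob_pt e (-e) 1 1 t) / u (mob_pt e (-e) 1 1 t) - v (mob_pt e (-e) 1 1 s) / u (mob_pt e (-e) 1 1 s))
         \<le> K / sqrt (s - 1)"
      unfolding eq .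
  qed
qed

lemma extension:
  obtains G where "continuous_on (cball 0 1) G" "\<And>z. z \<in> ball 0 1 \<Longrightarrow> G z = v z / u z"
proof -
  \<comment> \<open>Dilations: on the unit circle \<open>g n\<close> takes the values of the ratio
    at parameter \<open>n\<close> of the radii, where the modulus is tanh (n/2).\<close>
  define g where "g n z = v (of_real (tanh (real n / 2)) * z) / u (of_real (tanh (real n / 2)) * z)" for n and z :: complex
  have tn: "norm (of_real (tanh (real n / 2)) :: complex) < 1" for n
    using tanh_real_bounds[of "real n / 2"] by auto
  have inb: "of_real (tanh (real n / 2)) * z \<in> ball 0 1" if "norm z \<le> 1" for n and z :: complex
  proof -
    have "norm (of_real (tanh (real n / 2)) * z) \<le> norm (of_real (tanh (real n / 2)) :: complex) * 1"
      unfolding norm_mult using that by (intro mult_left_mono) auto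
    also have "\<dots> < 1" using tn by simp
    finally show ?thesis by simp
  qed
  have holq: "(\<lambda>z. v z / u z) holomorphic_on ball 0 1"
    using u_nonzero by (intro holomorphic_on_divide hill_solution_holomorphic[OF u(1)] hill_solution_holomorphic[OF v]) auto
  have gc: "continuous_on (cball 0 1) (g n)" for n
    unfolding g_def
    by (rule continuous_on_compose2[OF holomorphic_on_imp_continuous_on[OF holq]])
       (use inb in \<open>auto intro!: continuous_intros\<close>)
  have gh: "g n holomorphic_on ball 0 1" for n
  proof -
    have "((\<lambda>z. v z / u z) \<circ> (\<lambda>z. of_real (tanh (real n / 2)) * z)) holomorphic_on ball 0 1"
      by (rule holomorphic_on_compose_gen[OF _ holq]) (use inb in \<open>auto intro!: holomorphic_intros\<close>)
    then show ?thesis by (simp add: o_def g_def[abs_def])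
  qed
  obtain K where K: "K > 0" 
    "\<And>e s t. norm e = 1 \<Longrightarrow> 1 < s \<Longrightarrow> s \<le> t \<Longrightarrow>
       norm (v (mob_pt e (-e) 1 1 t) / u (mob_pt e (-e) 1 1 t) - v (mob_pt e (-e) 1 1 s) / u (mob_pt e (-e) 1 1 s))
         \<le> K / sqrt (s - 1)"
    using radial_bound by blast
  \<comment> \<open>The radial estimate applies on the unit circle; the maximum modulus principle
    carries it to the closed disc. The condition m \<ge> 2 places the parameter beyond 1.\<close>
  have diff: "norm (g n z - g m z) \<le> K / sqrt (real m - 1)" if mn: "2 \<le> m" "m \<le> n" and z: "z \<in> cball 0 1" for m n z
  proof (rule maximum_modulus_frontier[of "\<lambda>z. g n z - g m z" "cball 0 1"])
    fix e :: complex assume "e \<in> frontier (cball 0 1)"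
    then have e: "norm e = 1" by simp
    show "norm (g n e - g m e) \<le> K / sqrt (real m - 1)"
      using K(2)[OF e, of "real m" "real n"] mn by (simp add: g_def mob_pt_radial mult.commute)
  qed (use z gh gc in \<open>auto intro!: holomorphic_intros continuous_intros\<close>)
  have "uniformly_Cauchy_on (cball 0 1) g"
  proof (rule uniformly_Cauchy_onI')
    fix \<epsilon> :: real assume \<epsilon>: "\<epsilon> > 0"
    have "(\<lambda>m. K / sqrt (real m - 1)) \<longlonglongrightarrow> 0" by real_asymp
    then have "eventually (\<lambda>m. K / sqrt (real m - 1) < \<epsilon> \<and> 2 \<le> m) sequentially"
      using \<epsilon> K(1) by (intro eventually_conj eventually_ge_at_top) (auto dest: order_tendstoD)
    then obtain N where N: "\<And>m. m \<ge> N \<Longrightarrow> K / sqrt (real m - 1) < \<epsilon> \<and> 2 \<le> m"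
      by (auto simp: eventually_sequentially)
    show "\<exists>M. \<forall>x\<in>cball 0 1. \<forall>m\<ge>M. \<forall>n>m. dist (g m x) (g n x) < \<epsilon>"
    proof (intro exI[of _ N] ballI allI impI)
      fix x :: complex and m n assume x: "x \<in> cball 0 1" and mn: "N \<le> m" "m < n"
      have "dist (g m x) (g n x) \<le> K / sqrt (real m - 1)"
        using diff[of m n x] N[OF mn(1)] mn x by (simp add: dist_norm norm_minus_commute)
      then show "dist (g m x) (g n x) < \<epsilon>" using N[OF mn(1)] by linarith
    qed
  qed
  then obtain G where G: "uniform_limit (cball 0 1) g G sequentially"
    using Cauchy_uniformly_convergent uniformly_convergent_on_def by blast
  show ?thesis
  proof (rule that)
    show "continuous_on (cball 0 1) G"
      by (rule uniform_limit_theorem[OF _ G]) (use gc in auto)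
    fix z :: complex assume z: "z \<in> ball 0 1"
    have 1: "(\<lambda>n. g n z) \<longlonglongrightarrow> G z"
      using tendsto_uniform_limitI[OF G, of z] z by auto
    have "isCont (\<lambda>z. v z / u z) z"
      using holomorphic_on_imp_continuous_on[OF holq] z by (simp add: continuous_on_eq_continuous_at)
    moreover have "(\<lambda>n. of_real (tanh (real n / 2)) * z) \<longlonglongrightarrow> of_real 1 * z"
      by (intro tendsto_intros) (unfold tanh_altdef, real_asymp)
    ultimately have "(\<lambda>n. g n z) \<longlonglongrightarrow> v z / u z"
      unfolding g_def using isCont_tendsto_compose[of z "\<lambda>z. v z / u z" "\<lambda>n. of_real (tanh (real n / 2)) * z" sequentially] by simp
    then show "G z = v z / u z" using 1 LIMSEQ_unique by blast
  qed
qed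

text \<open>A repeated value c makes w = v - c u vanish, outright or relative to \<open>u\<close>,
  at both ends of a geodesic. Its lift W has W \<bullet> W' = 0 at an interior end, while vanishing
  at s = +\<infinity> makes W \<bullet> W' negative throughout and vanishing at s = -\<infinity>
  makes it positive. Two interior ends contradict strict monotonicity, the other cases these
  signs.\<close>

lemma extension_inj:
  assumes Gc: "continuous_on (cball 0 1) G" and G: "\<And>z. z \<in> ball 0 1 \<Longrightarrow> G z = v z / u z"
  shows "inj_on G (cball 0 1)"
proof -
  have interior: False if z: "norm z1 < 1" "norm z2 \<le> 1" "z1 \<noteq> z2" and eq: "G z1 = G z2" for z1 z2
  proof -
    obtain A B C E where g: "geodesic A B C E" and T0: "mob_pt A B C E 0 = z1"
      and T: "(norm z2 < 1 \<and> (\<exists>s>0. mob_pt A B C E s = z2)) \<or> (norm z2 = 1 \<and> (mob_pt A B C E \<longlongrightarrow> z2) at_top)"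
      using geodesic_interior[OF z] by blast
    define c where "c = G z1"
    define w where "w = (\<lambda>z. 1 * v z + (-c) * u z)"
    define w' where "w' = (\<lambda>z. 1 * v' z + (-c) * u' z)"
    have w: "hill_solution (ball 0 1) Q w w'" unfolding w_def w'_def by (rule hill_solution_lincomb[OF v u(1)])
    have k: "u' z * w z - u z * w' z = -1" if "z \<in> ball 0 1" for z
      using wronskian[OF that] by (simp add: w_def w'_def algebra_simps)
    note W = geodesic_line_solution[OF g w] and U = geodesic_line_solution[OF g u(1)]
    note q = geo_coeff_pos[OF g bound]
    have D: "(A * E - B * C) * -1 \<noteq> 0" using g unfolding mult_eq_0_iff geodesic_def by auto
    note k' = geo_lift_wronskian[OF g k]
    have zero: "geo_lift A B C E w s = 0" if "G (mob_pt A B C E s) = c" for s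
      using that G[OF geodesic_in_ball[OF g, of s]] u_nonzero[OF geodesic_in_ball[OF g, of s]]
      by (auto simp: geo_lift_def w_def field_simps)
    have z0: "geo_lift A B C E w 0 = 0" using zero[of 0] T0 by (simp add: c_def)
    from T show False
    proof (elim disjE conjE exE)
      fix s assume s: "0 < s" "mob_pt A B C E s = z2"
      have "geo_lift A B C E w s = 0" using zero[of s] s eq by (simp add: c_def)
      with z0 line_solution_inner_strict[OF W q k' D s(1)] show False by simp
    next
      assume n2: "norm z2 = 1" and lim: "(mob_pt A B C E \<longlongrightarrow> z2) at_top"
      have nz: "geo_lift A B C E u s \<noteq> 0" for s
        using geodesic_nz[OF g] u_nonzero[OF geodesic_in_ball[OF g]] by (auto simp: geo_lift_def)
      have "geo_lift A B C E w s / geo_lift A B C E u s = G (mob_pt A B C E s) - c" for s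
        using nz[of s] G[OF geodesic_in_ball[OF g, of s]] by (simp add: geo_lift_def w_def field_simps)
      moreover have "((\<lambda>s. G (mob_pt A B C E s) - c) \<longlongrightarrow> G z2 - c) at_top"
        using geodesic_in_ball[OF g] n2
        by (intro tendsto_intros continuous_on_tendsto_compose[OF Gc lim]) (auto intro!: always_eventually less_imp_le)
      ultimately have "((\<lambda>s. geo_lift A B C E w s / geo_lift A B C E u s) \<longlongrightarrow> 0) at_top"
        using eq by (simp add: c_def)
      from line_solution_vanishing_at_top[OF W U q k' D this nz, of 0] z0 show False by simp
    qed
  qed
  have boundary: False if z: "norm z1 = 1" "norm z2 = 1" "z1 \<noteq> z2" and eq: "G z1 = G z2" for z1 z2
  proof -
    obtain A B C E where g: "geodesic A B C E" and 
      lim: "(mob_pt A B C E \<longlongrightarrow> z1) at_bot" "(mob_pt A B C E \<longlongrightarrow> z2) at_top"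
      using geodesic_boundary[OF z] by blast
    define c where "c = G z1"
    define w where "w = (\<lambda>z. 1 * v z + (-c) * u z)"
    define w' where "w' = (\<lambda>z. 1 * v' z + (-c) * u' z)"
    have w: "hill_solution (ball 0 1) Q w w'" unfolding w_def w'_def by (rule hill_solution_lincomb[OF v u(1)])
    have k: "u' z * w z - u z * w' z = -1" if "z \<in> ball 0 1" for z
      using wronskian[OF that] by (simp add: w_def w'_def algebra_simps)
    note W = geodesic_line_solution[OF g w] and U = geodesic_line_solution[OF g u(1)]
    note q = geo_coeff_pos[OF g bound]
    have D: "(A * E - B * C) * -1 \<noteq> 0" using g unfolding mult_eq_0_iff geodesic_def by auto
    note k' = geo_lift_wronskian[OF g k]
    have nz: "geo_lift A B C E u s \<noteq> 0" for s
      using geodesic_nz[OF g] u_nonzero[OF geodesic_in_ball[OF g]] by (auto simp: geo_lift_def)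
    have "geo_lift A B C E w s / geo_lift A B C E u s = G (mob_pt A B C E s) - c" for s
      using nz[of s] G[OF geodesic_in_ball[OF g, of s]] by (simp add: geo_lift_def w_def field_simps)
    moreover have "((\<lambda>s. G (mob_pt A B C E s) - c) \<longlongrightarrow> G z2 - c) at_top"
        "((\<lambda>s. G (mob_pt A B C E s) - c) \<longlongrightarrow> G z1 - c) at_bot"
      using geodesic_in_ball[OF g] z
      by (intro tendsto_intros continuous_on_tendsto_compose[OF Gc lim(1)] continuous_on_tendsto_compose[OF Gc lim(2)];
          auto intro!: always_eventually less_imp_le)+
    ultimately have "((\<lambda>s. geo_lift A B C E w s / geo_lift A B C E u s) \<longlongrightarrow> 0) at_top"
        "((\<lambda>s. geo_lift A B C E w s / geo_lift A B C E u s) \<longlongrightarrow> 0) at_bot"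
      using eq by (simp_all add: c_def)
    from line_solution_vanishing_at_top[OF W U q k' D this(1) nz, of 0] line_solution_vanishing_at_bot[OF W U q k' D this(2) nz, of 0]
    show False by simp
  qed
  show ?thesis
  proof (rule inj_onI, rule ccontr)
    fix z1 z2 :: complex assume z: "z1 \<in> cball 0 1" "z2 \<in> cball 0 1" "G z1 = G z2" "z1 \<noteq> z2"
    consider "norm z1 < 1" | "norm z2 < 1" | "norm z1 = 1" "norm z2 = 1"
      using z(1,2) by fastforce
    then show False
      using interior[of z1 z2] interior[of z2 z1] boundary[of z1 z2] z by cases auto
  qed
qed

end

theorem disc_extension:
  assumes "Q holomorphic_on ball 0 1"
    and "\<And>z. z \<in> ball 0 1 \<Longrightarrow> norm (Q z) < 1 / (1 - (norm z)^2)^2"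
  obtains u u' v v' G where "hill_solution (ball 0 1) Q u u'" "hill_solution (ball 0 1) Q v v'"
    "\<And>z. z \<in> ball 0 1 \<Longrightarrow> v' z * u z - v z * u' z = 1"
    "\<And>z. z \<in> ball 0 1 \<Longrightarrow> u z \<noteq> 0"
    "continuous_on (cball 0 1) G" "\<And>z. z \<in> ball 0 1 \<Longrightarrow> G z = v z / u z" "inj_on G (cball 0 1)"
proof -
  obtain u u' where u: "hill_solution (ball 0 1) Q u u'" "u 0 = 1" "u' 0 = 0"
    using hill_solution_exists_disc[OF assms(1)] by metis
  obtain v v' where v: "hill_solution (ball 0 1) Q v v'" "v 0 = 0" "v' 0 = 1"
    using hill_solution_exists_disc[OF assms(1)] by metis
  obtain k where k: "\<And>z. z \<in> ball 0 1 \<Longrightarrow> v' z * u z - v z * u' z = k"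
    using wronskian_const[OF convex_ball u(1) v(1)] by blast
  have "k = 1" using k[of 0] u v by simp
  interpret disc_eq Q u u' v v'
    by unfold_locales (use assms u v k \<open>k = 1\<close> in auto)
  obtain G where "continuous_on (cball 0 1) G" "\<And>z. z \<in> ball 0 1 \<Longrightarrow> G z = v z / u z"
    using extension by blast
  then show ?thesis using that u v wronskian u_nonzero extension_inj by blast
qed

section \<open>From the disc to strips\<close>

text \<open>Origin of the half-height pi/4: cos (2 Im w) is positive on the band |Im w| < pi/4, so
  \<open>tanh\<close> maps this band into the unit disc.\<close>

lemma norm_cosh_sinh: "(norm (cosh w))^2 - (norm (sinh w))^2 = cos (2 * Im w)"
proof -
  have "exp w * cnj (exp (-w)) = exp (2 * \<i> * of_real (Im w))"
  proof -
    have "w + cnj (-w) = 2 * \<i> * of_real (Im w)" by (simp add: complex_eq_iff)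
    then show ?thesis by (simp only: exp_cnj exp_add[symmetric])
  qed
  then have "Re (exp w * cnj (exp (-w))) = cos (2 * Im w)"
    by (simp add: Re_exp)
  moreover have "(norm (cosh w))^2 = (norm (exp w + exp (-w)))^2 / 4"
    "(norm (sinh w))^2 = (norm (exp w - exp (-w)))^2 / 4"
    by (simp_all add: cosh_field_def sinh_field_def norm_divide power_divide)
  ultimately show ?thesis unfolding norm_add_sq norm_diff_sq by simp
qed

lemma cos_double_nonneg: "\<bar>y\<bar> \<le> pi/4 \<Longrightarrow> cos (2 * y) \<ge> 0"
  by (rule cos_ge_zero) auto

lemma cos_double_pos: "\<bar>y\<bar> < pi/4 \<Longrightarrow> cos (2 * y) > 0"
  by (rule cos_gt_zero_pi) auto

lemma cosh_nonzero_strip: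
  assumes "\<bar>Im w\<bar> \<le> pi/4"
  shows "cosh w \<noteq> (0::complex)"
proof
  assume 0: "cosh w = 0"
  then have "0 - (norm (sinh w))^2 = cos (2 * Im w)"
    using norm_cosh_sinh[of w] by simp
  then have "(norm (sinh w))^2 \<le> 0" using cos_double_nonneg[OF assms] by linarith
  then have "sinh w = 0" by simp
  with 0 show False using hyperbolic_pythagoras[of w] by simp
qed

lemma tanh_one_minus_sq:
  assumes "cosh w \<noteq> (0::complex)"
  shows "1 - (tanh w)^2 = 1 / (cosh w)^2"
proof -
  have "1 - x / y = (y - x) / y" if "y \<noteq> 0" for x y :: complex
    using that by (simp add: field_simps)
  then show ?thesis using assms unfolding hyperbolic_pythagoras[of w, symmetric]
    by (simp add: tanh_def power_divide)
qed

lemma tanh_one_minus_norm_sq: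
  assumes "cosh w \<noteq> (0::complex)"
  shows "1 - (norm (tanh w))^2 = cos (2 * Im w) / (norm (cosh w))^2"
proof -
  have "1 - x / y = (y - x) / y" if "y \<noteq> 0" for x y :: real
    using that by (simp add: field_simps)
  then show ?thesis using assms unfolding norm_cosh_sinh[symmetric]
    by (simp add: tanh_def norm_divide power_divide)
qed

lemma tanh_in_ball:
  assumes "\<bar>Im w\<bar> < pi/4"
  shows "tanh w \<in> ball 0 (1::real)"
proof -
  have nz: "cosh w \<noteq> 0" using cosh_nonzero_strip assms by simp
  have "1 - (norm (tanh w))^2 > 0"
    unfolding tanh_one_minus_norm_sq[OF nz] using cos_double_pos[OF assms] nz by simp
  then show ?thesis by (simp add: abs_square_less_1)
qed

lemma tanh_in_cball:
  assumes "\<bar>Im w\<bar> \<le> pi/4"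
  shows "tanh w \<in> cball 0 (1::real)"
proof -
  have nz: "cosh w \<noteq> 0" using cosh_nonzero_strip assms by simp
  have "1 - (norm (tanh w))^2 \<ge> 0"
    unfolding tanh_one_minus_norm_sq[OF nz] using cos_double_nonneg[OF assms] by simp
  then show ?thesis by (simp add: abs_square_le_1)
qed

lemma tanh_neq_one:
  assumes "\<bar>Im w\<bar> \<le> pi/4"
  shows "tanh w \<noteq> (1::complex)" "tanh w \<noteq> -1"
  using tanh_one_minus_sq[OF cosh_nonzero_strip[OF assms]] cosh_nonzero_strip[OF assms] by auto

lemma exp_tanh:
  assumes "\<bar>Im w\<bar> \<le> pi/4"
  shows "(1 + tanh w) / (1 - tanh w) = (exp (2 * w) :: complex)"
proof -
  have nz: "cosh w \<noteq> 0" by (rule cosh_nonzero_strip[OF assms])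
  have "1 + tanh w = (cosh w + sinh w) / cosh w" "1 - tanh w = (cosh w - sinh w) / cosh w"
    using nz by (simp_all add: tanh_def add_divide_distrib diff_divide_distrib)
  then have "(1 + tanh w) / (1 - tanh w) = (cosh w + sinh w) / (cosh w - sinh w)"
    using nz by simp
  also have "\<dots> = exp w / exp (-w)" by (simp only: cosh_plus_sinh cosh_minus_sinh)
  also have "\<dots> = exp (2 * w)" by (simp flip: exp_diff)
  finally show ?thesis .
qed

lemma tanh_inj_strip: "inj_on tanh {w::complex. \<bar>Im w\<bar> \<le> pi/4}"
proof (rule inj_onI)
  fix w z :: complex assume wz: "w \<in> {w. \<bar>Im w\<bar> \<le> pi/4}" "z \<in> {w. \<bar>Im w\<bar> \<le> pi/4}" "tanh w = tanh z"
  then have e: "exp (2 * w) = exp (2 * z)"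
    using exp_tanh[of w] exp_tanh[of z] by simp
  have "\<bar>Im (2 * w) - Im (2 * z)\<bar> < 2 * pi" using wz(1,2) pi_gt_zero by (simp; linarith)
  from exp_complex_eqI[OF this e] show "w = z" by simp
qed

text \<open>This is artanh. The quotient has positive real part on the disc, so its principal
  logarithm is holomorphic there and the values satisfy |Im| < pi/4.\<close>

definition disc_to_strip :: "complex \<Rightarrow> complex" where
  "disc_to_strip x = Ln ((1 + x) / (1 - x)) / 2"

lemma Re_cayley_pos:
  assumes "x \<in> ball 0 (1::real)"
  shows "Re ((1 + x) / (1 - x)) > 0"
proof -
  have n: "norm x < 1" using assms by simp
  then have "1 - x \<noteq> 0" by auto
  have "Re ((1 + x) / (1 - x)) = Re ((1 + x) * cnj (1 - x)) / (norm (1 - x))^2"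
    by (subst complex_div_cnj) (simp only: Re_divide_of_real of_real_power[symmetric])
  also have "\<dots> = (1 - (norm x)^2) / (norm (1 - x))^2"
    unfolding Re_add_mult_cnj_diff by simp
  also have "\<dots> > 0" using n \<open>1 - x \<noteq> 0\<close> by (intro divide_pos_pos) (auto simp: abs_square_less_1)
  finally show ?thesis .
qed

lemma disc_to_strip_holomorphic: "disc_to_strip holomorphic_on ball 0 1"
  unfolding disc_to_strip_def
proof (intro holomorphic_intros)
  fix z :: complex assume "z \<in> ball 0 1"
  from Re_cayley_pos[OF this] show "(1 + z) / (1 - z) \<notin> \<real>\<^sub>\<le>\<^sub>0"
    by (auto simp: complex_nonpos_Reals_iff)
qed auto

lemma disc_to_strip_Im:
  assumes "x \<in> ball 0 1"
  shows "\<bar>Im (disc_to_strip x)\<bar> < pi/4"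
proof -
  have "\<bar>Im (Ln w)\<bar> < pi/2" if "Re w > 0" for w
    using Re_Ln_pos_lt[of w] that by fastforce
  from this[OF Re_cayley_pos[OF assms]] show ?thesis by (simp add: disc_to_strip_def)
qed

lemma disc_to_strip_tanh:
  assumes "\<bar>Im w\<bar> < pi/4"
  shows "disc_to_strip (tanh w) = w"
proof -
  have "Ln (exp (2 * w)) = 2 * w" using assms by (intro Ln_exp) auto
  then show ?thesis using exp_tanh[of w] assms by (simp add: disc_to_strip_def)
qed

lemma tanh_disc_to_strip:
  assumes "x \<in> ball 0 1"
  shows "tanh (disc_to_strip x) = x"
proof -
  have x: "1 - x \<noteq> 0" "1 + x \<noteq> 0" using assms by (auto simp: add_eq_0_iff)
  let ?t = "tanh (disc_to_strip x)"
  have "(1 + ?t) / (1 - ?t) = exp (Ln ((1 + x) / (1 - x)))"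
    using exp_tanh[of "disc_to_strip x"] disc_to_strip_Im[OF assms] by (simp add: disc_to_strip_def)
  also have "\<dots> = (1 + x) / (1 - x)" using x by (intro exp_Ln) auto
  finally have "(1 + ?t) * (1 - x) = (1 + x) * (1 - ?t)"
    using x tanh_neq_one[of "disc_to_strip x"] disc_to_strip_Im[OF assms] by (simp add: frac_eq_eq)
  then show ?thesis by (simp add: algebra_simps)
qed

section \<open>Liouville change of variable from a strip to the disc\<close>

locale strip_transfer =
  fixes c k :: real and q :: "complex \<Rightarrow> complex" and S :: "complex set"
  assumes k: "k > 0"
    and S: "S = {z. \<bar>k * (Im z - c)\<bar> < pi/4}"
    and q: "q holomorphic_on S"
begin

definition arg :: "complex \<Rightarrow> complex" where "arg z = of_real k * (z - \<i> * of_real c)"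

text \<open>With x = tanh (arg z) the denominator is (dx/dz)^2. Subtracting k^2 accounts for the
  Schwarzian of \<open>tanh\<close>: the equation f'' = k^2 f, with solutions cosh (arg z) and sinh
  (arg z), becomes v'' = 0, with solutions 1 and x.\<close>

definition Q :: "complex \<Rightarrow> complex" where
  "Q x = (q (disc_to_strip x / of_real k + \<i> * of_real c) - of_real k^2) / (of_real k^2 * (1 - x^2)^2)"

lemma Im_arg [simp]: "Im (arg z) = k * (Im z - c)"
  by (simp add: arg_def)

lemma Q_holomorphic: "Q holomorphic_on ball 0 1"
proof -
  have "(q \<circ> (\<lambda>x. disc_to_strip x / of_real k + \<i> * of_real c)) holomorphic_on ball 0 1"
  proof (rule holomorphic_on_compose_gen[OF _ q])
    show "(\<lambda>x. disc_to_strip x / of_real k + \<i> * of_real c) holomorphic_on ball 0 1"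
      by (intro holomorphic_intros disc_to_strip_holomorphic) (use k in auto)
    show "(\<lambda>x. disc_to_strip x / of_real k + \<i> * of_real c) ` ball 0 1 \<subseteq> S"
      using disc_to_strip_Im k unfolding S by auto
  qed
  moreover have "of_real k^2 * (1 - x^2)^2 \<noteq> 0" if "x \<in> ball 0 1" for x :: complex
    using that k by (auto simp: square_eq_1_iff power2_eq_1_iff)
  ultimately show ?thesis unfolding Q_def o_def by (intro holomorphic_intros) auto
qed

lemma arg_S: "z \<in> S \<Longrightarrow> \<bar>Im (arg z)\<bar> < pi/4"
  by (simp add: S)

lemma Q_tanh:
  assumes "z \<in> S"
  shows "Q (tanh (arg z)) = (q z - of_real k^2) * (cosh (arg z))^4 / of_real k^2"
proof -
  note a = arg_S[OF assms]
  have nz: "cosh (arg z) \<noteq> 0" using cosh_nonzero_strip a by simp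
  have "arg z / of_real k + \<i> * of_real c = z" using k by (simp add: arg_def)
  then show ?thesis
    unfolding Q_def disc_to_strip_tanh[OF a] tanh_one_minus_sq[OF nz]
    using k nz by (simp add: power_divide flip: power_mult)
qed

text \<open>The factor \<open>cosh (arg z)\<close> is a constant multiple of (dx/dz)^(-1/2), the
  weight of the Liouville transformation to x = tanh (arg z).\<close>

definition lift :: "(complex \<Rightarrow> complex) \<Rightarrow> complex \<Rightarrow> complex" where
  "lift v z = cosh (arg z) * v (tanh (arg z))"
definition lift' :: "(complex \<Rightarrow> complex) \<Rightarrow> (complex \<Rightarrow> complex) \<Rightarrow> complex \<Rightarrow> complex" where
  "lift' v v' z = of_real k * (sinh (arg z) * v (tanh (arg z)) + inverse (cosh (arg z)) * v' (tanh (arg z)))"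

lemma lift_solution:
  assumes v: "hill_solution (ball 0 1) Q v v'"
  shows "hill_solution S q (lift v) (lift' v v')"
  unfolding hill_solution_def
proof (intro ballI conjI)
  fix z assume z: "z \<in> S"
  note a = arg_S[OF z]
  have nz: "cosh (arg z) \<noteq> 0" using cosh_nonzero_strip a by simp
  note V = hill_solutionD[OF v tanh_in_ball[OF a]]
  let ?C = "cosh (arg z)" and ?Sh = "sinh (arg z)" and ?t = "tanh (arg z)" and ?k = "of_real k :: complex"
  have da: "(arg has_field_derivative ?k) (at z)"
    unfolding arg_def by (auto intro!: derivative_eq_intros)
  have dt: "((\<lambda>z. tanh (arg z)) has_field_derivative ?k / ?C^2) (at z)"
    using has_field_derivative_tanh[OF nz da] tanh_one_minus_sq[OF nz] by simp
  have dC: "((\<lambda>z. cosh (arg z)) has_field_derivative ?Sh * ?k) (at z)"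
    by (rule has_field_derivative_cosh[OF da])
  have dS: "((\<lambda>z. sinh (arg z)) has_field_derivative ?C * ?k) (at z)"
    by (rule has_field_derivative_sinh[OF da])
  have dv: "((\<lambda>z. v (tanh (arg z))) has_field_derivative v' ?t * (?k / ?C^2)) (at z)"
    by (rule DERIV_chain2[OF V(1) dt])
  have dv': "((\<lambda>z. v' (tanh (arg z))) has_field_derivative (Q ?t * v ?t) * (?k / ?C^2)) (at z)"
    by (rule DERIV_chain2[OF V(2) dt])
  have "(lift v has_field_derivative (?Sh * ?k) * v ?t + (v' ?t * (?k / ?C^2)) * ?C) (at z)"
    unfolding lift_def by (rule DERIV_mult[OF dC dv])
  also have "(?Sh * ?k) * v ?t + (v' ?t * (?k / ?C^2)) * ?C = lift' v v' z"
    using nz by (simp add: lift'_def field_simps power2_eq_square)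
  finally show "(lift v has_field_derivative lift' v v' z) (at z)" .
  have di: "((\<lambda>z. inverse (cosh (arg z))) has_field_derivative - (inverse ?C * (?Sh * ?k) * inverse ?C)) (at z)"
    by (rule DERIV_inverse'[OF dC nz])
  have "(lift' v v' has_field_derivative 
      ?k * (((?C * ?k) * v ?t + (v' ?t * (?k / ?C^2)) * ?Sh) + 
       (- (inverse ?C * (?Sh * ?k) * inverse ?C) * v' ?t + ((Q ?t * v ?t) * (?k / ?C^2)) * inverse ?C))) (at z)"
    unfolding lift'_def by (intro DERIV_cmult DERIV_add DERIV_mult dS dv di dv')
  also have "?k * (((?C * ?k) * v ?t + (v' ?t * (?k / ?C^2)) * ?Sh) + 
       (- (inverse ?C * (?Sh * ?k) * inverse ?C) * v' ?t + ((Q ?t * v ?t) * (?k / ?C^2)) * inverse ?C))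
     = ?k^2 * ?C * v ?t + ?k^2 * Q ?t * v ?t * inverse ?C^3"
    by (simp add: divide_inverse power2_eq_square power3_eq_cube algebra_simps)
  also have "\<dots> = q z * lift v z"
  proof -
    have "?k^2 * Q ?t * inverse ?C^3 = (q z - ?k^2) * ?C"
      unfolding Q_tanh[OF z] using nz k by (simp add: field_simps power_numeral_reduce)
    then have "?k^2 * Q ?t * v ?t * inverse ?C^3 = (q z - ?k^2) * ?C * v ?t"
      by (simp add: mult_ac)
    then show ?thesis by (simp add: lift_def algebra_simps)
  qed
  finally show "(lift' v v' has_field_derivative q z * lift v z) (at z)" .
qed

lemma lift_wronskian:
  assumes "z \<in> S"
  shows "lift' v v' z * lift u z - lift v z * lift' u u' z
       = of_real k * (v' (tanh (arg z)) * u (tanh (arg z)) - v (tanh (arg z)) * u' (tanh (arg z)))"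
proof -
  have nz: "cosh (arg z) \<noteq> 0" using cosh_nonzero_strip arg_S[OF assms] by simp
  then show ?thesis by (simp add: lift_def lift'_def field_simps)
qed

end

lemma open_horizontal_strip: "open (horizontal_strip a b)"
  unfolding horizontal_strip_def
  by (intro open_Collect_conj open_Collect_less continuous_intros)

lemma convex_horizontal_strip: "convex (horizontal_strip a b)"
proof -
  have "horizontal_strip a b = {z. Im z > a} \<inter> {z. Im z < b}" by (auto simp: horizontal_strip_def)
  then show ?thesis by (simp add: convex_Int convex_halfspace_Im_gt convex_halfspace_Im_lt)
qed

text \<open>Global solutions exist whatever the height of the strip and the size of
  \<open>q\<close>, since the whole strip is conformally a disc; they serve to continue solutions
  found on a substrip.\<close>

theorem hill_solution_basis_strip:
  assumes "a < b" "q holomorphic_on horizontal_strip a b"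
  obtains f f' g g' where "hill_solution (horizontal_strip a b) q f f'" "hill_solution (horizontal_strip a b) q g g'"
    "\<And>z. z \<in> horizontal_strip a b \<Longrightarrow> g' z * f z - g z * f' z = 1"
proof -
  \<comment> \<open>Scales the height b - a to pi/2, the height of the band that \<open>tanh\<close>
    maps to the disc.\<close>
  define k where "k = pi / (2 * (b - a))"
  define c where "c = (a + b) / 2"
  have k: "k > 0" using assms by (simp add: k_def)
  have "\<bar>k * (Im z - c)\<bar> < pi/4 \<longleftrightarrow> z \<in> horizontal_strip a b" for z
  proof -
    have "\<bar>k * (Im z - c)\<bar> = k * \<bar>Im z - c\<bar>" using k by (simp add: abs_mult)
    moreover have "pi/4 = k * ((b - a) / 2)"
    proof -
      have "pi/4 = pi / (2 * d) * (d / 2)" if "d > 0" for d using that by simp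
      from this[of "b - a"] show ?thesis using assms by (simp add: k_def)
    qed
    ultimately have "\<bar>k * (Im z - c)\<bar> < pi/4 \<longleftrightarrow> \<bar>Im z - c\<bar> < (b - a) / 2"
      using k by (simp only: mult_less_cancel_left_pos)
    then show ?thesis by (auto simp: horizontal_strip_def c_def abs_less_iff field_simps)
  qed
  then have S: "horizontal_strip a b = {z. \<bar>k * (Im z - c)\<bar> < pi/4}" by auto
  interpret strip_transfer c k q "horizontal_strip a b"
    by unfold_locales (use k S assms in auto)
  obtain u u' where u: "hill_solution (ball 0 1) Q u u'" "u 0 = 1" "u' 0 = 0"
    using hill_solution_exists_disc[OF Q_holomorphic] by metis
  \<comment> \<open>The slope 1 / k compensates for the factor in
    \<open>lift_wronskian\<close>.\<close>
  obtain v v' where v: "hill_solution (ball 0 1) Q v v'" "v 0 = 0" "v' 0 = 1 / of_real k"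
    using hill_solution_exists_disc[OF Q_holomorphic] by metis
  obtain w where w: "\<And>z. z \<in> ball 0 1 \<Longrightarrow> v' z * u z - v z * u' z = w"
    using wronskian_const[OF convex_ball u(1) v(1)] by blast
  have "w = 1 / of_real k" using w[of 0] u v by simp
  then show ?thesis
    using that[OF lift_solution[OF u(1)] lift_solution[OF v(1)]] lift_wronskian w tanh_in_ball[OF arg_S] k by simp
qed

definition closed_strip :: "real \<Rightarrow> real \<Rightarrow> complex set" where
  "closed_strip a b = {z. a \<le> Im z \<and> Im z \<le> b}"

text \<open>For k = 1/2 the constant k^2 is the 1/4 of the operator, and 1 - |x|^2 = cos (Im z - c)
  / |cosh (arg z)|^2 turns the hypothesis into Nehari's bound. The ends of the strip become x = -1
  and x = 1, so \<open>\<alpha>\<close> and \<open>\<beta>\<close> are boundary values there;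
  injectivity on the closed disc makes them distinct and omitted.\<close>

theorem strip_extension:
  fixes c :: real
  defines "S \<equiv> horizontal_strip (c - pi/2) (c + pi/2)" and "C \<equiv> closed_strip (c - pi/2) (c + pi/2)"
  assumes q: "q holomorphic_on S"
    and bound: "\<And>z. z \<in> S \<Longrightarrow> norm (q z - 1/4) < 1 / (2 * cos (Im z - c))^2"
  obtains f f' g g' \<Gamma> \<alpha> \<beta> where "hill_solution S q f f'" "hill_solution S q g g'"
    "\<And>z. z \<in> S \<Longrightarrow> g' z * f z - g z * f' z = 1"
    "\<And>z. z \<in> S \<Longrightarrow> f z \<noteq> 0" "\<And>z. z \<in> S \<Longrightarrow> \<Gamma> z = g z / f z"
    "continuous_on C \<Gamma>" "inj_on \<Gamma> C" 
    "(\<Gamma> \<longlongrightarrow> \<alpha>) (Re going_to at_bot within C)" "(\<Gamma> \<longlongrightarrow> \<beta>) (Re going_to at_top within C)"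
    "\<alpha> \<noteq> \<beta>" "\<alpha> \<notin> \<Gamma> ` C" "\<beta> \<notin> \<Gamma> ` C"
proof -
  have half: "\<bar>1/2 * t\<bar> < pi/4 \<longleftrightarrow> - (pi/2) < t \<and> t < pi/2"
    "\<bar>1/2 * t\<bar> \<le> pi/4 \<longleftrightarrow> - (pi/2) \<le> t \<and> t \<le> pi/2" for t :: real
    by (auto simp: abs_if)
  have S: "S = {z. \<bar>1/2 * (Im z - c)\<bar> < pi/4}" unfolding S_def horizontal_strip_def half(1) by auto
  have C: "C = {z. \<bar>1/2 * (Im z - c)\<bar> \<le> pi/4}" unfolding C_def closed_strip_def half(2) by auto
  interpret strip_transfer c "1/2" q S by unfold_locales (use q S in auto)
  have Qb: "norm (Q x) < 1 / (1 - (norm x)^2)^2" if x: "x \<in> ball 0 1" for x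
  proof -
    define z where "z = disc_to_strip x / of_real (1/2) + \<i> * of_real c"
    have z: "z \<in> S" using disc_to_strip_Im[OF x] by (simp add: S z_def)
    have a: "arg z = disc_to_strip x" by (simp add: arg_def z_def)
    have x': "x = tanh (arg z)" using tanh_disc_to_strip[OF x] a by simp
    have nz: "cosh (arg z) \<noteq> 0" using cosh_nonzero_strip arg_S[OF z] by simp
    have cz: "2 * Im (arg z) = Im z - c" by simp
    have cpos: "cos (Im z - c) > 0" using cos_double_pos[OF arg_S[OF z]] unfolding cz .
    have "norm (Q x) = 4 * norm (q z - 1/4) * norm (cosh (arg z))^4"
      unfolding x' Q_tanh[OF z] by (simp add: norm_mult norm_divide norm_power power2_eq_square)
    also have "\<dots> < 4 * (1 / (2 * cos (Im z - c))^2) * norm (cosh (arg z))^4"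
      using bound[OF z] nz by (intro mult_strict_right_mono) auto
    also have "\<dots> = 1 / (1 - (norm x)^2)^2"
      unfolding x' tanh_one_minus_norm_sq[OF nz] cz using nz cpos
      by (simp add: power_divide power_mult_distrib flip: power_mult)
    finally show ?thesis .
  qed
  obtain u u' v v' G where u: "hill_solution (ball 0 1) Q u u'" and v: "hill_solution (ball 0 1) Q v v'"
    and wr: "\<And>z. z \<in> ball 0 1 \<Longrightarrow> v' z * u z - v z * u' z = 1"
    and unz: "\<And>z. z \<in> ball 0 1 \<Longrightarrow> u z \<noteq> 0"
    and Gc: "continuous_on (cball 0 1) G" and G: "\<And>z. z \<in> ball 0 1 \<Longrightarrow> G z = v z / u z" and Gi: "inj_on G (cball 0 1)"
    using disc_extension[OF Q_holomorphic Qb] by blast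
  define T where "T z = tanh (arg z)" for z
  have argC: "\<bar>Im (arg z)\<bar> \<le> pi/4" if "z \<in> C" for z
    using that unfolding C by simp
  have Tc: "T z \<in> cball 0 1" if "z \<in> C" for z
    unfolding T_def by (intro tanh_in_cball argC that)
  have Tb: "T z \<in> ball 0 1" if "z \<in> S" for z
    unfolding T_def using that by (intro tanh_in_ball arg_S)
  have Tn: "T z \<noteq> 1" "T z \<noteq> -1" if "z \<in> C" for z
    unfolding T_def by (intro tanh_neq_one argC that)+
  have Ti: "inj_on T C"
  proof (rule inj_onI)
    fix x y assume xy: "x \<in> C" "y \<in> C" "T x = T y"
    have "arg x = arg y"
      by (rule inj_onD[OF tanh_inj_strip xy(3)[unfolded T_def]]) (use argC xy in blast)+
    then show "x = y" by (simp add: arg_def)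
  qed
  have Tcont: "continuous_on C T"
    unfolding T_def tanh_def arg_def
    by (intro continuous_intros) (use cosh_nonzero_strip argC in \<open>auto simp: arg_def\<close>)
  have ev: "eventually (\<lambda>z. z \<in> C) (Re going_to F within C)" for F
    unfolding going_to_within_def eventually_inf_principal by simp
  have Tlim: "(T \<longlongrightarrow> -1) (Re going_to at_bot within C)" "(T \<longlongrightarrow> 1) (Re going_to at_top within C)"
  proof -
    have T1: "T z = 1 - 2 / (exp (2 * arg z) + 1)" if "z \<in> C" for z
    proof -
      have "(1 + T z) / (1 - T z) = exp (2 * arg z)"
        unfolding T_def by (rule exp_tanh[OF argC[OF that]])
      then have "exp (2 * arg z) + 1 = (1 + T z) / (1 - T z) + (1 - T z) / (1 - T z)"
        using Tn(1)[OF that] by simp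
      also have "\<dots> = 2 / (1 - T z)" unfolding add_divide_distrib[symmetric] by simp
      finally show ?thesis using Tn(1)[OF that] by (simp add: diff_divide_distrib)
    qed
    \<comment> \<open>The same quotient in terms of a function that tends to 0 at the right
      end.\<close>
    have T2: "T z = 1 - 2 * exp (- (2 * arg z)) / (1 + exp (- (2 * arg z)))" if "z \<in> C" for z
    proof -
      have "exp (- (2 * arg z)) * (exp (2 * arg z) + 1) = 1 + exp (- (2 * arg z))"
        by (simp add: distrib_left flip: exp_add)
      then have "2 / (exp (2 * arg z) + 1) = 2 * exp (- (2 * arg z)) / (1 + exp (- (2 * arg z)))"
        by (metis exp_not_eq_zero mult.commute mult_divide_mult_cancel_left)
      then show ?thesis using T1[OF that] by simp
    qed
    have "((\<lambda>z. norm (exp (2 * arg z))) \<longlongrightarrow> 0) (Re going_to at_bot within C)"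
      by (simp add: arg_def) (rule filterlim_compose[OF exp_at_bot filterlim_going_toI_weak])
    then have "((\<lambda>z. exp (2 * arg z)) \<longlongrightarrow> 0) (Re going_to at_bot within C)"
      by (rule tendsto_norm_zero_cancel)
    then have "((\<lambda>z. 1 - 2 / (exp (2 * arg z) + 1)) \<longlongrightarrow> 1 - 2 / (0 + 1)) (Re going_to at_bot within C)"
      by (intro tendsto_intros) auto
    moreover have "eventually (\<lambda>z. 1 - 2 / (exp (2 * arg z) + 1) = T z) (Re going_to at_bot within C)"
      by (rule eventually_mono[OF ev]) (use T1 in auto)
    ultimately show "(T \<longlongrightarrow> -1) (Re going_to at_bot within C)"
      by (auto dest: Lim_transform_eventually)
    have "((\<lambda>z. norm (exp (- (2 * arg z)))) \<longlongrightarrow> 0) (Re going_to at_top within C)"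
      by (simp add: arg_def)
         (rule filterlim_compose[OF exp_at_bot filterlim_compose[OF filterlim_uminus_at_bot_at_top filterlim_going_toI_weak]])
    then have "((\<lambda>z. exp (- (2 * arg z))) \<longlongrightarrow> 0) (Re going_to at_top within C)"
      by (rule tendsto_norm_zero_cancel)
    then have "((\<lambda>z. 1 - 2 * exp (- (2 * arg z)) / (1 + exp (- (2 * arg z)))) \<longlongrightarrow> 1 - 2 * 0 / (1 + 0)) (Re going_to at_top within C)"
      by (intro tendsto_intros) auto
    moreover have "eventually (\<lambda>z. 1 - 2 * exp (- (2 * arg z)) / (1 + exp (- (2 * arg z))) = T z) (Re going_to at_top within C)"
      by (rule eventually_mono[OF ev]) (use T2 in auto)
    ultimately show "(T \<longlongrightarrow> 1) (Re going_to at_top within C)"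
      by (auto dest: Lim_transform_eventually)
  qed
  \<comment> \<open>The factor 2 normalizes the Wronskian, which \<open>lift_wronskian\<close> gives
    as 1/2; the zero summand brings \<open>?g\<close> into the form of
    \<open>hill_solution_lincomb\<close>.\<close>
  let ?f = "lift u" and ?g = "\<lambda>z. 2 * lift v z + 0 * lift u z"
  let ?f' = "lift' u u'" and ?g' = "\<lambda>z. 2 * lift' v v' z + 0 * lift' u u' z"
  show ?thesis
  proof (rule that[of ?f ?f' ?g ?g' "\<lambda>z. 2 * G (T z)" "2 * G (-1)" "2 * G 1"])
    show "hill_solution S q ?f ?f'" by (rule lift_solution[OF u])
    show "hill_solution S q ?g ?g'" by (rule hill_solution_lincomb[OF lift_solution[OF v] lift_solution[OF u]])
    show "?g' z * ?f z - ?g z * ?f' z = 1" if "z \<in> S" for z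
      using lift_wronskian[OF that, of v v' u u'] wr[OF Tb[OF that]] by (simp add: T_def algebra_simps)
    show "?f z \<noteq> 0" if "z \<in> S" for z
      using unz[OF Tb[OF that]] cosh_nonzero_strip[of "arg z"] arg_S[OF that] by (simp add: lift_def T_def)
    show "2 * G (T z) = ?g z / ?f z" if "z \<in> S" for z
      using G[OF Tb[OF that]] cosh_nonzero_strip[of "arg z"] arg_S[OF that] by (simp add: lift_def T_def)
    show "continuous_on C (\<lambda>z. 2 * G (T z))"
      using Tc by (intro continuous_intros continuous_on_compose2[OF Gc Tcont]) auto
    show "inj_on (\<lambda>z. 2 * G (T z)) C"
    proof (rule inj_onI)
      fix x y assume xy: "x \<in> C" "y \<in> C" "2 * G (T x) = 2 * G (T y)"
      then have "T x = T y" by (intro inj_onD[OF Gi _ Tc Tc]) auto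
      then show "x = y" using inj_onD[OF Ti] xy by blast
    qed
    show "((\<lambda>z. 2 * G (T z)) \<longlongrightarrow> 2 * G (-1)) (Re going_to at_bot within C)"
      by (intro tendsto_intros continuous_on_tendsto_compose[OF Gc Tlim(1)])
         (use Tc in \<open>auto intro: eventually_mono[OF ev]\<close>)
    show "((\<lambda>z. 2 * G (T z)) \<longlongrightarrow> 2 * G 1) (Re going_to at_top within C)"
      by (intro tendsto_intros continuous_on_tendsto_compose[OF Gc Tlim(2)])
         (use Tc in \<open>auto intro: eventually_mono[OF ev]\<close>)
    show "2 * G (-1) \<noteq> 2 * G 1" using inj_onD[OF Gi, of "-1" 1] by auto
    have "G x \<noteq> G (T z)" if "z \<in> C" "x = 1 \<or> x = -1" for x z
      using inj_onD[OF Gi _ _ Tc[OF that(1)], of x] Tn[OF that(1)] that(2) by auto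
    then show "2 * G (-1) \<notin> (\<lambda>z. 2 * G (T z)) ` C" "2 * G 1 \<notin> (\<lambda>z. 2 * G (T z)) ` C"
      by auto
  qed
qed

section \<open>Solutions that are principal at both ends\<close>

lemma horizontal_strip_subset_closed: "horizontal_strip a b \<subseteq> closed_strip a b"
  by (auto simp: horizontal_strip_def closed_strip_def)

lemma convex_closed_strip: "convex (closed_strip a b)"
proof -
  have "closed_strip a b = {z. Im z \<ge> a} \<inter> {z. Im z \<le> b}" by (auto simp: closed_strip_def)
  then show ?thesis by (simp add: convex_Int convex_halfspace_Im_ge convex_halfspace_Im_le)
qed

lemma eventually_going_to_within_mem: "eventually (\<lambda>z. z \<in> A) (f going_to F within A)"
  by (simp add: going_to_within_def eventually_inf_principal)

lemma filterlim_line: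
  assumes "\<And>t. Complex t h \<in> A"
  shows "filterlim (\<lambda>t. Complex t h) (Re going_to F within A) F"
proof -
  have "filterlim (\<lambda>t. Re (Complex t h)) F F" by (simp add: filterlim_ident)
  then show ?thesis
    using assms unfolding going_to_within_def
    by (auto simp: filterlim_inf filterlim_principal filterlim_filtercomap_iff o_def)
qed

text \<open>The model is q = 1/4 with exp (z/2), exp (-z/2) and \<open>\<Phi> = exp\<close>. The
  pole at +\<infinity> is recorded through the reciprocal. On the two edges of the substrip the
  values are carried by \<open>\<Phi>\<close> alone.\<close>

definition ratio_extends :: "real \<Rightarrow> (complex \<Rightarrow> complex) \<Rightarrow> (complex \<Rightarrow> complex) \<Rightarrow> (complex \<Rightarrow> complex) \<Rightarrow> bool" where
  "ratio_extends c f1 f2 \<Phi> \<longleftrightarrow>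
     continuous_on (closed_strip (c - pi/2) (c + pi/2)) \<Phi> \<and>
     inj_on \<Phi> (closed_strip (c - pi/2) (c + pi/2)) \<and>
     (\<forall>z\<in>closed_strip (c - pi/2) (c + pi/2). \<Phi> z \<noteq> 0) \<and>
     (\<Phi> \<longlongrightarrow> 0) (Re going_to at_bot within closed_strip (c - pi/2) (c + pi/2)) \<and>
     ((\<lambda>z. 1 / \<Phi> z) \<longlongrightarrow> 0) (Re going_to at_top within closed_strip (c - pi/2) (c + pi/2)) \<and>
     (\<forall>z\<in>horizontal_strip (c - pi/2) (c + pi/2). f1 z \<noteq> 0 \<and> f2 z \<noteq> 0 \<and> \<Phi> z = f1 z / f2 z)"

text \<open>The Moebius map t |-> l (t - \<alpha>) / (t - \<beta>) sends the two end values to 0 and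
  \<infinity>; as \<open>\<Gamma>\<close> omits both, the composite has neither zeros nor poles on
  the closed strip.\<close>

lemma ratio_extends_moebius:
  fixes c :: real
  defines "S \<equiv> horizontal_strip (c - pi/2) (c + pi/2)" and "C \<equiv> closed_strip (c - pi/2) (c + pi/2)"
  assumes \<Gamma>: "continuous_on C \<Gamma>" "inj_on \<Gamma> C" 
    "(\<Gamma> \<longlongrightarrow> \<alpha>) (Re going_to at_bot within C)" "(\<Gamma> \<longlongrightarrow> \<beta>) (Re going_to at_top within C)"
    "\<alpha> \<noteq> \<beta>" "\<alpha> \<notin> \<Gamma> ` C" "\<beta> \<notin> \<Gamma> ` C"
    and l: "l \<noteq> 0"
    and f12: "\<And>z. z \<in> S \<Longrightarrow> f1 z \<noteq> 0 \<and> f2 z \<noteq> 0 \<and> f1 z / f2 z = l * (\<Gamma> z - \<alpha>) / (\<Gamma> z - \<beta>)"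
  shows "ratio_extends c f1 f2 (\<lambda>z. l * (\<Gamma> z - \<alpha>) / (\<Gamma> z - \<beta>))"
  unfolding ratio_extends_def S_def[symmetric] C_def[symmetric]
proof (intro conjI ballI)
  have nz: "\<Gamma> z - \<alpha> \<noteq> 0" "\<Gamma> z - \<beta> \<noteq> 0" if "z \<in> C" for z using \<Gamma>(6,7) that by auto
  show "continuous_on C (\<lambda>z. l * (\<Gamma> z - \<alpha>) / (\<Gamma> z - \<beta>))"
    using nz by (intro continuous_intros \<Gamma>(1)) auto
  show "inj_on (\<lambda>z. l * (\<Gamma> z - \<alpha>) / (\<Gamma> z - \<beta>)) C"
  proof (rule inj_onI)
    fix x y assume xy: "x \<in> C" "y \<in> C" "l * (\<Gamma> x - \<alpha>) / (\<Gamma> x - \<beta>) = l * (\<Gamma> y - \<alpha>) / (\<Gamma> y - \<beta>)"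
    then have "(l * (\<Gamma> x - \<alpha>)) * (\<Gamma> y - \<beta>) = (l * (\<Gamma> y - \<alpha>)) * (\<Gamma> x - \<beta>)"
      using nz by (simp add: frac_eq_eq)
    then have "l * ((\<Gamma> x - \<Gamma> y) * (\<alpha> - \<beta>)) = 0" by (simp add: algebra_simps)
    then have "\<Gamma> x = \<Gamma> y" using l \<Gamma>(5) by simp
    then show "x = y" using inj_onD[OF \<Gamma>(2)] xy by blast
  qed
  show "l * (\<Gamma> z - \<alpha>) / (\<Gamma> z - \<beta>) \<noteq> 0" if "z \<in> C" for z using nz[OF that] l by simp
  have "((\<lambda>z. l * (\<Gamma> z - \<alpha>) / (\<Gamma> z - \<beta>)) \<longlongrightarrow> l * (\<alpha> - \<alpha>) / (\<alpha> - \<beta>)) (Re going_to at_bot within C)"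
    using \<Gamma>(5) by (intro tendsto_intros \<Gamma>(3)) auto
  then show "((\<lambda>z. l * (\<Gamma> z - \<alpha>) / (\<Gamma> z - \<beta>)) \<longlongrightarrow> 0) (Re going_to at_bot within C)" by simp
  have "((\<lambda>z. (\<Gamma> z - \<beta>) / (l * (\<Gamma> z - \<alpha>))) \<longlongrightarrow> (\<beta> - \<beta>) / (l * (\<beta> - \<alpha>))) (Re going_to at_top within C)"
    using \<Gamma>(5) l by (intro tendsto_intros \<Gamma>(4)) auto
  then show "((\<lambda>z. 1 / (l * (\<Gamma> z - \<alpha>) / (\<Gamma> z - \<beta>))) \<longlongrightarrow> 0) (Re going_to at_top within C)" by simp
qed (use f12 in auto)

text \<open>The bound is imposed on every inscribed strip of height pi, the form in which
  \<open>strip_extension\<close> needs it, and not through the distance to the edge.\<close>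

locale hill_strip =
  fixes a b :: real and q :: "complex \<Rightarrow> complex"
  assumes height: "b - a \<ge> pi"
    and q_holomorphic: "q holomorphic_on horizontal_strip a b"
    and q_bound: "\<And>c z. a + pi/2 \<le> c \<Longrightarrow> c \<le> b - pi/2 \<Longrightarrow> z \<in> horizontal_strip (c - pi/2) (c + pi/2)
                    \<Longrightarrow> norm (q z - 1/4) < 1 / (2 * cos (Im z - c))^2"
begin

abbreviation "B \<equiv> horizontal_strip a b"
abbreviation "K \<equiv> {a + pi/2..b - pi/2}"
abbreviation "S c \<equiv> horizontal_strip (c - pi/2) (c + pi/2)"
abbreviation "C c \<equiv> closed_strip (c - pi/2) (c + pi/2)"

lemma S_subset: "c \<in> K \<Longrightarrow> S c \<subseteq> B"
  by (auto simp: horizontal_strip_def)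

lemma extension:
  assumes "c \<in> K"
  obtains f f' g g' \<Gamma> \<alpha> \<beta> where "hill_solution (S c) q f f'" "hill_solution (S c) q g g'"
    "\<And>z. z \<in> S c \<Longrightarrow> g' z * f z - g z * f' z = 1"
    "\<And>z. z \<in> S c \<Longrightarrow> f z \<noteq> 0" "\<And>z. z \<in> S c \<Longrightarrow> \<Gamma> z = g z / f z"
    "continuous_on (C c) \<Gamma>" "inj_on \<Gamma> (C c)" 
    "(\<Gamma> \<longlongrightarrow> \<alpha>) (Re going_to at_bot within C c)" "(\<Gamma> \<longlongrightarrow> \<beta>) (Re going_to at_top within C c)"
    "\<alpha> \<noteq> \<beta>" "\<alpha> \<notin> \<Gamma> ` C c" "\<beta> \<notin> \<Gamma> ` C c"
  using strip_extension[OF holomorphic_on_subset[OF q_holomorphic S_subset[OF assms]], of thesis]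
    q_bound assms by auto

text \<open>Along the line, \<open>\<Gamma>\<close> tends to \<open>\<alpha>\<close> and
  \<open>\<beta>\<close>. Since f1 / f = a1 + b1 \<Gamma>, the decay of f1 / f2 there forces a1 + b1
  \<alpha> = 0, and likewise a2 + b2 \<beta> = 0. So the ratio is a Moebius image of
  \<open>\<Gamma>\<close>, and its limits on one line determine its behaviour on the closed
  strip.\<close>

lemma extends_from_line:
  assumes c: "c \<in> K" and f1: "hill_solution B q f1 f1'" and f2: "hill_solution B q f2 f2'"
    and k: "\<And>z. z \<in> B \<Longrightarrow> f1' z * f2 z - f1 z * f2' z = k" "k \<noteq> 0"
    and h: "\<bar>h - c\<bar> < pi/2"
    and nz: "\<And>t. f1 (Complex t h) \<noteq> 0" "\<And>t. f2 (Complex t h) \<noteq> 0"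
    and lim1: "((\<lambda>t. f1 (Complex t h) / f2 (Complex t h)) \<longlongrightarrow> 0) at_bot"
    and lim2: "((\<lambda>t. f2 (Complex t h) / f1 (Complex t h)) \<longlongrightarrow> 0) at_top"
  shows "\<exists>\<Phi>. ratio_extends c f1 f2 \<Phi>"
proof -
  obtain f f' g g' \<Gamma> \<alpha> \<beta> where f: "hill_solution (S c) q f f'" and g: "hill_solution (S c) q g g'"
    and wr: "\<And>z. z \<in> S c \<Longrightarrow> g' z * f z - g z * f' z = 1"
    and fnz: "\<And>z. z \<in> S c \<Longrightarrow> f z \<noteq> 0" and \<Gamma>: "\<And>z. z \<in> S c \<Longrightarrow> \<Gamma> z = g z / f z"
    and \<Gamma>': "continuous_on (C c) \<Gamma>" "inj_on \<Gamma> (C c)" 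
    "(\<Gamma> \<longlongrightarrow> \<alpha>) (Re going_to at_bot within C c)" "(\<Gamma> \<longlongrightarrow> \<beta>) (Re going_to at_top within C c)"
    "\<alpha> \<noteq> \<beta>" "\<alpha> \<notin> \<Gamma> ` C c" "\<beta> \<notin> \<Gamma> ` C c"
    using extension[OF c] by blast
  obtain a1 b1 where f1e: "\<And>z. z \<in> S c \<Longrightarrow> f1 z = a1 * f z + b1 * g z \<and> f1' z = a1 * f' z + b1 * g' z"
    using hill_solution_combination[OF convex_horizontal_strip f g hill_solution_subset[OF f1 S_subset[OF c]] wr] by blast
  obtain a2 b2 where f2e: "\<And>z. z \<in> S c \<Longrightarrow> f2 z = a2 * f z + b2 * g z \<and> f2' z = a2 * f' z + b2 * g' z"
    using hill_solution_combination[OF convex_horizontal_strip f g hill_solution_subset[OF f2 S_subset[OF c]] wr] by blast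
  have line: "Complex t h \<in> S c" for t
    using h unfolding abs_less_iff by (auto simp: horizontal_strip_def)
  then have lineC: "Complex t h \<in> C c" for t using horizontal_strip_subset_closed by blast
  \<comment> \<open>The Wronskian of \<open>f1\<close> and \<open>f2\<close> is this determinant;
    once \<open>a1\<close> and \<open>a2\<close> are known, it shows \<open>b1\<close> and
    \<open>b2\<close> to be nonzero.\<close>
  have det: "b1 * a2 - a1 * b2 \<noteq> 0"
  proof
    assume 0: "b1 * a2 - a1 * b2 = 0"
    define z where "z = Complex 0 h"
    have z: "z \<in> S c" using line by (simp add: z_def)
    then have "k = f1' z * f2 z - f1 z * f2' z" using k(1) S_subset[OF c] by auto
    also have "\<dots> = (b1 * a2 - a1 * b2) * (g' z * f z - g z * f' z)"
      using f1e[OF z] f2e[OF z] by (simp add: algebra_simps)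
    finally show False using 0 k(2) by simp
  qed
  have e1: "f1 z / f z = a1 + b1 * \<Gamma> z" and e2: "f2 z / f z = a2 + b2 * \<Gamma> z" if "z \<in> S c" for z
    using fnz[OF that] f1e[OF that] f2e[OF that] \<Gamma>[OF that] by (simp_all add: add_divide_distrib)
  have G1: "((\<lambda>t. \<Gamma> (Complex t h)) \<longlongrightarrow> \<alpha>) at_bot" and G2: "((\<lambda>t. \<Gamma> (Complex t h)) \<longlongrightarrow> \<beta>) at_top"
    using filterlim_compose[OF \<Gamma>'(3) filterlim_line[OF lineC]] filterlim_compose[OF \<Gamma>'(4) filterlim_line[OF lineC]] by auto
  have "a1 + b1 * \<alpha> = 0"
  proof -
    have "((\<lambda>t. f1 (Complex t h) / f2 (Complex t h) * (a2 + b2 * \<Gamma> (Complex t h))) \<longlongrightarrow> 0 * (a2 + b2 * \<alpha>)) at_bot"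
      by (intro tendsto_intros lim1 G1)
    moreover have "f1 (Complex t h) / f2 (Complex t h) * (a2 + b2 * \<Gamma> (Complex t h)) = a1 + b1 * \<Gamma> (Complex t h)" for t
      unfolding e1[OF line, symmetric] e2[OF line, symmetric] using nz by simp
    ultimately have "((\<lambda>t. a1 + b1 * \<Gamma> (Complex t h)) \<longlongrightarrow> 0) at_bot" by simp
    moreover have "((\<lambda>t. a1 + b1 * \<Gamma> (Complex t h)) \<longlongrightarrow> a1 + b1 * \<alpha>) at_bot" by (intro tendsto_intros G1)
    ultimately show ?thesis using tendsto_unique[OF trivial_limit_at_bot_linorder] by blast
  qed
  then have a1: "a1 = - b1 * \<alpha>" by (simp add: add_eq_0_iff2)
  have "a2 + b2 * \<beta> = 0"
  proof -
    have "((\<lambda>t. f2 (Complex t h) / f1 (Complex t h) * (a1 + b1 * \<Gamma> (Complex t h))) \<longlongrightarrow> 0 * (a1 + b1 * \<beta>)) at_top"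
      by (intro tendsto_intros lim2 G2)
    moreover have "f2 (Complex t h) / f1 (Complex t h) * (a1 + b1 * \<Gamma> (Complex t h)) = a2 + b2 * \<Gamma> (Complex t h)" for t
      unfolding e1[OF line, symmetric] e2[OF line, symmetric] using nz by simp
    ultimately have "((\<lambda>t. a2 + b2 * \<Gamma> (Complex t h)) \<longlongrightarrow> 0) at_top" by simp
    moreover have "((\<lambda>t. a2 + b2 * \<Gamma> (Complex t h)) \<longlongrightarrow> a2 + b2 * \<beta>) at_top" by (intro tendsto_intros G2)
    ultimately show ?thesis using tendsto_unique[OF trivial_limit_at_top_linorder] by blast
  qed
  then have a2: "a2 = - b2 * \<beta>" by (simp add: add_eq_0_iff2)
  have b: "b1 \<noteq> 0" "b2 \<noteq> 0" using det a1 a2 by auto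
  have "ratio_extends c f1 f2 (\<lambda>z. b1 / b2 * (\<Gamma> z - \<alpha>) / (\<Gamma> z - \<beta>))"
  proof (rule ratio_extends_moebius[OF \<Gamma>'])
    show "b1 / b2 \<noteq> 0" using b by simp
    fix z assume z: "z \<in> S c"
    then have zC: "z \<in> C c" using horizontal_strip_subset_closed by blast
    have n: "\<Gamma> z - \<alpha> \<noteq> 0" "\<Gamma> z - \<beta> \<noteq> 0" using \<Gamma>'(6,7) zC by auto
    have "f1 z / f z = b1 * (\<Gamma> z - \<alpha>)" "f2 z / f z = b2 * (\<Gamma> z - \<beta>)"
      unfolding e1[OF z] e2[OF z] a1 a2 by (simp_all add: algebra_simps)
    then have "f1 z = b1 * (\<Gamma> z - \<alpha>) * f z" "f2 z = b2 * (\<Gamma> z - \<beta>) * f z"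
      using fnz[OF z] by (simp_all add: field_simps)
    then show "f1 z \<noteq> 0 \<and> f2 z \<noteq> 0 \<and> f1 z / f2 z = b1 / b2 * (\<Gamma> z - \<alpha>) / (\<Gamma> z - \<beta>)"
      using b n fnz[OF z] by simp
  qed
  then show ?thesis by blast
qed

text \<open>The pair is g - \<alpha> f and g - \<beta> f, with ratio (\<Gamma> - \<alpha>) /
  (\<Gamma> - \<beta>).\<close>

lemma exists_principal:
  assumes c: "c \<in> K"
  obtains f1 f1' f2 f2' k \<Phi> where "hill_solution B q f1 f1'" "hill_solution B q f2 f2'"
    "\<And>z. z \<in> B \<Longrightarrow> f1' z * f2 z - f1 z * f2' z = k" "k \<noteq> 0" "ratio_extends c f1 f2 \<Phi>"
proof -
  obtain f f' g g' \<Gamma> \<alpha> \<beta> where f: "hill_solution (S c) q f f'" and g: "hill_solution (S c) q g g'"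
    and wr: "\<And>z. z \<in> S c \<Longrightarrow> g' z * f z - g z * f' z = 1"
    and fnz: "\<And>z. z \<in> S c \<Longrightarrow> f z \<noteq> 0" and \<Gamma>: "\<And>z. z \<in> S c \<Longrightarrow> \<Gamma> z = g z / f z"
    and \<Gamma>': "continuous_on (C c) \<Gamma>" "inj_on \<Gamma> (C c)" 
    "(\<Gamma> \<longlongrightarrow> \<alpha>) (Re going_to at_bot within C c)" "(\<Gamma> \<longlongrightarrow> \<beta>) (Re going_to at_top within C c)"
    "\<alpha> \<noteq> \<beta>" "\<alpha> \<notin> \<Gamma> ` C c" "\<beta> \<notin> \<Gamma> ` C c"
    using extension[OF c] by blast
  have "a < b" using height pi_gt_zero by linarith
  then obtain p p' r r' where p: "hill_solution B q p p'" and r: "hill_solution B q r r'" 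
    and pr: "\<And>z. z \<in> B \<Longrightarrow> r' z * p z - r z * p' z = 1"
    using hill_solution_basis_strip[OF _ q_holomorphic] by blast
  note p' = hill_solution_subset[OF p S_subset[OF c]] and r' = hill_solution_subset[OF r S_subset[OF c]]
  have pr': "r' z * p z - r z * p' z = 1" if "z \<in> S c" for z using pr S_subset[OF c] that by blast
  \<comment> \<open>A solution on the substrip continues to \<open>B\<close>, because its
    coefficients in the global basis are constants.\<close>
  have ext: "\<exists>F F'. hill_solution B q F F' \<and> (\<forall>z\<in>S c. F z = g z - x * f z \<and> F' z = g' z - x * f' z)" for x
  proof -
    have "hill_solution (S c) q (\<lambda>z. 1 * g z + (-x) * f z) (\<lambda>z. 1 * g' z + (-x) * f' z)"
      by (rule hill_solution_lincomb[OF g f])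
    from hill_solution_combination[OF convex_horizontal_strip p' r' this pr']
    obtain s t where st: "\<And>z. z \<in> S c \<Longrightarrow> 1 * g z + (-x) * f z = s * p z + t * r z \<and> 1 * g' z + (-x) * f' z = s * p' z + t * r' z"
      by blast
    show ?thesis
      by (rule exI[of _ "\<lambda>z. s * p z + t * r z"], rule exI[of _ "\<lambda>z. s * p' z + t * r' z"])
         (use st hill_solution_lincomb[OF p r] in auto)
  qed
  obtain f1 f1' where f1: "hill_solution B q f1 f1'" "\<And>z. z \<in> S c \<Longrightarrow> f1 z = g z - \<alpha> * f z \<and> f1' z = g' z - \<alpha> * f' z"
    using ext[of \<alpha>] by blast
  obtain f2 f2' where f2: "hill_solution B q f2 f2'" "\<And>z. z \<in> S c \<Longrightarrow> f2 z = g z - \<beta> * f z \<and> f2' z = g' z - \<beta> * f' z"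
    using ext[of \<beta>] by blast
  obtain k where k: "\<And>z. z \<in> B \<Longrightarrow> f1' z * f2 z - f1 z * f2' z = k"
    using wronskian_const[OF convex_horizontal_strip f2(1) f1(1)] by blast
  have "k \<noteq> 0"
  proof -
    define z where "z = Complex 0 c"
    have z: "z \<in> S c" by (simp add: z_def horizontal_strip_def)
    have "k = f1' z * f2 z - f1 z * f2' z" using k z S_subset[OF c] by auto
    also have "\<dots> = (\<alpha> - \<beta>) * (g' z * f z - g z * f' z)"
      unfolding conjunct1[OF f1(2)[OF z]] conjunct1[OF f2(2)[OF z]] conjunct2[OF f1(2)[OF z]] conjunct2[OF f2(2)[OF z]]
      by (simp add: algebra_simps)
    finally show ?thesis using wr[OF z] \<Gamma>'(5) by simp
  qed
  have "ratio_extends c f1 f2 (\<lambda>z. 1 * (\<Gamma> z - \<alpha>) / (\<Gamma> z - \<beta>))"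
  proof (rule ratio_extends_moebius[OF \<Gamma>'])
    fix z assume z: "z \<in> S c"
    then have zC: "z \<in> C c" using horizontal_strip_subset_closed by blast
    have n: "\<Gamma> z - \<alpha> \<noteq> 0" "\<Gamma> z - \<beta> \<noteq> 0" using \<Gamma>'(6,7) zC by auto
    have "f1 z = (\<Gamma> z - \<alpha>) * f z" "f2 z = (\<Gamma> z - \<beta>) * f z"
      using fnz[OF z] f1(2)[OF z] f2(2)[OF z] \<Gamma>[OF z] by (simp_all add: field_simps)
    then show "f1 z \<noteq> 0 \<and> f2 z \<noteq> 0 \<and> f1 z / f2 z = 1 * (\<Gamma> z - \<alpha>) / (\<Gamma> z - \<beta>)"
      using n fnz[OF z] by simp
  qed simp
  then show ?thesis using that[OF f1(1) f2(1) k \<open>k \<noteq> 0\<close>] by blast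
qed

lemma ratio_extends_line:
  assumes re: "ratio_extends c f1 f2 \<Phi>" and h: "\<bar>h - c\<bar> < pi/2"
  shows "f1 (Complex t h) \<noteq> 0" "f2 (Complex t h) \<noteq> 0"
    "((\<lambda>t. f1 (Complex t h) / f2 (Complex t h)) \<longlongrightarrow> 0) at_bot"
    "((\<lambda>t. f2 (Complex t h) / f1 (Complex t h)) \<longlongrightarrow> 0) at_top"
proof -
  have line: "Complex t h \<in> S c" for t
    using h unfolding abs_less_iff by (auto simp: horizontal_strip_def)
  then have lineC: "Complex t h \<in> C c" for t using horizontal_strip_subset_closed by blast
  note re' = re[unfolded ratio_extends_def]
  show "f1 (Complex t h) \<noteq> 0" "f2 (Complex t h) \<noteq> 0" using re' line by auto
  have eq: "\<Phi> (Complex t h) = f1 (Complex t h) / f2 (Complex t h)" for t using re' line by auto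
  have "((\<lambda>t. \<Phi> (Complex t h)) \<longlongrightarrow> 0) at_bot" "((\<lambda>t. 1 / \<Phi> (Complex t h)) \<longlongrightarrow> 0) at_top"
    using filterlim_compose[OF _ filterlim_line[OF lineC]] re' by blast+
  then show "((\<lambda>t. f1 (Complex t h) / f2 (Complex t h)) \<longlongrightarrow> 0) at_bot"
    "((\<lambda>t. f2 (Complex t h) / f1 (Complex t h)) \<longlongrightarrow> 0) at_top"
    unfolding eq by simp_all
qed

text \<open>Strips with centres less than pi apart overlap, and the line midway between the centres
  lies in both; \<open>extends_from_line\<close> passes the property across it. Connectedness of
  \<open>K\<close> then spreads it from one centre to all, for a single pair of solutions.\<close>

lemma principal_solutions:
  obtains f1 f1' f2 f2' k where "hill_solution B q f1 f1'" "hill_solution B q f2 f2'"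
    "\<And>z. z \<in> B \<Longrightarrow> f1' z * f2 z - f1 z * f2' z = k" "k \<noteq> 0" 
    "\<And>c. c \<in> K \<Longrightarrow> \<exists>\<Phi>. ratio_extends c f1 f2 \<Phi>"
proof -
  have K: "a + pi/2 \<in> K" using height by simp
  obtain f1 f1' f2 f2' k where f: "hill_solution B q f1 f1'" "hill_solution B q f2 f2'"
    "\<And>z. z \<in> B \<Longrightarrow> f1' z * f2 z - f1 z * f2' z = k" "k \<noteq> 0" and re: "\<exists>\<Phi>. ratio_extends (a + pi/2) f1 f2 \<Phi>"
    using exists_principal[OF K] by metis
  have step: "\<exists>\<Phi>. ratio_extends c' f1 f2 \<Phi>" if c': "c' \<in> K" and d: "\<bar>c - c'\<bar> < pi" and ex: "\<exists>\<Phi>. ratio_extends c f1 f2 \<Phi>" for c c'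
  proof -
    obtain \<Phi> where re: "ratio_extends c f1 f2 \<Phi>" using ex by blast
    have h: "\<bar>(c + c')/2 - c\<bar> < pi/2" "\<bar>(c + c')/2 - c'\<bar> < pi/2" using d by (auto simp: abs_less_iff field_simps)
    show ?thesis
      by (rule extends_from_line[OF c' f h(2) ratio_extends_line[OF re h(1)]])
  qed
  have "\<exists>\<Phi>. ratio_extends c f1 f2 \<Phi>" if c: "c \<in> K" for c
  proof (rule connected_induction_simple[of K "a + pi/2" c "\<lambda>c. \<exists>\<Phi>. ratio_extends c f1 f2 \<Phi>", OF _ K c re])
    show "connected K" by simp
    fix x assume "x \<in> K"
    show "\<exists>T. openin (top_of_set K) T \<and> x \<in> T \<and> 
        (\<forall>x\<in>T. \<forall>y\<in>T. (\<exists>\<Phi>. ratio_extends x f1 f2 \<Phi>) \<longrightarrow> (\<exists>\<Phi>. ratio_extends y f1 f2 \<Phi>))"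
    proof (intro exI[of _ "K \<inter> {x - pi/2<..<x + pi/2}"] conjI ballI impI)
      fix u v assume uv: "u \<in> K \<inter> {x - pi/2<..<x + pi/2}" "v \<in> K \<inter> {x - pi/2<..<x + pi/2}" "\<exists>\<Phi>. ratio_extends u f1 f2 \<Phi>"
      show "\<exists>\<Phi>. ratio_extends v f1 f2 \<Phi>"
        by (rule step[OF _ _ uv(3)]) (use uv in \<open>auto simp: abs_less_iff\<close>)
    qed (use \<open>x \<in> K\<close> in \<open>auto intro: openin_open_Int\<close>)
  qed
  then show ?thesis using that[OF f] by blast
qed

end

section \<open>Injectivity on the closed strip\<close>

text \<open>The Noshiro-Warschawski argument: along the segment from m to z, the inner product of
  \<open>y\<close> with z - m has derivative Re y' |z - m|^2.\<close>

lemma inner_diff_pos: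
  fixes y y' :: "complex \<Rightarrow> complex"
  assumes N: "convex N" "z \<in> N" "m \<in> N" "z \<noteq> m"
    and y: "\<And>x. x \<in> N \<Longrightarrow> (y has_field_derivative y' x) (at x)"
    and pos: "\<And>x. x \<in> N \<Longrightarrow> Re (y' x) > 0"
  shows "(y z - y m) \<bullet> (z - m) > 0"
proof -
  define p where "p t = m + of_real t * (z - m)" for t :: real
  have pN: "p t \<in> N" if "0 \<le> t" "t \<le> 1" for t
  proof -
    have "p t = (1 - t) *\<^sub>R m + t *\<^sub>R z" by (simp add: p_def scaleR_conv_of_real algebra_simps)
    then show ?thesis using convexD[OF N(1) N(3) N(2), of "1 - t" t] that by simp
  qed
  have "y (p 0) \<bullet> (z - m) < y (p 1) \<bullet> (z - m)"
  proof (rule DERIV_pos_imp_increasing_open[where f = "\<lambda>t. y (p t) \<bullet> (z - m)"])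
    fix t :: real assume t: "0 < t" "t < 1"
    have dp: "(p has_vector_derivative (z - m)) (at t)"
      unfolding p_def by (auto intro!: derivative_eq_intros simp: has_vector_derivative_def scaleR_conv_of_real)
    have "((y \<circ> p) has_vector_derivative (z - m) * y' (p t)) (at t)"
      by (rule field_vector_diff_chain_at[OF dp y[OF pN]]) (use t in auto)
    then have "((\<lambda>t. y (p t) \<bullet> (z - m)) has_derivative (\<lambda>h. (h *\<^sub>R ((z - m) * y' (p t))) \<bullet> (z - m))) (at t)"
      unfolding has_vector_derivative_def o_def by (rule has_derivative_inner_left)
    then have "((\<lambda>t. y (p t) \<bullet> (z - m)) has_real_derivative ((z - m) * y' (p t)) \<bullet> (z - m)) (at t)"
      by (simp add: has_field_derivative_def mult_commute_abs)
    moreover have "((z - m) * y' (p t)) \<bullet> (z - m) > 0"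
      using inner_mult_self[of "z - m" "y' (p t)"] pos[OF pN, of t] t N(4) by (simp add: inner_commute mult.commute)
    ultimately show "\<exists>d. ((\<lambda>t. y (p t) \<bullet> (z - m)) has_real_derivative d) (at t) \<and> d > 0" by blast
  next
    have "isCont (\<lambda>t. y (p t)) t" if "0 \<le> t" "t \<le> 1" for t
    proof (rule isCont_o2[where f = p and g = y])
      show "isCont y (p t)" by (rule DERIV_isCont[OF y[OF pN[OF that]]])
      show "isCont p t" unfolding p_def by (intro continuous_intros)
    qed
    then show "continuous_on {0..1} (\<lambda>t. y (p t) \<bullet> (z - m))"
      by (intro continuous_intros) (auto intro: continuous_at_imp_continuous_on)
  qed simp
  then show ?thesis by (simp add: p_def inner_diff_left)
qed

text \<open>The two outer bands inherit injectivity from substrips of height pi, the middle one gets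
  it from Re y' > 0. What remains is that the three images do not meet. The case
  \<open>A = H\<close> belongs to a strip of height exactly pi.\<close>

locale strip_graph =
  fixes a b A H :: real and y y' :: "complex \<Rightarrow> complex"
  assumes order: "a < A" "A \<le> H" "H < b"
    and cont: "continuous_on (closed_strip a b) y"
    and deriv: "\<And>z. z \<in> horizontal_strip a b \<Longrightarrow> (y has_field_derivative y' z) (at z)"
    and cont': "continuous_on (horizontal_strip a b) y'"
    and pos: "\<And>z. A \<le> Im z \<Longrightarrow> Im z \<le> H \<Longrightarrow> Re (y' z) > 0"
    and lim_bot: "filterlim (\<lambda>z. Re (y z)) at_bot (Re going_to at_bot within closed_strip a b)"
    and lim_top: "filterlim (\<lambda>z. Re (y z)) at_top (Re going_to at_top within closed_strip a b)"
    and inj_top: "inj_on y (closed_strip H b)"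
    and inj_bot: "inj_on y (closed_strip a A)"
begin

lemma mem_middle: "z \<in> closed_strip A H \<Longrightarrow> z \<in> horizontal_strip a b"
  using order by (auto simp: closed_strip_def horizontal_strip_def)

lemma middle_inner:
  assumes "z \<in> closed_strip A H" "m \<in> closed_strip A H" "z \<noteq> m"
  shows "(y z - y m) \<bullet> (z - m) > 0"
  by (rule inner_diff_pos[OF convex_closed_strip assms deriv[OF mem_middle] pos])
     (auto simp: closed_strip_def)

definition line :: "real \<Rightarrow> real \<Rightarrow> real" where "line h x = Re (y (Complex x h))"

lemma line_mem: "A \<le> h \<Longrightarrow> h \<le> H \<Longrightarrow> Complex x h \<in> closed_strip A H"
  by (simp add: closed_strip_def)

lemma isCont_y: "z \<in> horizontal_strip a b \<Longrightarrow> isCont y z"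
  using deriv by (blast intro: DERIV_isCont)

lemma line_isCont:
  assumes "A \<le> h" "h \<le> H" shows "isCont (\<lambda>x. y (Complex x h)) x"
proof (rule isCont_o2[where f = "\<lambda>x. Complex x h"])
  show "isCont (\<lambda>x. Complex x h) x" unfolding Complex_eq by (intro continuous_intros)
  show "isCont y (Complex x h)" by (rule isCont_y[OF mem_middle[OF line_mem[OF assms]]])
qed

lemma line_strict_mono:
  assumes "A \<le> h" "h \<le> H" shows "strict_mono (line h)"
proof (rule strict_monoI)
  fix s t :: real assume "s < t"
  then have "(y (Complex t h) - y (Complex s h)) \<bullet> (Complex t h - Complex s h) > 0"
    by (intro middle_inner line_mem assms) simp
  then show "line h s < line h t" using \<open>s < t\<close> by (simp add: line_def inner_complex_def zero_less_mult_iff)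
qed

lemma line_surj:
  assumes "A \<le> h" "h \<le> H" shows "surj (line h)"
  unfolding surj_def
proof
  fix t
  have mem: "Complex x h \<in> closed_strip a b" for x
    using order assms by (auto simp: closed_strip_def)
  have "filterlim (line h) at_bot at_bot" "filterlim (line h) at_top at_top"
    using filterlim_compose[OF lim_bot filterlim_line[OF mem]] filterlim_compose[OF lim_top filterlim_line[OF mem]]
    by (simp_all add: line_def[abs_def])
  then have "eventually (\<lambda>x. line h x \<le> t) at_bot" "eventually (\<lambda>x. t \<le> line h x) at_top"
    by (auto simp: filterlim_at_bot filterlim_at_top)
  then obtain x1 x2 where x: "line h x1 \<le> t" "t \<le> line h x2"
    by (meson eventually_at_bot_linorder eventually_at_top_linorder order_refl)
  then have "x1 \<le> x2"
    using line_strict_mono[OF assms] by (meson order_trans strict_mono_less_eq)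
  from IVT[OF x this] show "\<exists>x. t = line h x"
    using line_isCont[OF assms] by (auto simp: line_def[abs_def])
qed

lemma line_inv:
  assumes "A \<le> h" "h \<le> H" shows "line h (inv (line h) t) = t" "inv (line h) (line h x) = x"
  using surj_f_inv_f[OF line_surj[OF assms]] inv_f_f[OF strict_mono_imp_inj_on[OF line_strict_mono[OF assms]]]
  by auto

lemma line_inv_isCont:
  assumes "A \<le> h" "h \<le> H" shows "isCont (inv (line h)) t"
proof -
  have "isCont (inv (line h)) (line h (inv (line h) t))"
    by (rule isCont_inverse_function[of 1])
       (use line_inv[OF assms] line_isCont[OF assms] in \<open>auto simp: line_def[abs_def]\<close>)
  then show ?thesis by (simp add: line_inv[OF assms])
qed

text \<open>
  On the middle strip the real part of \<open>y'\<close> is positive, so \<open>y\<close> maps each horizontal line there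
  onto a graph over the real axis. The vertical distance to such a graph separates the images of the bands.
\<close>

definition height_above :: "real \<Rightarrow> complex \<Rightarrow> real" where
  "height_above h w = Im w - Im (y (Complex (inv (line h) (Re w)) h))"

lemma height_above_isCont:
  assumes "A \<le> h" "h \<le> H" shows "isCont (height_above h) w"
proof -
  have "isCont (\<lambda>w. inv (line h) (Re w)) w"
    by (rule isCont_o2[OF _ line_inv_isCont[OF assms]]) (rule bounded_linear.isCont[OF bounded_linear_Re continuous_ident])
  then have "isCont (\<lambda>w. y (Complex (inv (line h) (Re w)) h)) w"
    by (rule isCont_o2[OF _ line_isCont[OF assms]])
  from bounded_linear.isCont[OF bounded_linear_Im continuous_ident] bounded_linear.isCont[OF bounded_linear_Im this]
  show ?thesis unfolding height_above_def by (rule continuous_diff)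
qed

lemma height_above_eq:
  assumes h: "A \<le> h" "h \<le> H" and p: "p = Complex (inv (line h) (Re w)) h"
  shows "w - y p = \<i> * of_real (height_above h w)"
  using line_inv(1)[OF h, of "Re w"] by (simp add: complex_eq_iff height_above_def p line_def)

text \<open>The points \<open>y p\<close> and \<open>y z\<close> lie on one vertical, so the inner
  product sees only the imaginary part of z - p. Its sign thus decides on which side of the graph
  \<open>y z\<close> lies.\<close>

lemma height_above_inner:
  assumes h: "A \<le> h" "h \<le> H" and p: "p = Complex (inv (line h) (Re (y z))) h"
  shows "(y z - y p) \<bullet> (z - p) = height_above h (y z) * (Im z - h)"
  unfolding height_above_eq[OF h p] by (simp add: inner_complex_def p)

lemma height_above_middle:
  assumes h: "A \<le> h" "h \<le> H" and z: "z \<in> closed_strip A H"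
  shows "Im z \<ge> h \<Longrightarrow> height_above h (y z) \<ge> 0" "Im z \<le> h \<Longrightarrow> height_above h (y z) \<le> 0"
proof -
  define p where "p = Complex (inv (line h) (Re (y z))) h"
  have "height_above h (y z) = 0" if "Im z = h"
  proof -
    have "z = Complex (Re z) h" using that by (simp add: complex_eq_iff)
    then have "Re (y z) = line h (Re z)" by (metis line_def)
    then have "p = z" using that by (simp add: p_def line_inv[OF h] complex_eq_iff)
    then show ?thesis using height_above_eq[OF h p_def] by simp
  qed
  moreover have "height_above h (y z) * (Im z - h) > 0" if "Im z \<noteq> h"
  proof -
    have "z \<noteq> p" using that unfolding p_def by (metis complex.sel(2))
    from middle_inner[OF z line_mem[OF h] this[unfolded p_def]] show ?thesis
      unfolding height_above_inner[OF h refl] .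
  qed
  ultimately show "Im z \<ge> h \<Longrightarrow> height_above h (y z) \<ge> 0" "Im z \<le> h \<Longrightarrow> height_above h (y z) \<le> 0"
    by (cases "Im z = h"; force simp: zero_less_mult_iff)+
qed

text \<open>A zero of the height would put \<open>y z\<close> on the graph, making it equal to
  \<open>y\<close> at a point of the line, against injectivity. By connectedness the sign is
  constant on \<open>T\<close>, and one point close to the line reveals it. The factor
  \<open>\<sigma>\<close> treats bands above and below alike.\<close>

lemma height_above_band:
  assumes h: "A \<le> h" "h \<le> H" and T: "connected T" "T \<subseteq> closed_strip a b" "z \<in> T"
    and inj: "inj_on y (T \<union> {z. Im z = h})" and T0: "\<And>z. z \<in> T \<Longrightarrow> Im z \<noteq> h"
    and \<sigma>: "\<bar>\<sigma>\<bar> = 1" and d: "d > 0" "\<And>e. 0 < e \<Longrightarrow> e < d \<Longrightarrow> Complex 0 (h + \<sigma> * e) \<in> T"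
  shows "\<sigma> * height_above h (y z) > 0"
proof -
  let ?g = "\<lambda>z. \<sigma> * height_above h (y z)"
  have nz: "?g z \<noteq> 0" if "z \<in> T" for z
  proof
    assume "?g z = 0"
    then have "y z = y (Complex (inv (line h) (Re (y z))) h)"
      using height_above_eq[OF h refl, of "y z"] \<sigma> by auto
    then have "z = Complex (inv (line h) (Re (y z))) h"
      using inj_onD[OF inj] that by auto
    then have "Im z = h" by (metis complex.sel(2))
    then show False using T0[OF that] by simp
  qed
  have "continuous_on T ?g"
  proof (intro continuous_intros)
    have "continuous_on (y ` T) (height_above h)"
      using height_above_isCont[OF h] by (intro continuous_at_imp_continuous_on) auto
    then show "continuous_on T (\<lambda>z. height_above h (y z))"
      using continuous_on_compose2[OF _ continuous_on_subset[OF cont T(2)]] by auto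
  qed
  then have conn: "connected (?g ` T)" using T(1) by (rule connected_continuous_image)
  obtain z0 where z0: "z0 \<in> T" "?g z0 > 0"
  proof -
    define m0 where "m0 = Complex 0 h"
    have oB: "m0 \<in> horizontal_strip a b" using mem_middle[OF line_mem[OF h]] by (simp add: m0_def)
    have "isCont y' m0"
      using cont' oB open_horizontal_strip by (simp add: continuous_on_eq_continuous_at)
    then have "isCont (\<lambda>z. Re (y' z)) m0" by (rule bounded_linear.isCont[OF bounded_linear_Re])
    moreover have "Re (y' m0) > 0" using pos h by (simp add: m0_def)
    ultimately have "eventually (\<lambda>z. Re (y' z) > 0) (nhds m0)"
      using tendsto_at_iff_tendsto_nhds[of "\<lambda>z. Re (y' z)" m0] unfolding isCont_def
      by (auto dest: order_tendstoD)
    moreover have "eventually (\<lambda>z. z \<in> horizontal_strip a b) (nhds m0)"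
      using oB open_horizontal_strip by (rule eventually_nhds_in_open[rotated])
    ultimately have "eventually (\<lambda>z. Re (y' z) > 0 \<and> z \<in> horizontal_strip a b) (nhds m0)"
      by (rule eventually_conj)
    then obtain \<rho> where \<rho>: "\<rho> > 0" "\<And>z. z \<in> ball m0 \<rho> \<Longrightarrow> Re (y' z) > 0 \<and> z \<in> horizontal_strip a b"
      unfolding eventually_nhds_metric by (auto simp: dist_commute)
    \<comment> \<open>The point of the line whose image lies on the same vertical as that of the
      nearby point of \<open>T\<close>. As e tends to 0 both tend to \<open>m0\<close> and enter a
      ball where Re y' > 0.\<close>
    define p where "p e = Complex (inv (line h) (Re (y (Complex 0 (h + \<sigma> * e))))) h" for e
    have cz: "isCont (\<lambda>e. Complex 0 (h + \<sigma> * e)) 0" unfolding Complex_eq by (intro continuous_intros)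
    have "isCont (\<lambda>e. y (Complex 0 (h + \<sigma> * e))) 0"
      by (rule isCont_o2[OF cz]) (use isCont_y[OF oB] in \<open>simp add: m0_def\<close>)
    then have "isCont p 0"
      unfolding p_def Complex_eq
      by (intro continuous_intros isCont_o2[OF _ line_inv_isCont[OF h]]) auto
    moreover have "p 0 = m0"
      using line_inv(2)[OF h, of 0] by (simp add: p_def m0_def line_def)
    ultimately have "(p \<longlongrightarrow> m0) (at_right 0)" "((\<lambda>e. Complex 0 (h + \<sigma> * e)) \<longlongrightarrow> m0) (at_right 0)"
      using cz unfolding continuous_at
      by (auto simp: m0_def intro!: tendsto_mono[OF at_le[OF subset_UNIV], of _ _ 0 "{0<..}"])
    then have "eventually (\<lambda>e. p e \<in> ball m0 \<rho>) (at_right 0)" 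
       "eventually (\<lambda>e. Complex 0 (h + \<sigma> * e) \<in> ball m0 \<rho>) (at_right 0)"
      using \<rho>(1) by (auto simp: tendsto_iff dist_commute)
    moreover have "eventually (\<lambda>e. e \<in> {0<..<d}) (at_right 0)"
      using d(1) by (rule eventually_at_right_real)
    ultimately have "eventually (\<lambda>e. p e \<in> ball m0 \<rho> \<and> Complex 0 (h + \<sigma> * e) \<in> ball m0 \<rho> \<and> e \<in> {0<..<d}) (at_right 0)"
      by eventually_elim auto
    then obtain e where e: "p e \<in> ball m0 \<rho>" "Complex 0 (h + \<sigma> * e) \<in> ball m0 \<rho>" "0 < e" "e < d"
      using eventually_happens' trivial_limit_at_right_real by fastforce
    define z where "z = Complex 0 (h + \<sigma> * e)"
    have ne: "z \<noteq> p e" using e \<sigma> by (auto simp: z_def p_def)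
    have "(y z - y (p e)) \<bullet> (z - p e) > 0"
      by (rule inner_diff_pos[OF convex_ball _ e(1) ne deriv]) (use \<rho>(2) e z_def in auto)
    then have "height_above h (y z) * (Im z - h) > 0"
      using height_above_inner[OF h, of "p e" z] by (simp add: p_def z_def)
    then have "0 < ?g z * e" by (simp add: z_def mult_ac)
    then have "?g z > 0" using e(3) by (rule zero_less_mult_pos2)
    then show ?thesis using that d(2)[OF e(3,4)] z_def by blast
  qed
  show ?thesis
  proof (rule ccontr)
    assume "\<not> ?g z > 0"
    then have "?g z \<le> 0" "0 \<le> ?g z0" using z0 by auto
    then have "0 \<in> ?g ` T"
      using connectedD_interval[OF conn, of "?g z" "?g z0" 0] T(3) z0(1) by blast
    then show False using nz by auto
  qed
qed

lemma height_above_top: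
  assumes "H < Im z" "Im z \<le> b"
  shows "height_above H (y z) > 0"
proof -
  have "1 * height_above H (y z) > 0"
  proof (rule height_above_band[where T = "{z. H < Im z \<and> Im z \<le> b}" and d = "b - H"])
    have "{z. H < Im z \<and> Im z \<le> b} = {z. Im z > H} \<inter> {z. Im z \<le> b}" by auto
    then have "convex {z. H < Im z \<and> Im z \<le> b}" by (simp add: convex_Int convex_halfspace_Im_gt convex_halfspace_Im_le)
    then show "connected {z. H < Im z \<and> Im z \<le> b}" by (rule convex_connected)
    show "inj_on y ({z. H < Im z \<and> Im z \<le> b} \<union> {z. Im z = H})"
      by (rule inj_on_subset[OF inj_top]) (use order in \<open>auto simp: closed_strip_def\<close>)
  qed (use assms order in \<open>auto simp: closed_strip_def\<close>)
  then show ?thesis by simp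
qed

lemma height_above_bottom:
  assumes "a \<le> Im z" "Im z < A"
  shows "height_above A (y z) < 0"
proof -
  have "(-1) * height_above A (y z) > 0"
  proof (rule height_above_band[where T = "{z. a \<le> Im z \<and> Im z < A}" and d = "A - a"])
    have "{z. a \<le> Im z \<and> Im z < A} = {z. Im z \<ge> a} \<inter> {z. Im z < A}" by auto
    then have "convex {z. a \<le> Im z \<and> Im z < A}" by (simp add: convex_Int convex_halfspace_Im_ge convex_halfspace_Im_lt)
    then show "connected {z. a \<le> Im z \<and> Im z < A}" by (rule convex_connected)
    show "inj_on y ({z. a \<le> Im z \<and> Im z < A} \<union> {z. Im z = A})"
      by (rule inj_on_subset[OF inj_bot]) (use order in \<open>auto simp: closed_strip_def\<close>)
  qed (use assms order in \<open>auto simp: closed_strip_def\<close>)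
  then show ?thesis by simp
qed

theorem inj_on_closed_strip: "inj_on y (closed_strip a b)"
proof -
  have *: "z1 = z2" if z: "z1 \<in> closed_strip a b" "z2 \<in> closed_strip a b" and eq: "y z1 = y z2" and le: "Im z1 \<le> Im z2" for z1 z2
  proof -
    have z': "a \<le> Im z1" "Im z2 \<le> b" using z by (auto simp: closed_strip_def)
    consider "Im z1 \<ge> H" | "Im z2 \<le> A" | "A \<le> Im z1" "Im z2 \<le> H"
      | "A \<le> Im z1" "Im z1 < H" "H < Im z2" | "Im z1 < A" "A < Im z2" "Im z2 \<le> H" | "Im z1 < A" "H < Im z2"
      by linarith
    then show ?thesis
    proof cases
      case 1
      then show ?thesis using inj_onD[OF inj_top eq] z' le by (auto simp: closed_strip_def)
    next
      case 2
      then show ?thesis using inj_onD[OF inj_bot eq] z' le by (auto simp: closed_strip_def)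
    next
      case 3
      then show ?thesis using middle_inner[of z1 z2] eq le by (auto simp: closed_strip_def)
    next
      case 4
      then show ?thesis using height_above_top[of z2] height_above_middle(2)[of H z1] z' order eq
        by (auto simp: closed_strip_def)
    next
      case 5
      then show ?thesis using height_above_bottom[of z1] height_above_middle(1)[of A z2] z' order eq
        by (auto simp: closed_strip_def)
    next
      case 6
      \<comment> \<open>The upper graph is nowhere below the lower one: \<open>y p\<close> lies
        under \<open>y z2\<close> on the same vertical and not below the graph of height
        \<open>A\<close>, whereas \<open>y z1 = y z2\<close> lies below that graph.\<close>
      define p where "p = Complex (inv (line H) (Re (y z2))) H"
      have p: "p \<in> closed_strip A H" unfolding p_def by (rule line_mem) (use order in auto)
      have Rep: "Re (y p) = Re (y z2)"
        using line_inv(1)[of H "Re (y z2)"] order by (simp add: p_def line_def)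
      have "Im (y p) < Im (y z2)"
        using height_above_top[of z2] 6 z' by (simp add: height_above_def p_def)
      moreover have "height_above A (y p) \<ge> 0"
        using height_above_middle(1)[OF _ _ p, of A] order by (simp add: p_def)
      moreover have "height_above A (y z2) < 0" using height_above_bottom[of z1] 6 z' eq by simp
      ultimately show ?thesis using Rep by (simp add: height_above_def)
    qed
  qed
  show ?thesis
  proof (rule inj_onI)
    fix z1 z2 assume "z1 \<in> closed_strip a b" "z2 \<in> closed_strip a b" "y z1 = y z2"
    then show "z1 = z2" using *[of z1 z2] *[of z2 z1] by (cases "Im z1 \<le> Im z2") auto
  qed
qed

end

section \<open>The logarithm of the ratio of principal solutions\<close>

text \<open>Near \<open>z\<close> a continuous logarithm is the principal logarithm of F w / F z
  shifted by \<open>y z\<close>: the two have equal exponentials, and their imaginary parts differ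
  by at most 1 + pi, which is less than 2 pi.\<close>

lemma has_field_derivative_log:
  fixes y F :: "complex \<Rightarrow> complex"
  assumes y: "isCont y z" and F: "(F has_field_derivative F') (at z)"
    and ev: "eventually (\<lambda>w. exp (y w) = F w) (nhds z)"
  shows "(y has_field_derivative F' / F z) (at z)"
proof -
  have Fz: "exp (y z) = F z" using eventually_nhds_x_imp_x[OF ev] .
  then have nz: "F z \<noteq> 0" by (metis exp_not_eq_zero)
  have "((\<lambda>w. Ln (F w / F z) + y z) has_field_derivative inverse (F z / F z) * (F' / F z) + 0) (at z)"
    by (intro DERIV_add DERIV_chain2[OF has_field_derivative_Ln] DERIV_cdivide F DERIV_const) (use nz in auto)
  then have d: "((\<lambda>w. Ln (F w / F z) + y z) has_field_derivative F' / F z) (at z)" using nz by simp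
  have "eventually (\<lambda>w. dist (y w) (y z) < 1) (nhds z)"
    using y tendsto_at_iff_tendsto_nhds[of y z] unfolding isCont_def by (auto simp: tendsto_iff)
  with ev have "eventually (\<lambda>w. y w = Ln (F w / F z) + y z) (nhds z)"
  proof eventually_elim
    fix w assume w: "exp (y w) = F w" "dist (y w) (y z) < 1"
    then have "F w \<noteq> 0" by (metis exp_not_eq_zero)
    then have nzw: "F w / F z \<noteq> 0" using nz by simp
    have e: "exp (y w) = exp (Ln (F w / F z) + y z)"
      unfolding exp_add exp_Ln[OF nzw] Fz using w nz by simp
    have "\<bar>Im (y w) - Im (y z)\<bar> < 1"
      using abs_Im_le_cmod[of "y w - y z"] w(2) by (simp add: dist_norm)
    moreover have "\<bar>Im (Ln (F w / F z))\<bar> \<le> pi"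
      using mpi_less_Im_Ln[OF nzw] Im_Ln_le_pi[OF nzw] by (simp add: abs_le_iff)
    ultimately have "\<bar>Im (y w) - Im (Ln (F w / F z) + y z)\<bar> < 2 * pi"
      using pi_gt3 by simp
    then show "y w = Ln (F w / F z) + y z" by (rule exp_complex_eqI[OF _ e])
  qed
  from DERIV_cong_ev[OF refl this refl] d show ?thesis by simp
qed

text \<open>Each piece has its own threshold for the value of \<open>g\<close>; finitely many pieces
  admit a common one. For the strip, finiteness comes from the compactness of
  \<open>{a..b}\<close>.\<close>

lemma filterlim_going_to_finite_UN:
  assumes "finite I" "\<And>i. i \<in> I \<Longrightarrow> filterlim f G (g going_to F within D i)"
  shows "filterlim f G (g going_to F within (\<Union>i\<in>I. D i))"
  using assms
proof (induction I rule: finite_induct)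
  case empty
  then show ?case by (simp add: filterlim_def)
next
  case (insert i I)
  then show ?case by (simp add: filterlim_sup)
qed

section \<open>Gluing the ratios of the substrips\<close>

context hill_strip
begin

text \<open>
  Within \<open>{a..b}\<close>, \<open>core c\<close> omits the edges of the strip of height \<open>\<pi>\<close> centred at \<open>c\<close>, except
  those that are edges of the whole strip; so it is open and the ratio still extends to it.
\<close>

definition clamp :: "real \<Rightarrow> real" where
  "clamp h = max (a + pi/2) (min h (b - pi/2))"

definition core :: "real \<Rightarrow> real set" where
  "core c = {h. (c - pi/2 < h \<or> c = a + pi/2) \<and> (h < c + pi/2 \<or> c = b - pi/2)}"

lemma clamp_K: "clamp h \<in> K"
  using height by (auto simp: clamp_def)

lemma clamp_core: "h \<in> core (clamp h)"
  unfolding clamp_def core_def mem_Collect_eq using height pi_gt_zero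
  by (smt (verit) field_sum_of_halves)

lemma open_core: "open (core c)"
  unfolding core_def by (intro open_Collect_conj open_Collect_disj open_Collect_less continuous_intros open_Collect_const)

lemma core_closed_strip:
  assumes "c \<in> K" "z \<in> closed_strip a b" "Im z \<in> core c"
  shows "z \<in> C c"
  using assms by (auto simp: core_def closed_strip_def)

lemma core_strip:
  assumes "c \<in> K" "z \<in> B" "Im z \<in> core c"
  shows "z \<in> S c"
  using assms by (auto simp: core_def horizontal_strip_def)

lemma finite_cover:
  obtains I where "finite I" "I \<subseteq> K" "closed_strip a b = (\<Union>c\<in>I. closed_strip a b \<inter> Im -` core c)"
proof -
  have "{a..b} \<subseteq> (\<Union>c\<in>K. core c)" using clamp_K clamp_core by blast
  then obtain I where I: "I \<subseteq> K" "finite I" "{a..b} \<subseteq> (\<Union>c\<in>I. core c)"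
    using compactE_image[OF compact_Icc _, of K core] open_core by metis
  have "z \<in> (\<Union>c\<in>I. closed_strip a b \<inter> Im -` core c)" if "z \<in> closed_strip a b" for z
  proof -
    have "Im z \<in> {a..b}" using that by (simp add: closed_strip_def)
    then show ?thesis using I(3) that by blast
  qed
  then show ?thesis using that[OF I(2,1)] by blast
qed

text \<open>In the interior all extended ratios equal f1 / f2, so they glue to a function
  \<open>F\<close> without zeros on the closed strip. That strip is contractible, and
  \<open>y\<close> is a continuous logarithm of \<open>F\<close>. The Wronskian \<open>k\<close>
  enters as the numerator of the derivative of f1 / f2.\<close>

lemma log_ratio:
  obtains y f1 f1' f2 f2' k where "hill_solution B q f1 f1'" "hill_solution B q f2 f2'"
    "\<And>z. z \<in> B \<Longrightarrow> f1' z * f2 z - f1 z * f2' z = k" "k \<noteq> 0" 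
    "\<And>z. z \<in> B \<Longrightarrow> f1 z \<noteq> 0 \<and> f2 z \<noteq> 0"
    "continuous_on (closed_strip a b) y"
    "\<And>z. z \<in> B \<Longrightarrow> (y has_field_derivative k / (f1 z * f2 z)) (at z)"
    "inj_on y (closed_strip (b - pi/2) b)" "inj_on y (closed_strip a (a + pi/2))"
    "filterlim (\<lambda>z. Re (y z)) at_bot (Re going_to at_bot within closed_strip a b)"
    "filterlim (\<lambda>z. Re (y z)) at_top (Re going_to at_top within closed_strip a b)"
    "\<And>z. Im z \<in> K \<Longrightarrow> Re (k / (f1 z * f2 z)) > 0"
proof -
  obtain f1 f1' f2 f2' k where f: "hill_solution B q f1 f1'" "hill_solution B q f2 f2'"
    "\<And>z. z \<in> B \<Longrightarrow> f1' z * f2 z - f1 z * f2' z = k" "k \<noteq> 0" 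
    and "\<And>c. c \<in> K \<Longrightarrow> \<exists>\<Phi>. ratio_extends c f1 f2 \<Phi>"
    using principal_solutions by metis
  then obtain \<Phi> where "\<And>c. c \<in> K \<Longrightarrow> ratio_extends c f1 f2 (\<Phi> c)" by metis
  note \<Phi> = this this[unfolded ratio_extends_def]
  \<comment> \<open>On an edge of \<open>B\<close> the value comes from the only substrip that
    reaches this edge; \<open>clamp\<close> selects it.\<close>
  define F where "F z = \<Phi> (clamp (Im z)) z" for z
  have FB: "F z = f1 z / f2 z" "f1 z \<noteq> 0" "f2 z \<noteq> 0" if "z \<in> B" for z
    using \<Phi>(2)[OF clamp_K[of "Im z"]] core_strip[OF clamp_K that clamp_core] by (auto simp: F_def)
  have F\<Phi>: "F z = \<Phi> c z" if c: "c \<in> K" "z \<in> closed_strip a b" "Im z \<in> core c" for c z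
  proof (cases "z \<in> B")
    case True
    then show ?thesis using \<Phi>(2)[OF c(1)] core_strip[OF c(1) True c(3)] FB(1)[OF True] by auto
  next
    case False
    then have "Im z = a \<or> Im z = b" using c(2) by (auto simp: closed_strip_def horizontal_strip_def)
    then have "clamp (Im z) = c"
      using c(1,3) height pi_gt_zero unfolding clamp_def core_def mem_Collect_eq atLeastAtMost_iff
      by (smt (verit) field_sum_of_halves)
    then show ?thesis by (simp add: F_def)
  qed
  have Fnz: "F z \<noteq> 0" if "z \<in> closed_strip a b" for z
    using \<Phi>(2)[OF clamp_K[of "Im z"]] core_closed_strip[OF clamp_K that clamp_core] by (auto simp: F_def)
  have Fcont: "continuous_on (closed_strip a b) F"
    unfolding continuous_on_eq_continuous_within
  proof
    fix z assume z: "z \<in> closed_strip a b"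
    define c where "c = clamp (Im z)"
    have c: "c \<in> K" "Im z \<in> core c" using clamp_K clamp_core by (auto simp: c_def)
    have sub: "closed_strip a b \<inter> Im -` core c \<subseteq> C c" using core_closed_strip[OF c(1)] by auto
    have "continuous_on (closed_strip a b \<inter> Im -` core c) F"
      using continuous_on_subset[OF _ sub, of "\<Phi> c"] \<Phi>(2)[OF c(1)] F\<Phi>[OF c(1)] by (auto cong: continuous_on_cong_simp)
    then have "continuous (at z within closed_strip a b \<inter> Im -` core c) F"
      using z c by (auto simp: continuous_on_eq_continuous_within)
    moreover have "open (Im -` core c)" using open_core by (intro open_vimage continuous_intros) auto
    then have "at z within closed_strip a b \<inter> Im -` core c = at z within closed_strip a b"
      using c(2) by (intro at_within_nhd[of _ "Im -` core c"]) auto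
    ultimately show "continuous (at z within closed_strip a b) F" by simp
  qed
  obtain I where I: "finite I" "I \<subseteq> K" "closed_strip a b = (\<Union>c\<in>I. closed_strip a b \<inter> Im -` core c)"
    using finite_cover by blast
  \<comment> \<open>Used with the identity for the left end and with the reciprocal for the right
    end.\<close>
  have lims: "filterlim (g \<circ> F) H (Re going_to G within closed_strip a b)"
    if "\<And>c. c \<in> K \<Longrightarrow> filterlim (g \<circ> \<Phi> c) H (Re going_to G within C c)" for g :: "complex \<Rightarrow> complex" and H G
  proof (subst I(3), rule filterlim_going_to_finite_UN[OF I(1)])
    fix c assume "c \<in> I"
    then have c: "c \<in> K" using I(2) by blast
    have "filterlim (g \<circ> \<Phi> c) H (Re going_to G within closed_strip a b \<inter> Im -` core c)"
      by (rule filterlim_mono[OF that[OF c] order_refl going_to_mono]) (use core_closed_strip[OF c] in auto)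
    moreover have "eventually (\<lambda>z. (g \<circ> \<Phi> c) z = (g \<circ> F) z) (Re going_to G within closed_strip a b \<inter> Im -` core c)"
      by (rule eventually_mono[OF eventually_going_to_within_mem]) (use F\<Phi>[OF c] in auto)
    ultimately show "filterlim (g \<circ> F) H (Re going_to G within closed_strip a b \<inter> Im -` core c)"
      using filterlim_cong[OF refl refl] by blast
  qed
  have Fbot: "(F \<longlongrightarrow> 0) (Re going_to at_bot within closed_strip a b)"
    using lims[of id "nhds 0" at_bot] \<Phi>(2) by simp
  have Ftop: "((\<lambda>z. 1 / F z) \<longlongrightarrow> 0) (Re going_to at_top within closed_strip a b)"
    using lims[of "\<lambda>w. 1 / w" "nhds 0" at_top] \<Phi>(2) by (simp add: o_def)
  obtain y where y: "continuous_on (closed_strip a b) y" "\<And>z. z \<in> closed_strip a b \<Longrightarrow> F z = exp (y z)"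
    using continuous_logarithm_on_contractible[OF Fcont convex_imp_contractible[OF convex_closed_strip] Fnz] by blast
  have deriv: "(y has_field_derivative k / (f1 z * f2 z)) (at z)" if z: "z \<in> B" for z
  proof -
    have BC: "B \<subseteq> closed_strip a b" by (rule horizontal_strip_subset_closed)
    have "((\<lambda>w. f1 w / f2 w) has_field_derivative (f1' z * f2 z - f1 z * f2' z) / (f2 z * f2 z)) (at z)"
      by (rule DERIV_divide[OF hill_solutionD(1)[OF f(1) z] hill_solutionD(1)[OF f(2) z] FB(3)[OF z]])
    then have d: "((\<lambda>w. f1 w / f2 w) has_field_derivative k / (f2 z * f2 z)) (at z)" using f(3)[OF z] by simp
    have "isCont y z"
      using continuous_on_subset[OF y(1) BC] z open_horizontal_strip by (simp add: continuous_on_eq_continuous_at)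
    moreover have "eventually (\<lambda>w. exp (y w) = f1 w / f2 w) (nhds z)"
    proof (rule eventually_mono[OF eventually_nhds_in_open[OF open_horizontal_strip z]])
      fix w assume w: "w \<in> B"
      then have "exp (y w) = F w" using y(2) BC by auto
      then show "exp (y w) = f1 w / f2 w" using FB(1)[OF w] by simp
    qed
    ultimately have "(y has_field_derivative (k / (f2 z * f2 z)) / (f1 z / f2 z)) (at z)"
      using has_field_derivative_log[OF _ d] by blast
    moreover have "(k / (f2 z * f2 z)) / (f1 z / f2 z) = k / (f1 z * f2 z)"
      using FB(2,3)[OF z] by (simp add: field_simps)
    ultimately show ?thesis by simp
  qed
  \<comment> \<open>Where a single substrip suffices, exp y = F is injective, and therefore so is
    \<open>y\<close>.\<close>
  have inj: "inj_on y T" if "c \<in> K" "T \<subseteq> closed_strip a b" "Im ` T \<subseteq> core c" for c T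
  proof (rule inj_onI)
    fix u v assume uv: "u \<in> T" "v \<in> T" "y u = y v"
    have cs: "u \<in> closed_strip a b" "v \<in> closed_strip a b" "Im u \<in> core c" "Im v \<in> core c"
      using uv that(2,3) by auto
    have "F u = F v" using y(2)[OF cs(1)] y(2)[OF cs(2)] uv(3) by simp
    then have "\<Phi> c u = \<Phi> c v" using F\<Phi>[OF that(1) cs(1,3)] F\<Phi>[OF that(1) cs(2,4)] by simp
    moreover have "u \<in> C c" "v \<in> C c" using core_closed_strip[OF that(1)] cs by auto
    ultimately show "u = v" using \<Phi>(2)[OF that(1)] by (auto dest: inj_onD)
  qed
  have Re_y: "Re (y z) = ln (norm (F z))" if "z \<in> closed_strip a b" for z
    using y(2)[OF that] by simp
  show ?thesis
  proof (rule that[OF f _ y(1) deriv])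
    show "f1 z \<noteq> 0 \<and> f2 z \<noteq> 0" if "z \<in> B" for z using FB[OF that] by simp
    show "inj_on y (closed_strip (b - pi/2) b)"
    proof (rule inj[of "b - pi/2"])
      have "b - pi/2 - pi/2 < t" "a \<le> t" if "b - pi/2 \<le> t" for t
        using that height pi_gt_zero by linarith+
      then show "closed_strip (b - pi/2) b \<subseteq> closed_strip a b" "Im ` closed_strip (b - pi/2) b \<subseteq> core (b - pi/2)"
        by (force simp: closed_strip_def core_def)+
    qed (use height in auto)
    show "inj_on y (closed_strip a (a + pi/2))"
    proof (rule inj[of "a + pi/2"])
      have "t < a + pi/2 + pi/2" "t \<le> b" if "t \<le> a + pi/2" for t
        using that height pi_gt_zero by linarith+
      then show "closed_strip a (a + pi/2) \<subseteq> closed_strip a b" "Im ` closed_strip a (a + pi/2) \<subseteq> core (a + pi/2)"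
        by (force simp: closed_strip_def core_def)+
    qed (use height in auto)
    have "filterlim (\<lambda>z. norm (F z)) (at_right 0) (Re going_to at_bot within closed_strip a b)"
      unfolding filterlim_at using tendsto_norm_zero[OF Fbot] eventually_mono[OF eventually_going_to_within_mem] Fnz
      by (auto intro: eventually_mono[OF eventually_going_to_within_mem])
    from filterlim_compose[OF ln_at_0 this]
    show "filterlim (\<lambda>z. Re (y z)) at_bot (Re going_to at_bot within closed_strip a b)"
      by (rule filterlim_cong[OF refl refl, THEN iffD1, rotated])
         (auto intro!: eventually_mono[OF eventually_going_to_within_mem] simp: Re_y)
    have "filterlim (\<lambda>z. norm (1 / F z)) (at_right 0) (Re going_to at_top within closed_strip a b)"
      unfolding filterlim_at using tendsto_norm_zero[OF Ftop] Fnz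
      by (auto intro: eventually_mono[OF eventually_going_to_within_mem])
    then have "filterlim (\<lambda>z. - ln (norm (1 / F z))) at_top (Re going_to at_top within closed_strip a b)"
      using filterlim_compose[OF ln_at_0] by (simp only: filterlim_uminus_at_top minus_minus)
    then show "filterlim (\<lambda>z. Re (y z)) at_top (Re going_to at_top within closed_strip a b)"
      by (rule filterlim_cong[OF refl refl, THEN iffD1, rotated])
         (use Fnz in \<open>auto intro!: eventually_mono[OF eventually_going_to_within_mem] simp: Re_y norm_divide ln_div\<close>)
    fix z assume z: "Im z \<in> K"
    define h where "h = Im z"
    have h: "h \<in> K" "\<bar>h - h\<bar> < pi/2" using z by (auto simp: h_def)
    have line: "Complex t h \<in> B" for t
    proof -
      have "a < h" "h < b" using h pi_gt_zero unfolding atLeastAtMost_iff by linarith+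
      then show ?thesis by (simp add: horizontal_strip_def)
    qed
    have Cz: "z = Complex (Re z) h" by (simp add: h_def complex_eq_iff)
    have zB: "z \<in> B" using line[of "Re z"] Cz by simp
    have vl: "((\<lambda>t. Complex t h) has_vector_derivative 1) (at t)" for t
      unfolding Complex_eq by (auto intro!: derivative_eq_intros simp: has_vector_derivative_def scaleR_conv_of_real)
    have rs: "line_solution (\<lambda>t. q (Complex t h)) (\<lambda>t. F (Complex t h)) (\<lambda>t. F' (Complex t h))" if "hill_solution B q F F'" for F F'
      unfolding line_solution_def
      using field_vector_diff_chain_at[OF vl hill_solutionD(1)[OF that line]] field_vector_diff_chain_at[OF vl hill_solutionD(2)[OF that line]]
      by (auto simp: o_def)
    \<comment> \<open>The line is the midline of the substrip centred at \<open>h\<close>, where the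
      cosine is 1 and the bound becomes 1/4.\<close>
    have qpos: "Re (q (Complex t h)) > 0" for t
    proof -
      have "norm (q (Complex t h) - 1/4) < 1 / (2 * cos (Im (Complex t h) - h))^2"
        by (rule q_bound) (use h in \<open>auto simp: horizontal_strip_def\<close>)
      then have "norm (q (Complex t h) - 1/4) < 1/4" by (simp add: power2_eq_square)
      then show ?thesis using abs_Re_le_cmod[of "q (Complex t h) - 1/4"] by simp
    qed
    note line_facts = ratio_extends_line[OF \<Phi>(1)[OF h(1)] h(2)]
    \<comment> \<open>Along the line \<open>f1\<close> is negligible against \<open>f2\<close> on
      the left, so its modulus grows; \<open>f2\<close> is negligible against \<open>f1\<close> on
      the right, so its modulus falls. Hence f1'/f1 has positive and f2'/f2 negative real
      part.\<close>
    have "f1 (Complex (Re z) h) \<bullet> f1' (Complex (Re z) h) > 0"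
    proof (rule line_solution_vanishing_at_bot[OF rs[OF f(1)] rs[OF f(2)] qpos])
      show "f2' (Complex s h) * f1 (Complex s h) - f2 (Complex s h) * f1' (Complex s h) = - k" for s
        using f(3)[OF line, of s] by (simp add: algebra_simps)
    qed (use f(4) line_facts in auto)
    moreover have "f2 (Complex (Re z) h) \<bullet> f2' (Complex (Re z) h) < 0"
    proof (rule line_solution_vanishing_at_top[OF rs[OF f(2)] rs[OF f(1)] qpos])
      show "f1' (Complex s h) * f2 (Complex s h) - f1 (Complex s h) * f2' (Complex s h) = k" for s
        using f(3)[OF line, of s] by (simp add: algebra_simps)
    qed (use f(4) line_facts in auto)
    ultimately have i: "f1 z \<bullet> f1' z > 0" "f2 z \<bullet> f2' z < 0" unfolding Cz[symmetric] by auto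
    have re: "Re (w' / w) = (w \<bullet> w') / (norm w)^2" for w w' :: complex
      by (simp add: Re_divide cmod_power2 inner_complex_def mult.commute)
    have "k / (f1 z * f2 z) = f1' z / f1 z - f2' z / f2 z"
      unfolding f(3)[OF zB, symmetric] using FB(2,3)[OF zB] by (simp add: field_simps)
    then have "Re (k / (f1 z * f2 z)) = (f1 z \<bullet> f1' z) / (norm (f1 z))^2 - (f2 z \<bullet> f2' z) / (norm (f2 z))^2"
      by (simp only: minus_complex.sel re)
    also have "\<dots> > 0"
    proof -
      have "(f1 z \<bullet> f1' z) / (norm (f1 z))^2 > 0" using i(1) FB(2)[OF zB] by (intro divide_pos_pos) auto
      moreover have "(f2 z \<bullet> f2' z) / (norm (f2 z))^2 < 0" using i(2) FB(3)[OF zB] by (intro divide_neg_pos) auto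
      ultimately show ?thesis by linarith
    qed
    finally show "Re (k / (f1 z * f2 z)) > 0" .
  qed
qed

end

section \<open>Liouville transformation and embedding\<close>

text \<open>Below, \<open>P = 1 / y\<^sub>z\<close> and \<open>m\<close> is the product of the derivatives of the two solutions over their Wronskian.\<close>

lemma wronskian_liouville_identity:
  fixes f s s' P P' P'' f' f'' q m :: complex
  assumes sP: "s^2 * P = 1" and s': "s' = - (1/2) * s^3 * P'"
    and P'2: "P'^2 = 1 + 4 * P * m" and P'': "P'' = 2 * q * P + 2 * m"
  shows "s * (s' * (P * f' - P' * f / 2) + s * ((P' * f' + P * f'') - (P'' * f + P' * f') / 2)) - s^4 * f / 4
       = f'' - q * f"
proof -
  have 1: "s * (s' * (P * f' - P' * f / 2)) = - (1/2) * (s^2 * P) * s^2 * P' * f' + (1/4) * s^4 * P'^2 * f"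
    unfolding s' by (simp add: field_simps power2_eq_square power3_eq_cube power4_eq_xxxx)
  have 2: "s * (s * ((P' * f' + P * f'') - (P'' * f + P' * f') / 2))
      = (1/2) * s^2 * P' * f' + (s^2 * P) * f'' - (1/2) * s^2 * P'' * f"
    by (simp add: field_simps power2_eq_square)
  have 3: "(1/4) * s^4 * P'^2 * f - (1/2) * s^2 * P'' * f
      = (1/4) * s^4 * f + (s^2 * P) * s^2 * m * f - (s^2 * P) * q * f - s^2 * m * f"
    unfolding P'2 P'' by (simp add: algebra_simps power2_eq_square power4_eq_xxxx)
  show ?thesis unfolding distrib_left 1 2 using 3 unfolding sP by (simp add: field_simps)
qed

text \<open>Everything is expressed through P = 1 / y_z = f1 f2 / k. Differentiating s^2 P = 1 gives
  s', the equation for \<open>f1\<close> and \<open>f2\<close> gives P'', and the constancy of the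
  Wronskian enters through (f1' f2 + f1 f2')^2 = k^2 + 4 f1 f2 f1' f2'.\<close>

lemma liouville_of_solutions:
  assumes B: "open B" and f1: "hill_solution B q f1 f1'" and f2: "hill_solution B q f2 f2'"
    and k: "\<And>z. z \<in> B \<Longrightarrow> f1' z * f2 z - f1 z * f2' z = k" "k \<noteq> 0"
    and nz: "\<And>z. z \<in> B \<Longrightarrow> f1 z \<noteq> 0 \<and> f2 z \<noteq> 0"
    and y: "\<And>z. z \<in> B \<Longrightarrow> (y has_field_derivative k / (f1 z * f2 z)) (at z)"
    and s: "s holomorphic_on B" "\<And>z. z \<in> B \<Longrightarrow> (s z)^2 = deriv y z"
    and q: "\<And>z. z \<in> B \<Longrightarrow> q z = 1/4 + p z / 2"
  shows "ops_eq_on B (hill_op p) (mult_op (\<lambda>z. (s z)^3) \<circ> const_hill_op_wrt y \<circ> mult_op s)"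
  unfolding ops_eq_on_def
proof (intro allI impI ballI)
  fix U f z assume U: "open U" "U \<subseteq> B" and f: "f holomorphic_on U" and z: "z \<in> U"
  define P where "P z = f1 z * f2 z / k" for z
  define P' where "P' z = (f1' z * f2 z + f1 z * f2' z) / k" for z
  define P'' where "P'' z = (2 * q z * (f1 z * f2 z) + 2 * (f1' z * f2' z)) / k" for z
  have P: "(P has_field_derivative P' w) (at w)" and P': "(P' has_field_derivative P'' w) (at w)" if "w \<in> B" for w
  proof -
    note [derivative_intros] = hill_solutionD[OF f1 that] hill_solutionD[OF f2 that]
    show "(P has_field_derivative P' w) (at w)"
      unfolding P_def P'_def by (rule DERIV_cdivide) (auto intro!: derivative_eq_intros)
    show "(P' has_field_derivative P'' w) (at w)"
      unfolding P'_def P''_def by (rule DERIV_cdivide) (auto intro!: derivative_eq_intros simp: algebra_simps)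
  qed
  have dy: "deriv y w = k / (f1 w * f2 w)" if "w \<in> B" for w
    by (rule DERIV_imp_deriv[OF y[OF that]])
  have sP: "(s w)^2 * P w = 1" if "w \<in> B" for w
    using s(2)[OF that] dy[OF that] nz[OF that] k(2) by (simp add: P_def)
  have snz: "s w \<noteq> 0" if "w \<in> B" for w using sP[OF that] by auto
  have ds: "(s has_field_derivative deriv s w) (at w)" if "w \<in> B" for w
    using holomorphic_derivI[OF s(1) B that] .
  have s': "deriv s w = - (1/2) * (s w)^3 * P' w" if w: "w \<in> B" for w
  proof -
    have "((\<lambda>w. (s w)^2 * P w) has_field_derivative 2 * s w * deriv s w * P w + (s w)^2 * P' w) (at w)"
      by (auto intro!: derivative_eq_intros ds[OF w] P[OF w])
    moreover have "((\<lambda>w. (s w)^2 * P w) has_field_derivative 0) (at w)"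
      by (rule DERIV_cong_ev[OF refl _ refl, THEN iffD2, OF _ DERIV_const[of 1]])
         (use sP eventually_nhds_in_open[OF B w] in \<open>auto elim: eventually_mono\<close>)
    ultimately have 0: "2 * s w * deriv s w * P w + (s w)^2 * P' w = 0" by (rule DERIV_unique)
    have "2 * deriv s w * ((s w)^2 * P w) + (s w)^3 * P' w = s w * (2 * s w * deriv s w * P w + (s w)^2 * P' w)"
      by (simp add: algebra_simps power2_eq_square power3_eq_cube)
    then have "2 * deriv s w + (s w)^3 * P' w = 0" using 0 sP[OF w] by simp
    then have "2 * deriv s w = - ((s w)^3 * P' w)" by (simp add: add_eq_0_iff2)
    then have "deriv s w = - ((s w)^3 * P' w) / 2" by (metis nonzero_mult_div_cancel_left zero_neq_numeral)
    then show ?thesis by simp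
  qed
  have df: "(f has_field_derivative deriv f w) (at w)" if "w \<in> U" for w
    using holomorphic_derivI[OF f U(1) that] .
  have df': "(deriv f has_field_derivative deriv (deriv f) w) (at w)" if "w \<in> U" for w
    using holomorphic_derivI[OF holomorphic_deriv[OF f U(1)] U(1) that] .
  \<comment> \<open>Established on all of \<open>U\<close>, not only at \<open>z\<close>, because it
    is differentiated once more.\<close>
  have h: "deriv_wrt y (mult_op s f) w = s w * (P w * deriv f w - P' w * f w / 2)" if w: "w \<in> U" for w
  proof -
    have wB: "w \<in> B" using w U(2) by blast
    have "((\<lambda>z. s z * f z) has_field_derivative deriv s w * f w + s w * deriv f w) (at w)"
      by (auto intro!: derivative_eq_intros ds[OF wB] df[OF w])
    then have 1: "deriv (mult_op s f) w = deriv s w * f w + s w * deriv f w"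
      unfolding mult_op_def by (rule DERIV_imp_deriv)
    have "1 / deriv y w = P w" using dy[OF wB] by (simp add: P_def)
    then have "deriv_wrt y (mult_op s f) w = P w * (deriv s w * f w + s w * deriv f w)"
      unfolding deriv_wrt_def 1 by simp
    also have "\<dots> = - (1/2) * ((s w)^2 * P w) * s w * P' w * f w + s w * P w * deriv f w"
      unfolding s'[OF wB] by (simp add: algebra_simps power2_eq_square power3_eq_cube)
    also have "\<dots> = s w * (P w * deriv f w - P' w * f w / 2)"
      unfolding sP[OF wB] by (simp add: algebra_simps)
    finally show ?thesis .
  qed
  have zB: "z \<in> B" using z U(2) by blast
  define h' where "h' = deriv s z * (P z * deriv f z - P' z * f z / 2)
      + s z * ((P' z * deriv f z + P z * deriv (deriv f) z) - (P'' z * f z + P' z * deriv f z) / 2)"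
  have "((\<lambda>w. s w * (P w * deriv f w - P' w * f w / 2)) has_field_derivative h') (at z)"
    unfolding h'_def
    by (rule derivative_eq_intros ds[OF zB] P[OF zB] P'[OF zB] df[OF z] df'[OF z] refl | simp add: algebra_simps)+
  then have "(deriv_wrt y (mult_op s f) has_field_derivative h') (at z)"
    by (rule DERIV_cong_ev[OF refl _ refl, THEN iffD2, rotated])
       (use h eventually_nhds_in_open[OF U(1) z] in \<open>auto elim: eventually_mono\<close>)
  then have dh: "deriv (deriv_wrt y (mult_op s f)) z = h'" by (rule DERIV_imp_deriv)
  have rhs: "(mult_op (\<lambda>z. (s z)^3) \<circ> const_hill_op_wrt y \<circ> mult_op s) f z = s z * h' - (s z)^4 * f z / 4"
  proof -
    have "(deriv_wrt y ^^ 2) (mult_op s f) z = h' / (s z)^2"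
      using dh s(2)[OF zB] by (simp add: numeral_2_eq_2 deriv_wrt_def[of y "deriv_wrt y (mult_op s f)"])
    then have "(mult_op (\<lambda>z. (s z)^3) \<circ> const_hill_op_wrt y \<circ> mult_op s) f z
        = (s z)^3 * (h' / (s z)^2 - 1/4 * (s z * f z))"
      by (simp add: mult_op_def const_hill_op_wrt_def)
    also have "\<dots> = s z * h' - (s z)^4 * f z / 4"
      using snz[OF zB] by (simp add: field_simps power2_eq_square power3_eq_cube power4_eq_xxxx)
    finally show ?thesis .
  qed
  have P'2: "(P' z)^2 = 1 + 4 * P z * (f1' z * f2' z / k)"
  proof -
    have "(f1' z * f2 z + f1 z * f2' z)^2 = (f1' z * f2 z - f1 z * f2' z)^2 + 4 * (f1 z * f2 z) * (f1' z * f2' z)"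
      by (simp add: power2_eq_square algebra_simps)
    then have "(P' z)^2 = (k^2 + 4 * (f1 z * f2 z) * (f1' z * f2' z)) / k^2"
      unfolding k(1)[OF zB] P'_def power_divide by simp
    then show ?thesis using k(2) unfolding P_def
      by (simp add: add_divide_distrib power2_eq_square)
  qed
  have P''2: "P'' z = 2 * q z * P z + 2 * (f1' z * f2' z / k)"
    by (simp add: P''_def P_def add_divide_distrib)
  have "s z * h' - (s z)^4 * f z / 4 = deriv (deriv f) z - q z * f z"
    unfolding h'_def by (rule wronskian_liouville_identity[OF sP[OF zB] s'[OF zB] P'2 P''2])
  then show "hill_op p f z = (mult_op (\<lambda>z. (s z)^3) \<circ> const_hill_op_wrt y \<circ> mult_op s) f z"
    unfolding rhs by (simp add: hill_op_def numeral_2_eq_2 q[OF zB])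
qed

section \<open>Topology of the extended strip\<close>

lemma Hausdorff_space_ext_plane: "Hausdorff_space (euclidean :: ext_plane topology)"
proof -
  have fin: "open (Fin ` V)" if "open V" for V
    using that by (auto simp: open_ext_plane_def inj_vimage_image_eq inj_def)
  have minus: "open (insert Minus_Inf (Fin ` {z. Re z < c}))" for c
  proof -
    have "Fin -` insert Minus_Inf (Fin ` {z. Re z < c}) = {z. Re z < c}" by auto
    then show ?thesis by (auto simp: open_ext_plane_def open_halfspace_Re_lt)
  qed
  have plus: "open (insert Plus_Inf (Fin ` {z. Re z > c}))" for c
  proof -
    have "Fin -` insert Plus_Inf (Fin ` {z. Re z > c}) = {z. Re z > c}" by auto
    then show ?thesis by (auto simp: open_ext_plane_def open_halfspace_Re_gt)
  qed
  \<comment> \<open>Pairs of points of different kinds are listed in one order only; symmetry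
    provides the other.\<close>
  have sep: "\<exists>U V. open U \<and> open V \<and> x \<in> U \<and> y \<in> V \<and> U \<inter> V = {}"
    if "x \<noteq> y" "(x, y) \<in> {(Fin v, Fin w) |v w. True} \<union> {(Fin v, Minus_Inf) |v. True} \<union> {(Fin v, Plus_Inf) |v. True} \<union> {(Minus_Inf, Plus_Inf)}" for x y
    using that(2)
  proof (elim UnE)
    assume "(x, y) \<in> {(Fin v, Fin w) |v w. True}"
    then obtain v w where vw: "x = Fin v" "y = Fin w" by auto
    then have "v \<noteq> w" using that(1) by auto
    then obtain U V where "open U" "open V" "v \<in> U" "w \<in> V" "U \<inter> V = {}"
      using hausdorff[of v w] by auto
    then show ?thesis using vw fin by (intro exI[of _ "Fin ` U"] exI[of _ "Fin ` V"]) auto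
  next
    assume "(x, y) \<in> {(Fin v, Minus_Inf) |v. True}"
    then obtain v where "x = Fin v" "y = Minus_Inf" by auto
    then show ?thesis using fin[OF open_halfspace_Re_gt] minus
      by (intro exI[of _ "Fin ` {z. Re z > Re v - 1}"] exI[of _ "insert Minus_Inf (Fin ` {z. Re z < Re v - 1})"]) auto
  next
    assume "(x, y) \<in> {(Fin v, Plus_Inf) |v. True}"
    then obtain v where "x = Fin v" "y = Plus_Inf" by auto
    then show ?thesis using fin[OF open_halfspace_Re_lt] plus
      by (intro exI[of _ "Fin ` {z. Re z < Re v + 1}"] exI[of _ "insert Plus_Inf (Fin ` {z. Re z > Re v + 1})"]) auto
  next
    assume "(x, y) \<in> {(Minus_Inf, Plus_Inf)}"
    then show ?thesis using minus[of 0] plus[of 0]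
      by (intro exI[of _ "insert Minus_Inf (Fin ` {z. Re z < 0})"] exI[of _ "insert Plus_Inf (Fin ` {z. Re z > 0})"]) auto
  qed
  show ?thesis
    unfolding Hausdorff_space_def
  proof (intro allI impI)
    fix x y :: ext_plane assume xy: "x \<in> topspace euclidean \<and> y \<in> topspace euclidean \<and> x \<noteq> y"
    have "\<exists>U V. open U \<and> open V \<and> x \<in> U \<and> y \<in> V \<and> U \<inter> V = {}"
    proof (cases "(x, y) \<in> {(Fin v, Fin w) |v w. True} \<union> {(Fin v, Minus_Inf) |v. True} \<union> {(Fin v, Plus_Inf) |v. True} \<union> {(Minus_Inf, Plus_Inf)}")
      case True
      then show ?thesis using sep[of x y] xy by blast
    next
      case False
      then have "(y, x) \<in> {(Fin v, Fin w) |v w. True} \<union> {(Fin v, Minus_Inf) |v. True} \<union> {(Fin v, Plus_Inf) |v. True} \<union> {(Minus_Inf, Plus_Inf)}"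
        using xy by (cases x; cases y) auto
      then show ?thesis using sep[of y x] xy by blast
    qed
    then show "\<exists>U V. openin euclidean U \<and> openin euclidean V \<and> x \<in> U \<and> y \<in> V \<and> disjnt U V"
      by (auto simp: disjnt_def)
  qed
qed

text \<open>The members of the cover that contain the two ends absorb everything left of
  \<open>c\<close> and right of \<open>d\<close>; a compact rectangle, possibly empty,
  remains.\<close>

lemma compact_hat:
  assumes "a < b"
  shows "compact (hat (horizontal_strip a b))"
proof (rule compactI)
  fix \<C> :: "ext_plane set set"
  assume op: "\<forall>t\<in>\<C>. open t" and cover: "hat (horizontal_strip a b) \<subseteq> \<Union>\<C>"
  have hat: "hat (horizontal_strip a b) = Fin ` {z. a \<le> Im z \<and> Im z \<le> b} \<union> {Minus_Inf, Plus_Inf}"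
    by (rule hat_horizontal_strip[OF assms])
  obtain U where U: "U \<in> \<C>" "Minus_Inf \<in> U" using cover unfolding hat by blast
  obtain V where V: "V \<in> \<C>" "Plus_Inf \<in> V" using cover unfolding hat by blast
  obtain c where c: "Fin ` {z. Re z < c} \<subseteq> U" using U op by (auto simp: open_ext_plane_def)
  obtain d where d: "Fin ` {z. Re z > d} \<subseteq> V" using V op by (auto simp: open_ext_plane_def)
  have "continuous_on UNIV Fin"
    by (subst continuous_on_open_vimage) (auto simp: open_ext_plane_def)
  then have "compact (Fin ` cbox (Complex c a) (Complex d b))"
    by (intro compact_continuous_image compact_cbox) (rule continuous_on_subset[OF _ subset_UNIV])
  moreover have "Fin ` cbox (Complex c a) (Complex d b) \<subseteq> \<Union>\<C>"
      proof -
    have "cbox (Complex c a) (Complex d b) \<subseteq> {z. a \<le> Im z \<and> Im z \<le> b}"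
      by (auto simp: in_cbox_complex_iff)
    then show ?thesis using cover unfolding hat by blast
  qed
  ultimately obtain \<D> where D: "\<D> \<subseteq> \<C>" "finite \<D>" "Fin ` cbox (Complex c a) (Complex d b) \<subseteq> \<Union>\<D>"
    using compactE[of "Fin ` cbox (Complex c a) (Complex d b)" \<C>] op by metis
  have "hat (horizontal_strip a b) \<subseteq> \<Union>(insert U (insert V \<D>))"
  proof
    fix x assume "x \<in> hat (horizontal_strip a b)"
    then consider "x = Minus_Inf" | "x = Plus_Inf" | z where "x = Fin z" "a \<le> Im z" "Im z \<le> b"
      unfolding hat by auto
    then show "x \<in> \<Union>(insert U (insert V \<D>))"
    proof cases
      case 3
      consider "Re z < c" | "Re z > d" | "c \<le> Re z" "Re z \<le> d" by linarith
      then show ?thesis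
      proof cases
        assume "c \<le> Re z" "Re z \<le> d"
        then have "z \<in> cbox (Complex c a) (Complex d b)" using 3 by (simp add: in_cbox_complex_iff)
        then show ?thesis using D(3) 3(1) by blast
      qed (use 3 c d in auto)
    qed (use U V in auto)
  qed
  then show "\<exists>\<C>'\<subseteq>\<C>. finite \<C>' \<and> hat (horizontal_strip a b) \<subseteq> \<Union>\<C>'"
    using U V D by (intro exI[of _ "insert U (insert V \<D>)"]) auto
qed

text \<open>A continuous injection of a compact space into a Hausdorff space is closed, hence an
  embedding, so continuity of the inverse needs no separate argument. The divergence of Re y gives
  continuity at the two ends.\<close>

lemma embedding_hat:
  assumes "a < b" and cont: "continuous_on (closed_strip a b) y" and inj: "inj_on y (closed_strip a b)"
    and bot: "filterlim (\<lambda>z. Re (y z)) at_bot (Re going_to at_bot within closed_strip a b)"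
    and top: "filterlim (\<lambda>z. Re (y z)) at_top (Re going_to at_top within closed_strip a b)"
  shows "embedding_map (top_of_set (hat (horizontal_strip a b))) euclidean
           (case_ext_plane (\<lambda>z. Fin (y z)) Minus_Inf Plus_Inf)"
    (is "embedding_map (top_of_set ?H) _ ?Y")
proof -
  have hat: "?H = Fin ` closed_strip a b \<union> {Minus_Inf, Plus_Inf}"
    unfolding hat_horizontal_strip[OF assms(1)] closed_strip_def ..
  have "continuous_on ?H ?Y"
    unfolding continuous_on_topological
  proof (intro ballI allI impI)
    fix x V assume x: "x \<in> ?H" and V: "open V" "?Y x \<in> V"
    consider z where "x = Fin z" "z \<in> closed_strip a b" | "x = Minus_Inf" | "x = Plus_Inf"
      using x unfolding hat by auto
    then show "\<exists>A. open A \<and> x \<in> A \<and> (\<forall>y\<in>?H. y \<in> A \<longrightarrow> ?Y y \<in> V)"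
    proof cases
      case 1
      have "open (Fin -` V)" "y z \<in> Fin -` V" using V 1 by (auto simp: open_ext_plane_def)
      then obtain A where A: "open A" "z \<in> A" "\<forall>w\<in>closed_strip a b. w \<in> A \<longrightarrow> y w \<in> Fin -` V"
        using cont 1(2) unfolding continuous_on_topological by meson
      have "Fin -` Fin ` A = A" by auto
      then have "open (Fin ` A)" using A(1) by (auto simp: open_ext_plane_def)
      then show ?thesis using A 1 unfolding hat by (intro exI[of _ "Fin ` A"]) auto
    next
      case 2
      then obtain c where c: "Fin ` {z. Re z < c} \<subseteq> V" using V by (auto simp: open_ext_plane_def)
      have "eventually (\<lambda>z. Re (y z) < c) (Re going_to at_bot within closed_strip a b)"
        using bot by (simp add: filterlim_at_bot_dense)
      then obtain d where d: "\<And>z. z \<in> closed_strip a b \<Longrightarrow> Re z < d \<Longrightarrow> Re (y z) < c"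
        by (auto simp: eventually_going_to_at_bot_dense)
      have "Fin -` insert Minus_Inf (Fin ` {z. Re z < d}) = {z. Re z < d}" by auto
      then have "open (insert Minus_Inf (Fin ` {z. Re z < d}))" by (auto simp: open_ext_plane_def open_halfspace_Re_lt)
      then show ?thesis using 2 V c d unfolding hat
        by (intro exI[of _ "insert Minus_Inf (Fin ` {z. Re z < d})"]) auto
    next
      case 3
      then obtain c where c: "Fin ` {z. Re z > c} \<subseteq> V" using V by (auto simp: open_ext_plane_def)
      have "eventually (\<lambda>z. Re (y z) > c) (Re going_to at_top within closed_strip a b)"
        using top by (simp add: filterlim_at_top_dense)
      then obtain d where d: "\<And>z. z \<in> closed_strip a b \<Longrightarrow> Re z > d \<Longrightarrow> Re (y z) > c"
        by (auto simp: eventually_going_to_at_top_dense)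
      have "Fin -` insert Plus_Inf (Fin ` {z. Re z > d}) = {z. Re z > d}" by auto
      then have "open (insert Plus_Inf (Fin ` {z. Re z > d}))" by (auto simp: open_ext_plane_def open_halfspace_Re_gt)
      then show ?thesis using 3 V c d unfolding hat
        by (intro exI[of _ "insert Plus_Inf (Fin ` {z. Re z > d})"]) auto
    qed
  qed
  then have cm: "continuous_map (top_of_set ?H) euclidean ?Y" by simp
  have "closed_map (top_of_set ?H) euclidean ?Y"
    using continuous_imp_closed_map_gen[OF _ Hausdorff_imp_kc_space[OF Hausdorff_space_ext_plane] cm]
      compact_hat[OF assms(1)] by (simp add: compact_space_subtopology)
  moreover have "inj_on ?Y (topspace (top_of_set ?H))"
    using inj unfolding hat by (auto simp: inj_on_def)
  ultimately show ?thesis using cm by (intro injective_closed_imp_embedding_map)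
qed

lemma edge_dist_ge:
  assumes "a < b" "d > 0" and z: "a + d \<le> Im z" "Im z \<le> b - d"
  shows "edge_dist (horizontal_strip a b) z \<ge> d"
proof -
  let ?B = "horizontal_strip a b"
  have "closed (closed_strip a b)"
    unfolding closed_strip_def by (intro closed_Collect_conj closed_Collect_le continuous_intros)
  then have "closure ?B \<subseteq> closed_strip a b"
    by (rule closure_minimal[OF horizontal_strip_subset_closed])
  then have fr: "frontier ?B \<subseteq> {w. Im w = a \<or> Im w = b}"
    unfolding frontier_def interior_open[OF open_horizontal_strip]
    by (auto simp: closed_strip_def horizontal_strip_def)
  have "z \<in> ?B" using z assms by (simp add: horizontal_strip_def)
  moreover have "Complex 0 a \<notin> ?B" by (simp add: horizontal_strip_def)
  \<comment> \<open>By convention \<open>infdist\<close> to the empty set is 0, so the lower bound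
    needs a boundary point.\<close>
  ultimately have ne: "frontier ?B \<noteq> {}" using frontier_not_empty[of ?B] by auto
  have "d \<le> dist z w" if "w \<in> frontier ?B" for w
  proof -
    have "d \<le> \<bar>Im (z - w)\<bar>" using fr that z by auto
    also have "\<dots> \<le> dist z w" unfolding dist_norm by (rule abs_Im_le_cmod)
    finally show ?thesis .
  qed
  then show ?thesis
    unfolding edge_dist_def infdist_notempty[OF ne] by (intro cINF_greatest ne)
qed

theorem theorem1:
  fixes a b :: real and B :: "complex set" and p :: "complex \<Rightarrow> complex"
  assumes "B = horizontal_strip a b"
    and "b - a \<ge> pi"
    and "p holomorphic_on B"
    and "\<And>z. z \<in> B \<Longrightarrow>
           norm (p z / 2) <
             (if edge_dist B z \<le> pi / 2 then (1 / (2 * sin (edge_dist B z)))^2 else 1 / 4)"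
  shows "\<exists>y. conformal_on B y \<and>
           (\<exists>Y. embedding_map (top_of_set (hat B)) (euclidean :: ext_plane topology) Y \<and>
                (\<forall>z\<in>B. Y (Fin z) = Fin (y z)) \<and>
                Y Minus_Inf = Minus_Inf \<and> Y Plus_Inf = Plus_Inf) \<and>
           liouville_transformation_on B p y"
proof -
  define q where "q z = 1/4 + p z / 2" for z
  have ab: "a < b" using assms(2) pi_gt_zero by linarith
  have bound: "norm (q z - 1/4) < 1 / (2 * cos (Im z - c))^2"
    if c: "a + pi/2 \<le> c" "c \<le> b - pi/2" and z: "z \<in> horizontal_strip (c - pi/2) (c + pi/2)" for c z
  proof -
    \<comment> \<open>The distance from \<open>z\<close> to the edge of the substrip centred at
      \<open>c\<close>. The substrip lies in \<open>B\<close>, so the distance to the edge of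
      \<open>B\<close> is at least \<open>d\<close>, and the hypothesis at distance \<open>d\<close>
      is the weaker bound; sin d = cos (Im z - c) gives it the required form.\<close>
    define d where "d = pi/2 - \<bar>Im z - c\<bar>"
    have d: "0 < d" "d \<le> pi/2" using z by (auto simp: d_def horizontal_strip_def abs_if)
    have sd: "sin d = cos (Im z - c)" by (simp add: d_def cos_sin_eq[symmetric] sin_diff)
    have zB: "z \<in> B" using z c unfolding assms(1) by (auto simp: horizontal_strip_def)
    have e: "d \<le> edge_dist B z"
      unfolding assms(1) by (rule edge_dist_ge[OF ab d(1)]) (use c in \<open>auto simp: d_def abs_if\<close>)
    have spos: "sin d > 0" using d by (intro sin_gt_zero) (use pi_gt_zero in linarith)+
    have "(if edge_dist B z \<le> pi / 2 then (1 / (2 * sin (edge_dist B z)))^2 else 1 / 4) \<le> (1 / (2 * sin d))^2"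
    proof (cases "edge_dist B z \<le> pi/2")
      case True
      have "sin d \<le> sin (edge_dist B z)" by (rule sin_monotone_2pi_le) (use d e True in auto)
      then show ?thesis using True spos by (auto intro!: power_mono divide_left_mono)
    next
      case False
      have "1/2 \<le> 1 / (2 * sin d)" using spos sin_le_one[of d] by (simp add: field_simps)
      then have "(1/2)^2 \<le> (1 / (2 * sin d))^2" by (intro power_mono) auto
      then show ?thesis using False by (simp add: power2_eq_square)
    qed
    then show ?thesis using assms(4)[OF zB] by (simp add: q_def sd power_divide)
  qed
  have qhol: "q holomorphic_on horizontal_strip a b"
    unfolding q_def using assms(3) unfolding assms(1) by (intro holomorphic_intros) auto
  interpret hill_strip a b q
    by unfold_locales (use assms(2) qhol bound in auto)
  obtain y f1 f1' f2 f2' k where f: "hill_solution B q f1 f1'" "hill_solution B q f2 f2'"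
    "\<And>z. z \<in> B \<Longrightarrow> f1' z * f2 z - f1 z * f2' z = k" "k \<noteq> 0" 
    and nz: "\<And>z. z \<in> B \<Longrightarrow> f1 z \<noteq> 0 \<and> f2 z \<noteq> 0"
    and cont: "continuous_on (closed_strip a b) y"
    and dy: "\<And>z. z \<in> B \<Longrightarrow> (y has_field_derivative k / (f1 z * f2 z)) (at z)"
    and inj: "inj_on y (closed_strip (b - pi/2) b)" "inj_on y (closed_strip a (a + pi/2))"
    and lim: "filterlim (\<lambda>z. Re (y z)) at_bot (Re going_to at_bot within closed_strip a b)"
    "filterlim (\<lambda>z. Re (y z)) at_top (Re going_to at_top within closed_strip a b)"
    and pos: "\<And>z. Im z \<in> {a + pi/2..b - pi/2} \<Longrightarrow> Re (k / (f1 z * f2 z)) > 0"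
    by (rule log_ratio[folded assms(1)]) (rule that)
  have opB: "open B" and cvB: "convex B"
    unfolding assms(1) by (rule open_horizontal_strip convex_horizontal_strip)+
  have fhol: "(\<lambda>z. k / (f1 z * f2 z)) holomorphic_on B"
    using nz by (intro holomorphic_intros hill_solution_holomorphic[OF f(1)] hill_solution_holomorphic[OF f(2)]) auto
  \<comment> \<open>Within pi/2 of an edge injectivity comes from one substrip; every other point
    lies on the midline of a substrip, where Re y' > 0.\<close>
  interpret strip_graph a b "a + pi/2" "b - pi/2" y "\<lambda>z. k / (f1 z * f2 z)"
  proof
    show "a < a + pi/2" "b - pi/2 < b" using pi_gt_zero by linarith+
    show "a + pi/2 \<le> b - pi/2" using assms(2) by simp
    show "continuous_on (horizontal_strip a b) (\<lambda>z. k / (f1 z * f2 z))"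
      using holomorphic_on_imp_continuous_on[OF fhol] unfolding assms(1) .
  qed (use cont dy inj lim pos assms(1) in auto)
  have deriv_y: "deriv y z = k / (f1 z * f2 z)" if "z \<in> B" for z
    by (rule DERIV_imp_deriv[OF dy[OF that]])
  have yhol: "y holomorphic_on B"
    using dy unfolding holomorphic_on_def field_differentiable_def by (blast intro: has_field_derivative_at_within)
  have conf: "conformal_on B y"
    unfolding conformal_on_def using yhol deriv_y nz f(4) by auto
  obtain s where s: "s holomorphic_on B" "\<And>z. z \<in> B \<Longrightarrow> deriv y z = (s z)^2"
  proof (rule contractible_imp_holomorphic_sqrt)
    show "deriv y holomorphic_on B" by (rule holomorphic_deriv[OF yhol opB])
    show "contractible B" by (rule convex_imp_contractible[OF cvB])
    show "deriv y z \<noteq> 0" if "z \<in> B" for z using deriv_y[OF that] nz[OF that] f(4) by simp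
  qed blast
  have "liouville_transformation_on B p y"
    unfolding liouville_transformation_on_def
    by (intro exI[of _ s] conjI ballI s(1) liouville_of_solutions[OF opB f nz dy s(1)])
       (use s(2) in \<open>auto simp: q_def\<close>)
  moreover have "embedding_map (top_of_set (hat B)) euclidean (case_ext_plane (\<lambda>z. Fin (y z)) Minus_Inf Plus_Inf)"
    unfolding assms(1) by (rule embedding_hat[OF ab cont inj_on_closed_strip lim])
  ultimately show ?thesis using conf
    by (intro exI[of _ y] conjI exI[of _ "case_ext_plane (\<lambda>z. Fin (y z)) Minus_Inf Plus_Inf"]) auto
qed

end
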